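(* Let a switch turn a simplex-wise standard graph filtration $\mathcal F$ with $m$ additions into $\mathcal F'$, exchanging the consecutive additions of $\sigma$ (from $G_{i-1}$ to $G_i$) and $\tau$ (from $G_i$ to $G_{i+1}$). Let $\mathbb T$ be a stored forest and $\Pi$ a stored simplex pairing, initially equal to the merge forest $\mathsf{MF}(\mathcal F)$ and the pairing of $\mathcal F$. The following algorithm correctly updates the pairing and the merge forest, i.e. afterwards $\mathbb T$ represents $\mathsf{MF}(\mathcal F')$ and $\Pi$ is the pairing of $\mathcal F'$, and it takes $O(\log m)$ time (implemented with the data structures described in the context). **Algorithm.** (1) *One of $\sigma,\tau$ is a vertex and the other an edge:* make no change to $\Pi$ or to the structure of $\mathbb T$. (2) *$v_1:=\sigma$ and $v_2:=\tau$ are both vertices:* if $v_1,v_2$ are in the same tree of $\mathbb T$, let $e$ be the edge corresponding to their nearest common ancestor in $\mathbb T$. If, for both $a=1$ and $a=2$, $v_a$ is either unpaired in $\Pi$ or paired in $\Pi$ with an edge $\eta_a$ such that $\mathrm{idx}_{\mathcal F}(\eta_a)\ge \mathrm{idx}_{\mathcal F}(e)$, then swap the paired simplices of $v_1,v_2$ in $\Pi$ (if one of them is unpaired, the other becomes unpaired by the swap). Otherwise do not change $\Pi$. The structure of $\mathbb T$ is not changed. (3) *$e_1:=\sigma$ and $e_2:=\tau$ are both edges* (positivity and negativity are with respect to $\mathcal F$): - (3a) $e_1,e_2$ both positive: do nothing. - (3b) $e_1$ positive, $e_2$ negative: do nothing. - (3c) $e_1$ negative, $e_2$ positive: if $e_1$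 is in a 1-cycle in $G_{i+1}$, let the node of $\mathbb T$ corresponding to $e_1$ now correspond to $e_2$, let the vertex paired with $e_1$ in $\Pi$ now be paired with $e_2$, and let $e_1$ be unpaired. Otherwise do nothing. - (3d) $e_1,e_2$ both negative: if the node of $e_1$ is not a child of the node of $e_2$ in $\mathbb T$, do nothing. Otherwise let $T_1,T_2$ be the subtrees rooted at the two children of $e_1$, and $T_3$ the subtree rooted at the child of $e_2$ other than $e_1$; let $C_1,C_2,C_3$ be the connected components of $G_{i-1}$ corresponding to $T_1,T_2,T_3$; and let $u,v,w$ be the leaves at the lowest (smallest) levels in $T_1,T_2,T_3$ respectively, where without loss of generality $\mathrm{idx}_{\mathcal F}(v)<\mathrm{idx}_{\mathcal F}(u)$. (The edge $e_1$ connects $C_1$ and $C_2$, while $e_2$ directly connects either $C_2,C_3$ or $C_1,C_3$.) - If $e_2$ directly connects $C_2,C_3$: let the roots of $T_2,T_3$ be the children of $e_2$, and let $e_2$ and the root of $T_1$ be the children of $e_1$ in $\mathbb T$. Do not change $\Pi$. - If $e_2$ directly connects $C_1,C_3$: let the roots of $T_1,T_3$ be the children of $e_2$, and let $e_2$ and the root of $T_2$ be the children of $e_1$ in $\mathbb T$. Moreover, if $\mathrm{idx}_{\mathcal F}(w)<\mathrm{idx}_{\mathcal F}(u)$, swap the paired vertices of $e_1,e_2$ in $\Pi$. - In both sub-cases, if $e_2$ had a parent in $\mathbb T$, that parent now becomes the parent of $e_1$. In all cases, also update the levels of the leaves of $\mathbb T$ corresponding to $\sigma$ and $\tau$ (if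 such leaves exist) to their indices in $\mathcal F'$.
   Context: **Filtrations.** A simplex-wise standard graph filtration is a sequence of finite simple graphs $\mathcal F:\emptyset=G_0\hookrightarrow G_1\hookrightarrow\cdots\hookrightarrow G_m$ in which $G_{j+1}$ is obtained from $G_j$ by adding a single simplex $\sigma_j$ (a vertex, or an edge whose endpoints are in $G_j$). The index of $\sigma_j$ is $\mathrm{idx}_{\mathcal F}(\sigma_j)=j$; a simplex is older (younger) than another if its index is smaller (larger). **Pairing.** Vertices are positive. An edge $\sigma_j=(u,v)$ is positive if $u,v$ are in the same connected component of $G_j$ and negative otherwise. Each negative edge $\sigma_j$, merging two components $C_1,C_2$ of $G_j$, is paired with the younger one among the oldest vertex of $C_1$ and the oldest vertex of $C_2$. Positive edges, and vertices not paired with any edge, are unpaired. (This is the usual persistence pairing.) **Merge forest.** $\mathsf{MF}(\mathcal F)$ is the rooted forest whose leaves correspond to the vertices in $\mathcal F$ and whose internal nodes correspond to the negative edges in $\mathcal F$, each node having as level the index of its simplex. It is built inductively, with $\mathsf{MF}^0(\mathcal F)=\emptyset$ and $\mathsf{MF}(\mathcal F)=\mathsf{MF}^m(\mathcal F)$: if $\sigma_j$ is a vertex, $\mathsf{MF}^{j+1}(\mathcal F)$ is $\mathsf{MF}^{j}(\mathcal F)$ plus an isolated leaf at level $j$; if $\sigma_j$ is a positive edge, $\mathsf{MF}^{j+1}(\mathcal F)=\mathsf{MF}^{j}(\mathcal F)$; if $\sigma_j$ is a negative edge merging components $C_1,C_2$ of $G_j$, corresponding to trees $T_1,T_2$ of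 $\mathsf{MF}^j(\mathcal F)$, one adds an internal node at level $j$ whose children are the roots of $T_1$ and $T_2$. (Trees of $\mathsf{MF}^j(\mathcal F)$ correspond bijectively to connected components of $G_j$.) A simplex and its node are identified; the level of an internal node is the index of its edge in the current filtration. **Switch.** A switch replaces $\mathcal F:\emptyset=G_0\hookrightarrow\cdots\hookrightarrow G_{i-1}\overset{\sigma}{\hookrightarrow}G_i\overset{\tau}{\hookrightarrow}G_{i+1}\hookrightarrow\cdots\hookrightarrow G_m$ by $\mathcal F':\emptyset=G_0\hookrightarrow\cdots\hookrightarrow G_{i-1}\overset{\tau}{\hookrightarrow}G'_i\overset{\sigma}{\hookrightarrow}G_{i+1}\hookrightarrow\cdots\hookrightarrow G_m$; it is required that $\sigma\not\subseteq\tau$ ($\sigma$ is not an endpoint of the edge $\tau$). **Data structures.** The algorithm keeps the following for the current filtration. - $\mathbb T$ is stored as a Depth First Tour Tree (DFT-Tree) of Farina and Laura, which supports in $O(\log N)$ time ($N$ the number of nodes): finding the root of the tree containing a node; cutting a node from its parent; making the root of a tree a child of a given node; nearest common ancestor; changing the value (here: the level) of a leaf; and finding the leaf of minimum value in the subtree rooted at a node. - The minimum spanning forest (MSF) of $G:=G_m$, with each edge weighted by its index in the filtration, is stored as a Link-Cut tree, which supports in $O(\log m)$ time inserting and deleting edges and finding the bottleneck (maximum) edge weight on the path between two vertices. The test in (3c) is done as follows: for $e_2=(x,y)$, $e_1$ is in a 1-cycle in $G_{i+1}$ if and only if the bottleneck weight of the path between $x$ and $y$ in the MSF of $G$ equals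 $i-1$, the weight of $e_1$. The two configurations in (3d) are distinguished by whether $u$ and $w$ are connected in $G'_i$ (if so, $e_2$ directly connects $C_1,C_3$; otherwise $C_2,C_3$), which is again decided by a bottleneck weight query: the index of the first graph of a filtration in which two vertices are connected is one plus the bottleneck weight of the path between them in the MSF. The MSF is updated at a switch as follows: in case (3c) with $e_1$ in a 1-cycle in $G_{i+1}$, $e_1$ is cut and $e_2$ is linked; in all other cases the structure of the MSF is unchanged and only the weights of those of $\sigma,\tau$ that are edges in the MSF are updated (by cutting and re-linking). *)

theory Defs
  imports
    Complex_Main
    "HOL-Library.Landau_Symbols"
    "HOL-Library.State_Monad"
    "HOL-Combinatorics.Transposition"
begin

section \<open>Graph filtrations\<close>

text \<open>
  Simplices are sets of points: \<open>{x}\<close> is a vertex and \<open>{x, y}\<close> with \<open>x \<noteq> y\<close> is an edge.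
  A graph is the set of its simplices.  A filtration is the list of the simplices in the order
  in which they are added, so that \<open>G\<^sub>j\<close> consists of the first \<open>j\<close> entries.
\<close>

type_synonym 'v simplex = "'v set"

definition is_vertex :: "'v simplex \<Rightarrow> bool" where
  "is_vertex s \<longleftrightarrow> (\<exists>x. s = {x})"

definition is_edge :: "'v simplex \<Rightarrow> bool" where
  "is_edge s \<longleftrightarrow> (\<exists>x y. x \<noteq> y \<and> s = {x, y})"

definition verts :: "'v simplex set \<Rightarrow> 'v set" where
  "verts G = {x. {x} \<in> G}"

definition edges :: "'v simplex set \<Rightarrow> 'v simplex set" where
  "edges G = {e \<in> G. is_edge e}"

definition graph_at :: "'v simplex list \<Rightarrow> nat \<Rightarrow> 'v simplex set" where
  "graph_at F j = set (take j F)"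

definition filtration :: "'v simplex list \<Rightarrow> bool" where
  "filtration F \<longleftrightarrow> distinct F \<and>
     (\<forall>j<length F. is_vertex (F ! j) \<or> (is_edge (F ! j) \<and> F ! j \<subseteq> verts (graph_at F j)))"

definition idx :: "'v simplex list \<Rightarrow> 'v simplex \<Rightarrow> nat" where
  "idx F s = (THE j. j < length F \<and> F ! j = s)"

text \<open>
  A vertex \<open>{x} \<in> G\<close> contributes only a loop at \<open>x\<close>, so the same notion applies to graphs and to
  bare edge sets.
\<close>

definition connected_in :: "'v simplex set \<Rightarrow> 'v \<Rightarrow> 'v \<Rightarrow> bool" where
  "connected_in G x y \<longleftrightarrow> (x, y) \<in> {(a, b). {a, b} \<in> G}\<^sup>*"

definition component :: "'v simplex set \<Rightarrow> 'v \<Rightarrow> 'v set" where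
  "component G x = {y. connected_in G x y}"

text \<open>One-dimensional cycles with coefficients in the field with two elements.\<close>

definition one_cycle :: "'v simplex set \<Rightarrow> 'v simplex set \<Rightarrow> bool" where
  "one_cycle E c \<longleftrightarrow> finite c \<and> c \<subseteq> E \<and> (\<forall>x. even (card {e \<in> c. x \<in> e}))"

definition in_one_cycle :: "'v simplex set \<Rightarrow> 'v simplex \<Rightarrow> bool" where
  "in_one_cycle G e \<longleftrightarrow> (\<exists>c. one_cycle (edges G) c \<and> e \<in> c)"

definition switch :: "'v simplex list \<Rightarrow> nat \<Rightarrow> 'v simplex list" where
  "switch F i = F[i - 1 := F ! i, i := F ! (i - 1)]"

definition switchable :: "'v simplex list \<Rightarrow> nat \<Rightarrow> bool" where
  "switchable F i \<longleftrightarrow> filtration F \<and> 1 \<le> i \<and> i < length F \<and> \<not> F ! (i - 1) \<subseteq> F ! i"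


section \<open>Pairing\<close>

definition positive :: "'v simplex list \<Rightarrow> 'v simplex \<Rightarrow> bool" where
  "positive F e \<longleftrightarrow> e \<in> set F \<and> is_edge e \<and>
     (\<exists>x y. e = {x, y} \<and> connected_in (graph_at F (idx F e)) x y)"

definition negative :: "'v simplex list \<Rightarrow> 'v simplex \<Rightarrow> bool" where
  "negative F e \<longleftrightarrow> e \<in> set F \<and> is_edge e \<and>
     (\<exists>x y. e = {x, y} \<and> \<not> connected_in (graph_at F (idx F e)) x y)"

definition oldest :: "'v simplex list \<Rightarrow> 'v set \<Rightarrow> 'v simplex" where
  "oldest F C = {ARG_MIN (\<lambda>x. idx F {x}) x. x \<in> C}"

definition younger :: "'v simplex list \<Rightarrow> 'v simplex \<Rightarrow> 'v simplex \<Rightarrow> 'v simplex" where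
  "younger F s t = (if idx F s < idx F t then t else s)"

type_synonym 'v pairing = "('v simplex \<times> 'v simplex) set"

definition pairing :: "'v simplex list \<Rightarrow> 'v pairing" where
  "pairing F = {(s, e). negative F e \<and>
     (\<exists>x y. e = {x, y} \<and>
        s = younger F (oldest F (component (graph_at F (idx F e)) x))
                      (oldest F (component (graph_at F (idx F e)) y)))}"


section \<open>Rooted forests and the merge forest\<close>

text \<open>The nodes of a forest are the elements of the domain of \<open>level\<close>.\<close>

record 'a forest =
  parent :: "'a \<rightharpoonup> 'a"
  level :: "'a \<rightharpoonup> nat"

definition nodes :: "'a forest \<Rightarrow> 'a set" where
  "nodes T = dom (level T)"

definition children :: "'a forest \<Rightarrow> 'a \<Rightarrow> 'a set" where
  "children T x = {y. parent T y = Some x}"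

definition is_leaf :: "'a forest \<Rightarrow> 'a \<Rightarrow> bool" where
  "is_leaf T x \<longleftrightarrow> x \<in> nodes T \<and> children T x = {}"

definition ancestor :: "'a forest \<Rightarrow> 'a \<Rightarrow> 'a \<Rightarrow> bool" where
  "ancestor T z x \<longleftrightarrow> (x, z) \<in> {(a, b). parent T a = Some b}\<^sup>*"

definition leaves :: "'a forest \<Rightarrow> 'a \<Rightarrow> 'a set" where
  "leaves T x = {y. is_leaf T y \<and> ancestor T x y}"

definition root_of :: "'a forest \<Rightarrow> 'a \<Rightarrow> 'a" where
  "root_of T x = (THE r. ancestor T r x \<and> parent T r = None)"

definition same_tree :: "'a forest \<Rightarrow> 'a \<Rightarrow> 'a \<Rightarrow> bool" where
  "same_tree T x y \<longleftrightarrow> root_of T x = root_of T y"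

definition nca :: "'a forest \<Rightarrow> 'a \<Rightarrow> 'a \<Rightarrow> 'a" where
  "nca T x y = (THE z. ancestor T z x \<and> ancestor T z y \<and>
                  (\<forall>z'. ancestor T z' x \<and> ancestor T z' y \<longrightarrow> ancestor T z' z))"

definition is_lowest_leaf :: "'a forest \<Rightarrow> 'a \<Rightarrow> 'a \<Rightarrow> bool" where
  "is_lowest_leaf T x l \<longleftrightarrow>
     l \<in> leaves T x \<and> (\<forall>l' \<in> leaves T x. the (level T l) \<le> the (level T l'))"

definition lowest_leaf :: "'a forest \<Rightarrow> 'a \<Rightarrow> 'a" where
  "lowest_leaf T x = (THE l. is_lowest_leaf T x l)"

definition component_of_node :: "'v simplex forest \<Rightarrow> 'v simplex \<Rightarrow> 'v set" where
  "component_of_node T r = {x. {x} \<in> leaves T r}"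

definition root_of_component :: "'v simplex forest \<Rightarrow> 'v set \<Rightarrow> 'v simplex" where
  "root_of_component T C =
     (THE r. r \<in> nodes T \<and> parent T r = None \<and> component_of_node T r = C)"

primrec MF_upto :: "'v simplex list \<Rightarrow> nat \<Rightarrow> 'v simplex forest" where
  "MF_upto F 0 = \<lparr>parent = Map.empty, level = Map.empty\<rparr>"
| "MF_upto F (Suc j) =
     (let M = MF_upto F j; s = F ! j in
      if is_vertex s then M\<lparr>level := (level M)(s \<mapsto> j)\<rparr>
      else if negative F s then
        \<lparr>parent = (\<lambda>r. if \<exists>x\<in>s. r = root_of_component M (component (graph_at F j) x)
                        then Some s else parent M r),
         level = (level M)(s \<mapsto> j)\<rparr>
      else M)"

definition MF :: "'v simplex list \<Rightarrow> 'v simplex forest" where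
  "MF F = MF_upto F (length F)"


section \<open>The update algorithm\<close>

definition update_vertices ::
  "'v simplex list \<Rightarrow> nat \<Rightarrow> 'v simplex forest \<times> 'v pairing \<Rightarrow> 'v simplex forest \<times> 'v pairing" where
  "update_vertices F i = (\<lambda>(T, P).
     let v1 = F ! (i - 1); v2 = F ! i; e = nca T v1 v2 in
     if same_tree T v1 v2 \<and>
        (\<forall>v\<in>{v1, v2}. \<forall>h. (v, h) \<in> P \<longrightarrow> idx F h \<ge> idx F e)
     then (T, (\<lambda>(v, h). (transpose v1 v2 v, h)) ` P)
     else (T, P))"

text \<open>
  The positive edge \<open>e2\<close> has neither a node nor a partner, so transposing it with \<open>e1\<close> amounts to
  replacing \<open>e1\<close> by \<open>e2\<close>.
\<close>

definition update_negative_positive ::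
  "'v simplex list \<Rightarrow> nat \<Rightarrow> 'v simplex forest \<times> 'v pairing \<Rightarrow> 'v simplex forest \<times> 'v pairing" where
  "update_negative_positive F i = (\<lambda>(T, P).
     let e1 = F ! (i - 1); e2 = F ! i; f = transpose e1 e2 in
     if in_one_cycle (graph_at F (i + 1)) e1
     then (\<lparr>parent = (\<lambda>x. map_option f (parent T (f x))), level = (\<lambda>x. level T (f x))\<rparr>,
           (\<lambda>(v, h). (v, f h)) ` P)
     else (T, P))"

definition directly_connects :: "'v simplex \<Rightarrow> 'v set \<Rightarrow> 'v set \<Rightarrow> bool" where
  "directly_connects e C C' \<longleftrightarrow> (\<exists>x\<in>C. \<exists>y\<in>C'. e = {x, y})"

text \<open>
  The pair \<open>(r1, r2)\<close> of roots is the ordering of the two children of \<open>e1\<close> for which the lowest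
  leaf below \<open>r2\<close> is the older one.
\<close>

definition update_negatives ::
  "'v simplex list \<Rightarrow> nat \<Rightarrow> 'v simplex forest \<times> 'v pairing \<Rightarrow> 'v simplex forest \<times> 'v pairing" where
  "update_negatives F i = (\<lambda>(T, P).
     let e1 = F ! (i - 1); e2 = F ! i in
     if parent T e1 \<noteq> Some e2 then (T, P)
     else
       let (r1, r2) = (THE (r1, r2). children T e1 = {r1, r2} \<and>
                          idx F (lowest_leaf T r2) < idx F (lowest_leaf T r1));
           r3 = (THE r. r \<in> children T e2 \<and> r \<noteq> e1);
           u = lowest_leaf T r1;
           w = lowest_leaf T r3;
           C1 = component_of_node T r1;
           C2 = component_of_node T r2;
           C3 = component_of_node T r3
       in
         if directly_connects e2 C2 C3 then
           (T\<lparr>parent := (parent T)(r2 \<mapsto> e2, r3 \<mapsto> e2, e2 \<mapsto> e1, r1 \<mapsto> e1, e1 := parent T e2)\<rparr>, P)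
         else if directly_connects e2 C1 C3 then
           (T\<lparr>parent := (parent T)(r1 \<mapsto> e2, r3 \<mapsto> e2, e2 \<mapsto> e1, r2 \<mapsto> e1, e1 := parent T e2)\<rparr>,
            if idx F w < idx F u then (\<lambda>(v, h). (v, transpose e1 e2 h)) ` P else P)
         else (T, P))"

text \<open>
  Leaf levels are stored and only those of the two switched simplices are changed.  The level of
  an internal node is by convention the index of its edge in the current filtration.
\<close>

definition update_levels ::
  "'v simplex list \<Rightarrow> nat \<Rightarrow> 'v simplex forest \<Rightarrow> 'v simplex forest" where
  "update_levels F i T = T\<lparr>level := (\<lambda>x.
     if x \<notin> nodes T then None
     else if is_leaf T x \<and> x \<notin> {F ! (i - 1), F ! i} then level T x
     else Some (idx (switch F i) x))\<rparr>"

definition update ::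
  "'v simplex list \<Rightarrow> nat \<Rightarrow> 'v simplex forest \<times> 'v pairing \<Rightarrow> 'v simplex forest \<times> 'v pairing" where
  "update F i TP =
     (let s = F ! (i - 1); t = F ! i in
      apfst (update_levels F i)
       (if is_vertex s \<and> is_vertex t then update_vertices F i TP
        else if is_edge s \<and> is_edge t then
          (if negative F s \<and> positive F t then update_negative_positive F i TP
           else if negative F s \<and> negative F t then update_negatives F i TP
           else TP)
        else TP))"


section \<open>Data structures\<close>

text \<open>
  A data structure is given by a representation relation between its states and the abstract
  objects, and by operations that take a state and return a result, a new state (queries may
  restructure the state) and the time used.
\<close>

definition performs :: "('s \<Rightarrow> bool) \<Rightarrow> ('r \<Rightarrow> bool) \<Rightarrow> real \<Rightarrow> 'r \<times> 's \<times> nat \<Rightarrow> bool" where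
  "performs S R b out \<longleftrightarrow> (case out of (r, s, t) \<Rightarrow> R r \<and> S s \<and> real t \<le> b)"

subsection \<open>Depth First Tour Trees\<close>

text \<open>
  Only the levels of leaves are observable through the operations; those of internal nodes are
  arbitrary.
\<close>

record ('n, 'd) dft_ops =
  dft_rep :: "'d \<Rightarrow> 'n forest \<Rightarrow> bool"
  dft_root :: "'n \<Rightarrow> 'd \<Rightarrow> 'n \<times> 'd \<times> nat"
  dft_cut :: "'n \<Rightarrow> 'd \<Rightarrow> unit \<times> 'd \<times> nat"
  dft_link :: "'n \<Rightarrow> 'n \<Rightarrow> 'd \<Rightarrow> unit \<times> 'd \<times> nat"
  dft_nca :: "'n \<Rightarrow> 'n \<Rightarrow> 'd \<Rightarrow> 'n \<times> 'd \<times> nat"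
  dft_set_level :: "'n \<Rightarrow> nat \<Rightarrow> 'd \<Rightarrow> unit \<times> 'd \<times> nat"
  dft_lowest_leaf :: "'n \<Rightarrow> 'd \<Rightarrow> 'n \<times> 'd \<times> nat"

definition dft_tree :: "('n, 'd) dft_ops \<Rightarrow> bool" where
  "dft_tree D \<longleftrightarrow> (\<exists>b :: nat \<Rightarrow> real. b \<in> O(\<lambda>N. ln (real N)) \<and>
     (\<forall>d T. dft_rep D d T \<longrightarrow>
        (\<forall>x\<in>nodes T.
           performs (\<lambda>d'. dft_rep D d' T) (\<lambda>r. r = root_of T x)
             (b (card (nodes T))) (dft_root D x d)) \<and>
        (\<forall>x\<in>nodes T. parent T x \<noteq> None \<longrightarrow>
           performs (\<lambda>d'. dft_rep D d' (T\<lparr>parent := (parent T)(x := None)\<rparr>)) (\<lambda>_. True)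
             (b (card (nodes T))) (dft_cut D x d)) \<and>
        (\<forall>r\<in>nodes T. \<forall>x\<in>nodes T. parent T r = None \<and> root_of T x \<noteq> r \<longrightarrow>
           performs (\<lambda>d'. dft_rep D d' (T\<lparr>parent := (parent T)(r \<mapsto> x)\<rparr>)) (\<lambda>_. True)
             (b (card (nodes T))) (dft_link D r x d)) \<and>
        (\<forall>x\<in>nodes T. \<forall>y\<in>nodes T. same_tree T x y \<longrightarrow>
           performs (\<lambda>d'. dft_rep D d' T) (\<lambda>r. r = nca T x y)
             (b (card (nodes T))) (dft_nca D x y d)) \<and>
        (\<forall>x k. is_leaf T x \<longrightarrow>
           performs (\<lambda>d'. dft_rep D d' (T\<lparr>level := (level T)(x \<mapsto> k)\<rparr>)) (\<lambda>_. True)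
             (b (card (nodes T))) (dft_set_level D x k d)) \<and>
        (\<forall>x\<in>nodes T.
           performs (\<lambda>d'. dft_rep D d' T) (is_lowest_leaf T x)
             (b (card (nodes T))) (dft_lowest_leaf D x d))))"

subsection \<open>Link-cut trees\<close>

definition simple_path :: "'v simplex set \<Rightarrow> 'v \<Rightarrow> 'v \<Rightarrow> 'v list \<Rightarrow> bool" where
  "simple_path E x y p \<longleftrightarrow> p \<noteq> [] \<and> hd p = x \<and> last p = y \<and> distinct p \<and>
     (\<forall>k. Suc k < length p \<longrightarrow> {p ! k, p ! Suc k} \<in> E)"

definition path_edges :: "'v list \<Rightarrow> 'v simplex set" where
  "path_edges p = {{p ! k, p ! Suc k} | k. Suc k < length p}"

definition bottleneck :: "('v simplex \<rightharpoonup> nat) \<Rightarrow> 'v \<Rightarrow> 'v \<Rightarrow> nat" where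
  "bottleneck W x y = Max ((\<lambda>e. the (W e)) ` path_edges (THE p. simple_path (dom W) x y p))"

text \<open>
  A weighted forest is given by its set \<open>V\<close> of vertices and a map \<open>W\<close> from its edges to their
  weights.  The number \<open>m\<close> in the time bound is any upper bound on the size of the forest, such as
  the length of a filtration of which it is a spanning forest.
\<close>

record ('v, 'l) lct_ops =
  lct_rep :: "'l \<Rightarrow> 'v set \<Rightarrow> ('v simplex \<rightharpoonup> nat) \<Rightarrow> bool"
  lct_link :: "'v \<Rightarrow> 'v \<Rightarrow> nat \<Rightarrow> 'l \<Rightarrow> unit \<times> 'l \<times> nat"
  lct_cut :: "'v \<Rightarrow> 'v \<Rightarrow> 'l \<Rightarrow> unit \<times> 'l \<times> nat"
  lct_bottleneck :: "'v \<Rightarrow> 'v \<Rightarrow> 'l \<Rightarrow> nat \<times> 'l \<times> nat"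

definition link_cut_tree :: "('v, 'l) lct_ops \<Rightarrow> bool" where
  "link_cut_tree L \<longleftrightarrow> (\<exists>b :: nat \<Rightarrow> real. b \<in> O(\<lambda>m. ln (real m)) \<and>
     (\<forall>l V W m. lct_rep L l V W \<and> card V + card (dom W) \<le> m \<longrightarrow>
        (\<forall>x\<in>V. \<forall>y\<in>V. \<forall>k. \<not> connected_in (dom W) x y \<longrightarrow>
           performs (\<lambda>l'. lct_rep L l' V (W({x, y} \<mapsto> k))) (\<lambda>_. True)
             (b m) (lct_link L x y k l)) \<and>
        (\<forall>x\<in>V. \<forall>y\<in>V. {x, y} \<in> dom W \<longrightarrow>
           performs (\<lambda>l'. lct_rep L l' V (W({x, y} := None))) (\<lambda>_. True)
             (b m) (lct_cut L x y l)) \<and>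
        (\<forall>x\<in>V. \<forall>y\<in>V. x \<noteq> y \<and> connected_in (dom W) x y \<longrightarrow>
           performs (\<lambda>l'. lct_rep L l' V W) (\<lambda>r. r = bottleneck W x y)
             (b m) (lct_bottleneck L x y l))))"

definition spanning_forest :: "'v simplex set \<Rightarrow> 'v simplex set \<Rightarrow> bool" where
  "spanning_forest G S \<longleftrightarrow> S \<subseteq> edges G \<and> (\<forall>c. one_cycle S c \<longrightarrow> c = {}) \<and>
     (\<forall>x\<in>verts G. \<forall>y\<in>verts G. connected_in S x y \<longleftrightarrow> connected_in G x y)"

definition minimum_spanning_forest ::
  "('v simplex \<Rightarrow> nat) \<Rightarrow> 'v simplex set \<Rightarrow> 'v simplex set \<Rightarrow> bool" where
  "minimum_spanning_forest w G S \<longleftrightarrow> spanning_forest G S \<and>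
     (\<forall>S'. spanning_forest G S' \<longrightarrow> sum w S \<le> sum w S')"


section \<open>Implementation\<close>

text \<open>
  Nodes of the stored forest are handles of type \<open>'n\<close>; \<open>simplex_of\<close> and \<open>node_of\<close> are the
  correspondence with simplices.  Besides the Depth First Tour Tree, each node has pointers to its
  parent and to its two children.
\<close>

record ('v, 'n, 'd, 'l) memory =
  simplex_at :: "nat \<Rightarrow> 'v simplex"
  index_of :: "'v simplex \<Rightarrow> nat"
  endpoints :: "'v simplex \<Rightarrow> 'v \<times> 'v"
  partner :: "'v simplex \<Rightarrow> 'v simplex option"
  node_of :: "'v simplex \<Rightarrow> 'n option"
  simplex_of :: "'n \<Rightarrow> 'v simplex"
  parent_ptr :: "'n \<Rightarrow> 'n option"
  child_ptrs :: "'n \<Rightarrow> ('n \<times> 'n) option"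
  dft :: 'd
  lct :: 'l

definition represents :: "('n \<Rightarrow> 'v simplex) \<Rightarrow> 'n forest \<Rightarrow> 'v simplex forest \<Rightarrow> bool" where
  "represents lab A T \<longleftrightarrow> bij_betw lab (nodes A) (nodes T) \<and>
     (\<forall>n p. parent A n = Some p \<longrightarrow> n \<in> nodes A \<and> p \<in> nodes A) \<and>
     (\<forall>n\<in>nodes A. map_option lab (parent A n) = parent T (lab n)) \<and>
     (\<forall>n. is_leaf A n \<longrightarrow> level A n = level T (lab n))"

text \<open>
  The levels of internal nodes are not stored in the Depth First Tour Tree but read off from
  \<open>index_of\<close>.
\<close>

definition stores ::
  "('n, 'd) dft_ops \<Rightarrow> ('v, 'l) lct_ops \<Rightarrow> 'v simplex list \<Rightarrow> ('v, 'n, 'd, 'l) memory \<Rightarrow> bool" where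
  "stores D L F M \<longleftrightarrow>
     (\<forall>j<length F. simplex_at M j = F ! j) \<and>
     (\<forall>s\<in>set F. index_of M s = idx F s \<and>
        s = {fst (endpoints M s), snd (endpoints M s)} \<and>
        (\<forall>t. partner M s = Some t \<longleftrightarrow> (s, t) \<in> pairing F \<or> (t, s) \<in> pairing F)) \<and>
     (\<exists>A. dft_rep D (dft M) A \<and> represents (simplex_of M) A (MF F) \<and>
        (\<forall>s\<in>set F. \<forall>n. node_of M s = Some n \<longleftrightarrow> n \<in> nodes A \<and> simplex_of M n = s) \<and>
        (\<forall>n\<in>nodes A. parent_ptr M n = parent A n \<and>
           (case child_ptrs M n of
              None \<Rightarrow> children A n = {}
            | Some (a, b) \<Rightarrow> a \<noteq> b \<and> children A n = {a, b})) \<and>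
        (\<forall>n\<in>nodes A. level (MF F) (simplex_of M n) = Some (index_of M (simplex_of M n)))) \<and>
     (\<exists>W. lct_rep L (lct M) (verts (set F)) W \<and>
        minimum_spanning_forest (idx F) (set F) (dom W) \<and>
        (\<forall>e\<in>dom W. W e = Some (idx F e)))"

text \<open>
  Programs act on the memory and a clock.  Reading or writing one cell of a table takes one unit
  of time, and a call of an operation of a data structure takes the time reported by it.
\<close>

type_synonym ('v, 'n, 'd, 'l, 'a) prog = "(('v, 'n, 'd, 'l) memory \<times> nat, 'a) state"

definition look ::
  "(('v, 'n, 'd, 'l) memory \<Rightarrow> 'k \<Rightarrow> 'a) \<Rightarrow> 'k \<Rightarrow> ('v, 'n, 'd, 'l, 'a) prog" where
  "look table k = State (\<lambda>(M, t). (table M k, (M, t + 1)))"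

definition store ::
  "((('k \<Rightarrow> 'a) \<Rightarrow> 'k \<Rightarrow> 'a) \<Rightarrow> ('v, 'n, 'd, 'l) memory \<Rightarrow> ('v, 'n, 'd, 'l) memory) \<Rightarrow>
   'k \<Rightarrow> 'a \<Rightarrow> ('v, 'n, 'd, 'l, unit) prog" where
  "store table_update k a = State (\<lambda>(M, t). ((), (table_update (\<lambda>f. f(k := a)) M, t + 1)))"

definition on_dft :: "('d \<Rightarrow> 'a \<times> 'd \<times> nat) \<Rightarrow> ('v, 'n, 'd, 'l, 'a) prog" where
  "on_dft f = State (\<lambda>(M, t). case f (dft M) of (a, d, c) \<Rightarrow> (a, (M\<lparr>dft := d\<rparr>, t + c)))"

definition on_lct :: "('l \<Rightarrow> 'a \<times> 'l \<times> nat) \<Rightarrow> ('v, 'n, 'd, 'l, 'a) prog" where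
  "on_lct f = State (\<lambda>(M, t). case f (lct M) of (a, l, c) \<Rightarrow> (a, (M\<lparr>lct := l\<rparr>, t + c)))"

abbreviation skip :: "('v, 'n, 'd, 'l, unit) prog" where
  "skip \<equiv> State_Monad.return ()"

definition when_prog ::
  "bool \<Rightarrow> ('v, 'n, 'd, 'l, unit) prog \<Rightarrow> ('v, 'n, 'd, 'l, unit) prog" where
  "when_prog c p = (if c then p else skip)"

definition get_node :: "'v simplex \<Rightarrow> ('v, 'n, 'd, 'l, 'n) prog" where
  "get_node s = do { n \<leftarrow> look node_of s; State_Monad.return (the n) }"

definition cut_msf :: "('v, 'l) lct_ops \<Rightarrow> 'v simplex \<Rightarrow> ('v, 'n, 'd, 'l, unit) prog" where
  "cut_msf L e = do { (x, y) \<leftarrow> look endpoints e; on_lct (lct_cut L x y) }"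

definition link_msf :: "('v, 'l) lct_ops \<Rightarrow> 'v simplex \<Rightarrow> nat \<Rightarrow> ('v, 'n, 'd, 'l, unit) prog" where
  "link_msf L e k = do { (x, y) \<leftarrow> look endpoints e; on_lct (lct_link L x y k) }"

definition reweigh_msf ::
  "('v, 'l) lct_ops \<Rightarrow> 'v simplex \<Rightarrow> nat \<Rightarrow> ('v, 'n, 'd, 'l, unit) prog" where
  "reweigh_msf L e k = do { cut_msf L e; link_msf L e k }"

definition swap_partners :: "'v simplex \<Rightarrow> 'v simplex \<Rightarrow> ('v, 'n, 'd, 'l, unit) prog" where
  "swap_partners s t = do {
     p \<leftarrow> look partner s;
     q \<leftarrow> look partner t;
     store partner_update s q;
     store partner_update t p;
     (case p of None \<Rightarrow> skip | Some a \<Rightarrow> store partner_update a (Some t));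
     (case q of None \<Rightarrow> skip | Some a \<Rightarrow> store partner_update a (Some s))
   }"

definition late_partner :: "nat \<Rightarrow> 'v simplex \<Rightarrow> ('v, 'n, 'd, 'l, bool) prog" where
  "late_partner k v = do {
     p \<leftarrow> look partner v;
     (case p of
        None \<Rightarrow> State_Monad.return True
      | Some h \<Rightarrow> do { j \<leftarrow> look index_of h; State_Monad.return (j \<ge> k) })
   }"

definition run_vertices ::
  "('n, 'd) dft_ops \<Rightarrow> 'v simplex \<Rightarrow> 'v simplex \<Rightarrow> ('v, 'n, 'd, 'l, unit) prog" where
  "run_vertices D v1 v2 = do {
     n1 \<leftarrow> get_node v1;
     n2 \<leftarrow> get_node v2;
     r1 \<leftarrow> on_dft (dft_root D n1);
     r2 \<leftarrow> on_dft (dft_root D n2);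
     when_prog (r1 = r2) (do {
       n \<leftarrow> on_dft (dft_nca D n1 n2);
       e \<leftarrow> look simplex_of n;
       k \<leftarrow> look index_of e;
       c1 \<leftarrow> late_partner k v1;
       c2 \<leftarrow> late_partner k v2;
       when_prog (c1 \<and> c2) (swap_partners v1 v2)
     })
   }"

definition run_negative_positive ::
  "('v, 'l) lct_ops \<Rightarrow> nat \<Rightarrow> 'v simplex \<Rightarrow> 'v simplex \<Rightarrow> ('v, 'n, 'd, 'l, unit) prog" where
  "run_negative_positive L i e1 e2 = do {
     (x, y) \<leftarrow> look endpoints e2;
     b \<leftarrow> on_lct (lct_bottleneck L x y);
     (if b = i - 1 then do {
        n \<leftarrow> get_node e1;
        store simplex_of_update n e2;
        store node_of_update e2 (Some n);
        store node_of_update e1 None;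
        swap_partners e1 e2;
        cut_msf L e1;
        link_msf L e2 (i - 1)
      }
      else reweigh_msf L e1 i)
   }"

text \<open>
  Here \<open>n1\<close> is a child of \<open>n2\<close>, the other child of \<open>n2\<close> is \<open>r3\<close>, and the children of \<open>n1\<close> are \<open>r\<close>
  and \<open>r'\<close>.  Afterwards \<open>r\<close> and \<open>r3\<close> are the children of \<open>n2\<close>, and \<open>n2\<close> and \<open>r'\<close> are the children
  of \<open>n1\<close>, which takes the place of \<open>n2\<close> below the former parent of \<open>n2\<close>.
\<close>

definition rotate_nodes ::
  "('n, 'd) dft_ops \<Rightarrow> 'n \<Rightarrow> 'n \<Rightarrow> 'n \<Rightarrow> 'n \<Rightarrow> 'n \<Rightarrow> ('v, 'n, 'd, 'l, unit) prog" where
  "rotate_nodes D n1 n2 r r' r3 = do {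
     q \<leftarrow> look parent_ptr n2;
     on_dft (dft_cut D n1);
     on_dft (dft_cut D r);
     on_dft (dft_link D r n2);
     (case q of
        None \<Rightarrow> skip
      | Some p \<Rightarrow> do {
          on_dft (dft_cut D n2);
          on_dft (dft_link D n1 p);
          ab \<leftarrow> look child_ptrs p;
          (case the ab of (a, b) \<Rightarrow>
             store child_ptrs_update p (Some (if a = n2 then (n1, b) else (a, n1))))
        });
     on_dft (dft_link D n2 n1);
     store parent_ptr_update r (Some n2);
     store parent_ptr_update n2 (Some n1);
     store parent_ptr_update n1 q;
     store child_ptrs_update n2 (Some (r, r3));
     store child_ptrs_update n1 (Some (n2, r'))
   }"

text \<open>
  The bottleneck query takes place after the change of weights, so it refers to the filtration
  after the switch.
\<close>

definition run_negatives ::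
  "('n, 'd) dft_ops \<Rightarrow> ('v, 'l) lct_ops \<Rightarrow> nat \<Rightarrow> 'v simplex \<Rightarrow> 'v simplex \<Rightarrow>
   ('v, 'n, 'd, 'l, unit) prog" where
  "run_negatives D L i e1 e2 = do {
     reweigh_msf L e1 i;
     reweigh_msf L e2 (i - 1);
     n1 \<leftarrow> get_node e1;
     n2 \<leftarrow> get_node e2;
     p \<leftarrow> look parent_ptr n1;
     when_prog (p = Some n2) (do {
       ab \<leftarrow> look child_ptrs n1;
       cd \<leftarrow> look child_ptrs n2;
       let (a, b) = the ab;
       let r3 = (if fst (the cd) = n1 then snd (the cd) else fst (the cd));
       la \<leftarrow> on_dft (dft_lowest_leaf D a);
       lb \<leftarrow> on_dft (dft_lowest_leaf D b);
       lw \<leftarrow> on_dft (dft_lowest_leaf D r3);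
       sa \<leftarrow> look simplex_of la;
       sb \<leftarrow> look simplex_of lb;
       w \<leftarrow> look simplex_of lw;
       ia \<leftarrow> look index_of sa;
       ib \<leftarrow> look index_of sb;
       iw \<leftarrow> look index_of w;
       let (r1, r2, u, iu) = (if ia < ib then (b, a, sb, ib) else (a, b, sa, ia));
       (x, _) \<leftarrow> look endpoints u;
       (y, _) \<leftarrow> look endpoints w;
       k \<leftarrow> on_lct (lct_bottleneck L x y);
       (if 1 + k \<le> i then do {
          rotate_nodes D n1 n2 r1 r2 r3;
          when_prog (iw < iu) (swap_partners e1 e2)
        }
        else rotate_nodes D n1 n2 r2 r1 r3)
     })
   }"

definition run_edges ::
  "('n, 'd) dft_ops \<Rightarrow> ('v, 'l) lct_ops \<Rightarrow> nat \<Rightarrow> 'v simplex \<Rightarrow> 'v simplex \<Rightarrow>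
   ('v, 'n, 'd, 'l, unit) prog" where
  "run_edges D L i e1 e2 = do {
     p1 \<leftarrow> look partner e1;
     p2 \<leftarrow> look partner e2;
     (if p1 = None \<and> p2 = None then skip
      else if p1 = None then reweigh_msf L e2 (i - 1)
      else if p2 = None then run_negative_positive L i e1 e2
      else run_negatives D L i e1 e2)
   }"

definition run_mixed ::
  "('v, 'l) lct_ops \<Rightarrow> 'v simplex \<Rightarrow> nat \<Rightarrow> ('v, 'n, 'd, 'l, unit) prog" where
  "run_mixed L e k = do {
     p \<leftarrow> look partner e;
     when_prog (p \<noteq> None) (reweigh_msf L e k)
   }"

definition set_leaf_level ::
  "('n, 'd) dft_ops \<Rightarrow> 'v simplex \<Rightarrow> nat \<Rightarrow> ('v, 'n, 'd, 'l, unit) prog" where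
  "set_leaf_level D v k = do { n \<leftarrow> get_node v; on_dft (dft_set_level D n k) }"

text \<open>A simplex is a vertex if and only if its two stored endpoints coincide.\<close>

definition run_update ::
  "('n, 'd) dft_ops \<Rightarrow> ('v, 'l) lct_ops \<Rightarrow> nat \<Rightarrow> ('v, 'n, 'd, 'l, unit) prog" where
  "run_update D L i = do {
     s \<leftarrow> look simplex_at (i - 1);
     t \<leftarrow> look simplex_at i;
     (x, x') \<leftarrow> look endpoints s;
     (y, y') \<leftarrow> look endpoints t;
     (if x = x' \<and> y = y' then run_vertices D s t
      else if x = x' then run_mixed L t (i - 1)
      else if y = y' then run_mixed L s i
      else run_edges D L i s t);
     when_prog (x = x') (set_leaf_level D s i);
     when_prog (y = y') (set_leaf_level D t (i - 1));
     store simplex_at_update (i - 1) t;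
     store simplex_at_update i s;
     store index_of_update t (i - 1);
     store index_of_update s i
   }"

end

theory Submission
  imports Defs
begin

text \<open>
  A node \<open>s\<close> of the merge forest is determined by the component that it creates: the vertex
  itself, or the component arising by the merge.  A negative edge \<open>e\<close> is the parent of \<open>s\<close>
  if and only if this set is the component of an endpoint of \<open>e\<close> just before \<open>e\<close> is added, and
  ancestors correspond to inclusion.  Thus the forest and the pairing depend only on the
  components of the graphs at the times of the negative edges.  A switch changes a single graph, so
  only the two switched simplices have to be compared, and adding an edge to a graph unites at most
  two components.

  The minimum spanning forest consists of the negative edges: compared with any spanning forest,
  these are at least as many at every time.  Bottleneck weights therefore measure when two vertices
  become connected.
\<close>


subsection \<open>Connectivity\<close>

text \<open>For two switched vertices the components at the merges stay the same, but the oldest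
  vertex of a component may change from \<open>\<sigma>\<close> to \<open>\<tau>\<close>. The
  obstacle is that the algorithm tests partners and not components.
  \<open>oldest_pt_self_iff\<close> links the two: a vertex is the oldest of its component until the
  edge that it is paired with is added. The test thus says that the two vertices are the oldest ones
  of the components merged at their nearest common ancestor. For two negative edges the sub-cases
  become one if the children of \<open>\<sigma>\<close> are named by which of them
  \<open>\<tau>\<close> touches instead of by age. The rotation is then always the same, and age
  matters only for the pairing. The program never sees graphs: it recognises a negative edge by its
  having a partner, and it decides connectivity by bottleneck weights. All costs are measured in
  multiples of one \<beta> \<ge> 1 that bounds every operation of the data structures, so that table
  accesses can be charged to \<beta> too. Factors such as 60 or 100 are generous and have no further
  meaning.\<close>

lemma connected_in_refl [simp]: "connected_in G x x"
  by (simp add: connected_in_def)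

lemma connected_in_sym: "connected_in G x y \<Longrightarrow> connected_in G y x"
proof -
  have "sym {(a, b). {a, b} \<in> G}" by (auto simp: sym_def insert_commute)
  then have "sym ({(a, b). {a, b} \<in> G}\<^sup>*)" by (rule sym_rtrancl)
  then show "connected_in G x y \<Longrightarrow> connected_in G y x"
    by (auto simp: connected_in_def sym_def)
qed

lemma connected_in_commute: "connected_in G x y \<longleftrightarrow> connected_in G y x"
  using connected_in_sym by metis

lemma connected_in_trans: "connected_in G x y \<Longrightarrow> connected_in G y z \<Longrightarrow> connected_in G x z"
  by (simp add: connected_in_def)

lemma connected_in_edge: "{x, y} \<in> G \<Longrightarrow> connected_in G x y"
  by (auto simp: connected_in_def)

lemma connected_in_mono: "connected_in G x y \<Longrightarrow> G \<subseteq> H \<Longrightarrow> connected_in H x y"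
  unfolding connected_in_def by (erule rtrancl_mono[THEN subsetD, rotated]) auto

lemma connected_in_induct [consumes 1, case_names refl step]:
  assumes "connected_in G x y" and "P x"
    and "\<And>y z. connected_in G x y \<Longrightarrow> {y, z} \<in> G \<Longrightarrow> P y \<Longrightarrow> P z"
  shows "P y"
  using assms(1) unfolding connected_in_def
  by (induction rule: rtrancl_induct) (use assms in \<open>auto simp: connected_in_def\<close>)

lemma mem_component [simp]: "y \<in> component G x \<longleftrightarrow> connected_in G x y"
  by (simp add: component_def)

lemma component_eq_iff: "component G x = component G y \<longleftrightarrow> connected_in G x y"
  by (auto simp: component_def set_eq_iff intro: connected_in_trans connected_in_sym)

lemma component_disjoint_or_eq:
  "component G x = component G y \<or> component G x \<inter> component G y = {}"
  by (auto simp: component_eq_iff) (meson connected_in_sym connected_in_trans)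

lemma component_mono: "G \<subseteq> H \<Longrightarrow> component G x \<subseteq> component H x"
  using connected_in_mono by fastforce

text \<open>A walk needs the new edge at most once, since a second crossing leads back to a
  component already reached. The effect of adding a simplex is always computed from this;
  \<open>a = b\<close> covers the addition of a vertex.\<close>

lemma connected_in_insert:
  "connected_in (insert {a, b} G) x y \<longleftrightarrow>
     connected_in G x y \<or> connected_in G x a \<and> connected_in G b y \<or>
     connected_in G x b \<and> connected_in G a y"
proof
  assume "connected_in (insert {a, b} G) x y"
  then show "connected_in G x y \<or> connected_in G x a \<and> connected_in G b y \<or>
     connected_in G x b \<and> connected_in G a y"
  proof (induction rule: connected_in_induct)
    case (step y z)
    from step.hyps(2) consider "{y, z} \<in> G" | "y = a" "z = b" | "y = b" "z = a"
      by (auto simp: doubleton_eq_iff)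
    then show ?case
    proof cases
      case 1
      then show ?thesis using step.IH connected_in_edge[OF 1] connected_in_trans by metis
    qed (use step.IH in auto)
  qed auto
next
  have "connected_in (insert {a, b} G) a b" by (auto intro: connected_in_edge)
  moreover assume "connected_in G x y \<or> connected_in G x a \<and> connected_in G b y \<or>
     connected_in G x b \<and> connected_in G a y"
  ultimately show "connected_in (insert {a, b} G) x y"
    by (metis connected_in_mono connected_in_sym connected_in_trans subset_insertI)
qed

lemma connected_in_insert_vertex: "connected_in (insert {a} G) x y \<longleftrightarrow> connected_in G x y"
  using connected_in_insert[of a a G x y] connected_in_trans[of G x a y] by auto

lemma component_insert_vertex [simp]: "component (insert {a} G) x = component G x"
  by (simp add: component_def connected_in_insert_vertex)

lemma component_insert_connected:
  "connected_in G a b \<Longrightarrow> component (insert {a, b} G) x = component G x"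
  by (auto simp: connected_in_insert) (meson connected_in_sym connected_in_trans)+

lemma component_insert_edge:
  "component (insert {a, b} G) x =
     (if connected_in G x a \<or> connected_in G x b then component G a \<union> component G b
      else component G x)"
  by (auto simp: connected_in_insert) (meson connected_in_sym connected_in_trans)+

lemma component_insert_left: "component (insert {a, b} G) a = component G a \<union> component G b"
  by (simp add: component_insert_edge)

lemma connected_in_edges: "connected_in (edges G) x y \<longleftrightarrow> connected_in G x y"
proof
  assume "connected_in G x y"
  then show "connected_in (edges G) x y"
  proof (induction rule: connected_in_induct)
    case (step y z)
    show ?case
    proof (cases "y = z")
      case False
      then have "{y, z} \<in> edges G" using step by (auto simp: edges_def is_edge_def)
      then show ?thesis using step.IH connected_in_edge connected_in_trans by metis
    qed (use step in auto)
  qed auto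
qed (auto simp: edges_def elim: connected_in_mono)


subsection \<open>Filtrations\<close>

lemma is_vertex_singleton [simp]: "is_vertex {x}"
  by (simp add: is_vertex_def)

lemma not_is_edge_singleton [simp]: "\<not> is_edge {x}"
  by (auto simp: is_edge_def doubleton_eq_iff)

lemma is_edge_not_vertex: "is_edge s \<Longrightarrow> \<not> is_vertex s"
  by (auto simp: is_vertex_def)

lemma is_edge_doubleton [simp]: "is_edge {x, y} \<longleftrightarrow> x \<noteq> y"
  by (auto simp: is_edge_def doubleton_eq_iff)

lemma graph_at_mono: "j \<le> k \<Longrightarrow> graph_at F j \<subseteq> graph_at F k"
  by (simp add: graph_at_def set_take_subset_set_take)

lemma graph_at_Suc: "j < length F \<Longrightarrow> graph_at F (Suc j) = insert (F ! j) (graph_at F j)"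
  by (simp add: graph_at_def take_Suc_conv_app_nth)

lemma graph_at_length [simp]: "graph_at F (length F) = set F"
  by (simp add: graph_at_def)

section \<open>Nodes of the merge forest, described by the components that they create\<close>

definition is_node :: "'v simplex list \<Rightarrow> 'v simplex \<Rightarrow> bool" where
  "is_node F s \<longleftrightarrow> s \<in> set F \<and> (is_vertex s \<or> negative F s)"

text \<open>The union avoids choosing an endpoint. By \<open>node_comp_eq\<close> all endpoints give
  the same set, because \<open>s\<close> itself connects them.\<close>

definition node_comp :: "'v simplex list \<Rightarrow> 'v simplex \<Rightarrow> 'v set" where
  "node_comp F s = (\<Union>x\<in>s. component (graph_at F (Suc (idx F s))) x)"

definition is_parent :: "'v simplex list \<Rightarrow> 'v simplex \<Rightarrow> 'v simplex \<Rightarrow> bool" where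
  "is_parent F e s \<longleftrightarrow> is_node F s \<and> negative F e \<and>
     (\<exists>x\<in>e. component (graph_at F (idx F e)) x = node_comp F s)"

locale graph_filtration =
  fixes F :: "'v simplex list"
  assumes filtration: "filtration F"
begin

lemma distinct: "distinct F"
  using filtration by (simp add: filtration_def)

lemma idx_nth [simp]: "j < length F \<Longrightarrow> idx F (F ! j) = j"
  unfolding idx_def using distinct by (auto simp: nth_eq_iff_index_eq)

lemma idx_less: "s \<in> set F \<Longrightarrow> idx F s < length F"
  by (metis idx_nth in_set_conv_nth)

lemma nth_idx [simp]: "s \<in> set F \<Longrightarrow> F ! idx F s = s"
  by (metis idx_nth in_set_conv_nth)

lemma idx_eq_iff: "s \<in> set F \<Longrightarrow> t \<in> set F \<Longrightarrow> idx F s = idx F t \<longleftrightarrow> s = t"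
  by (metis nth_idx)

lemma mem_graph_at: "s \<in> graph_at F j \<longleftrightarrow> s \<in> set F \<and> idx F s < j"
proof
  assume "s \<in> graph_at F j"
  then obtain k where "k < length F" "k < j" "s = F ! k"
    by (auto simp: graph_at_def in_set_conv_nth)
  then show "s \<in> set F \<and> idx F s < j" by auto
next
  assume *: "s \<in> set F \<and> idx F s < j"
  then have "take j F ! idx F s = s" "idx F s < length (take j F)"
    using idx_less by auto
  then show "s \<in> graph_at F j"
    unfolding graph_at_def by (metis nth_mem)
qed

lemma graph_at_subset: "graph_at F j \<subseteq> set F"
  by (auto simp: mem_graph_at)

lemma graph_at_Suc_idx: "s \<in> set F \<Longrightarrow> graph_at F (Suc (idx F s)) = insert s (graph_at F (idx F s))"
  using graph_at_Suc[OF idx_less] by simp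

lemma simplex_cases:
  assumes "s \<in> set F"
  obtains (vertex) x where "s = {x}" | (edge) x y where "s = {x, y}" "x \<noteq> y"
proof -
  obtain j where "j < length F" "s = F ! j" using assms by (metis in_set_conv_nth)
  then have "is_vertex s \<or> is_edge s" using filtration by (auto simp: filtration_def)
  then show thesis using that by (auto simp: is_vertex_def is_edge_def)
qed

lemma edge_endpoint:
  assumes "e \<in> set F" "is_edge e" "x \<in> e"
  shows "{x} \<in> set F" "idx F {x} < idx F e"
proof -
  have "e \<subseteq> verts (graph_at F (idx F e))"
    using filtration idx_less[OF assms(1)] nth_idx[OF assms(1)] assms(2) is_edge_not_vertex
    unfolding filtration_def by metis
  then have "{x} \<in> graph_at F (idx F e)" using assms(3) by (auto simp: verts_def)
  then show "{x} \<in> set F" "idx F {x} < idx F e" by (auto simp: mem_graph_at)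
qed

lemma simplex_endpoint:
  assumes "s \<in> set F" "x \<in> s"
  shows "{x} \<in> set F \<and> idx F {x} \<le> idx F s"
  using assms(1)
proof (cases rule: simplex_cases)
  case (edge a b)
  then show ?thesis using edge_endpoint[of s x] assms by auto
qed (use assms in auto)

lemma connected_in_graph_at_vertices:
  assumes "connected_in (graph_at F j) x y" "x \<noteq> y"
  shows "{x} \<in> graph_at F j" "{y} \<in> graph_at F j"
proof -
  have *: "{v} \<in> graph_at F j" if "connected_in (graph_at F j) u v" "u \<noteq> v" for u v
    using that
  proof (induction rule: connected_in_induct)
    case (step y z)
    have "{y, z} \<in> set F" "idx F {y, z} < j" using step by (auto simp: mem_graph_at)
    then show ?case using simplex_endpoint[of "{y, z}" z] by (auto simp: mem_graph_at)
  qed auto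
  show "{x} \<in> graph_at F j" "{y} \<in> graph_at F j"
    using *[OF assms] *[of y x] assms connected_in_sym by metis+
qed

lemma negative_in_set: "negative F e \<Longrightarrow> e \<in> set F"
  and negative_is_edge: "negative F e \<Longrightarrow> is_edge e"
  by (auto simp: negative_def)

lemma negative_obtain:
  assumes "negative F e"
  obtains x y where "e = {x, y}" "x \<noteq> y" "\<not> connected_in (graph_at F (idx F e)) x y"
  using assms unfolding negative_def by (metis connected_in_refl)

lemma negative_doubleton:
  "negative F {x, y} \<longleftrightarrow> {x, y} \<in> set F \<and> x \<noteq> y \<and> \<not> connected_in (graph_at F (idx F {x, y})) x y"
  by (auto simp: negative_def doubleton_eq_iff dest: connected_in_sym)

lemma positive_iff: "positive F e \<longleftrightarrow> e \<in> set F \<and> is_edge e \<and> \<not> negative F e"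
  unfolding positive_def negative_def
  by (auto simp: is_edge_def doubleton_eq_iff dest: connected_in_sym)

lemma positive_doubleton:
  "positive F {x, y} \<longleftrightarrow> {x, y} \<in> set F \<and> x \<noteq> y \<and> connected_in (graph_at F (idx F {x, y})) x y"
  by (auto simp: positive_iff negative_doubleton)

lemma node_in_set: "is_node F s \<Longrightarrow> s \<in> set F"
  by (simp add: is_node_def)

lemma negative_is_node: "negative F e \<Longrightarrow> is_node F e"
  by (simp add: is_node_def negative_in_set)

lemma vertex_is_node: "{x} \<in> set F \<Longrightarrow> is_node F {x}"
  by (simp add: is_node_def)

lemma node_cases [consumes 1, case_names vertex edge]:
  assumes "is_node F s"
  obtains (vertex) x where "s = {x}" "{x} \<in> set F"
  | (edge) x y where "s = {x, y}" "x \<noteq> y" "negative F {x, y}"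
  using assms that unfolding is_node_def is_vertex_def
  by (metis negative_obtain)

lemma node_comp_eq:
  assumes "s \<in> set F" "x \<in> s"
  shows "node_comp F s = component (graph_at F (Suc (idx F s))) x"
proof -
  have "component (graph_at F (Suc (idx F s))) y = component (graph_at F (Suc (idx F s))) x"
    if "y \<in> s" for y
    using assms(1)
  proof (cases rule: simplex_cases)
    case (edge a b)
    have "connected_in (graph_at F (Suc (idx F s))) a b"
      using assms edge by (auto simp: mem_graph_at intro!: connected_in_edge)
    then show ?thesis using edge assms that by (auto simp: component_eq_iff dest: connected_in_sym)
  qed (use that assms in auto)
  then show ?thesis unfolding node_comp_def using assms(2) by blast
qed

lemma component_before_vertex:
  assumes "{x} \<notin> graph_at F j" shows "component (graph_at F j) x = {x}"
  using connected_in_graph_at_vertices[of j x] assms by fastforce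

lemma component_after_vertex:
  assumes "{x} \<in> set F" shows "component (graph_at F (Suc (idx F {x}))) x = {x}"
  using assms component_before_vertex[of x "idx F {x}"]
  by (simp add: graph_at_Suc_idx mem_graph_at)

lemma node_comp_vertex [simp]: "{x} \<in> set F \<Longrightarrow> node_comp F {x} = {x}"
  using node_comp_eq[of "{x}" x] component_after_vertex by simp

lemma node_comp_edge:
  "{x, y} \<in> set F \<Longrightarrow> node_comp F {x, y} =
     component (graph_at F (idx F {x, y})) x \<union> component (graph_at F (idx F {x, y})) y"
  using node_comp_eq[of "{x, y}" x] by (simp add: graph_at_Suc_idx component_insert_left)

lemma subset_node_comp: "s \<in> set F \<Longrightarrow> s \<subseteq> node_comp F s"
  by (auto simp: node_comp_def)

lemma node_nonempty: "s \<in> set F \<Longrightarrow> s \<noteq> {}"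
  by (auto elim: simplex_cases)

lemma node_comp_vertices:
  assumes "s \<in> set F" "x \<in> node_comp F s"
  shows "{x} \<in> set F" "idx F {x} \<le> idx F s"
proof -
  obtain y where y: "y \<in> s" "connected_in (graph_at F (Suc (idx F s))) y x"
    using assms by (auto simp: node_comp_def)
  have "{x} \<in> graph_at F (Suc (idx F s))"
  proof (cases "x = y")
    case True
    then show ?thesis using y assms simplex_endpoint[of s y] by (auto simp: mem_graph_at)
  next
    case False
    then show ?thesis using y connected_in_graph_at_vertices by metis
  qed
  then show "{x} \<in> set F" "idx F {x} \<le> idx F s" by (auto simp: mem_graph_at)
qed

text \<open>If a negative edge \<open>t\<close> inside the component were younger than
  \<open>s\<close>, its endpoints would be connected before it is added. A vertex in the component
  has to exist when the component arises.\<close>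

lemma node_comp_subset_idx:
  assumes "is_node F s" "is_node F t" "t \<subseteq> node_comp F s"
  shows "idx F t \<le> idx F s"
  using assms(2)
proof (cases rule: node_cases)
  case (vertex x)
  then show ?thesis using assms node_comp_vertices node_in_set by auto
next
  case (edge x y)
  show ?thesis
  proof (rule ccontr)
    assume "\<not> ?thesis"
    then have sub: "graph_at F (Suc (idx F s)) \<subseteq> graph_at F (idx F t)" by (simp add: graph_at_mono)
    obtain z where "z \<in> s" using node_nonempty[OF node_in_set[OF assms(1)]] by auto
    then have "x \<in> component (graph_at F (Suc (idx F s))) z" "y \<in> component (graph_at F (Suc (idx F s))) z"
      using node_comp_eq[of s z] assms edge node_in_set by auto
    then have "connected_in (graph_at F (Suc (idx F s))) x y"
      using connected_in_trans connected_in_sym by (metis mem_component)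
    then have "connected_in (graph_at F (idx F t)) x y" using sub connected_in_mono by metis
    then show False using edge by (simp add: negative_doubleton)
  qed
qed

text \<open>Each of the two simplices lies inside the component of the other, so neither is younger.
  This is what allows a node to be replaced by its set.\<close>

lemma node_comp_inj:
  assumes "is_node F s" "is_node F t" "node_comp F s = node_comp F t"
  shows "s = t"
  using node_comp_subset_idx[OF assms(1,2)] node_comp_subset_idx[OF assms(2,1)] assms
    subset_node_comp idx_eq_iff node_in_set
  by (metis le_antisym)

lemma node_comp_laminar:
  assumes "is_node F s" "is_node F t" "idx F s \<le> idx F t" "x \<in> node_comp F s" "x \<in> node_comp F t"
  shows "node_comp F s \<subseteq> node_comp F t"
proof -
  let ?G = "graph_at F (Suc (idx F s))" and ?H = "graph_at F (Suc (idx F t))"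
  have GH: "?G \<subseteq> ?H" using assms by (simp add: graph_at_mono)
  obtain a b where ab: "a \<in> s" "b \<in> t"
    using assms node_nonempty node_in_set by (metis all_not_in_conv)
  then have "node_comp F s = component ?G a" "node_comp F t = component ?H b"
    using assms node_comp_eq node_in_set by metis+
  with assms have "node_comp F s = component ?G x" "node_comp F t = component ?H x"
    by (auto simp: component_eq_iff)
  then show ?thesis using component_mono[OF GH] by simp
qed

text \<open>The node found is the root of the tree belonging to the component at time
  \<open>j\<close>. A simplex that leaves the component of \<open>x\<close> unchanged leaves this
  node in place; otherwise the simplex just added is the new node.\<close>

lemma active_node:
  assumes "j \<le> length F" "{x} \<in> graph_at F j"
  shows "\<exists>s. is_node F s \<and> idx F s < j \<and> node_comp F s = component (graph_at F j) x"
  using assms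
proof (induction j arbitrary: x)
  case 0
  then show ?case by (simp add: graph_at_def)
next
  case (Suc j)
  then have j: "j < length F" by simp
  have G: "graph_at F (Suc j) = insert (F ! j) (graph_at F j)" using j by (rule graph_at_Suc)
  have mem: "F ! j \<in> set F" using j by simp
  have old: ?case if "{x} \<in> graph_at F j" "component (graph_at F (Suc j)) x = component (graph_at F j) x"
    using Suc.IH[of x] that j by (metis less_SucI less_or_eq_imp_le)
  from mem show ?case
  proof (cases rule: simplex_cases)
    case (vertex a)
    show ?thesis
    proof (cases "x = a")
      case True
      then have "node_comp F {x} = component (graph_at F (Suc j)) x"
        using vertex mem idx_nth[OF j] node_comp_eq[of "{x}" x] by (metis insertI1)
      then show ?thesis using True vertex mem idx_nth[OF j] vertex_is_node by (metis lessI)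
    next
      case False
      then show ?thesis using old Suc.prems vertex G by auto
    qed
  next
    case (edge a b)
    have x: "{x} \<in> graph_at F j" using Suc.prems edge G by (auto simp: doubleton_eq_iff)
    have ab: "idx F {a, b} = j" using edge idx_nth[OF j] by simp
    show ?thesis
    \<comment> \<open>Exactly the situations in which the component of \<open>x\<close> is
      unchanged: the edge is positive, or it is added away from \<open>x\<close>.\<close>
    proof (cases "connected_in (graph_at F j) a b \<or>
        \<not> (connected_in (graph_at F j) x a \<or> connected_in (graph_at F j) x b)")
      case True
      then have "component (graph_at F (Suc j)) x = component (graph_at F j) x"
        using G edge component_insert_connected[of _ a b x] component_insert_edge[of a b _ x]
        by metis
      then show ?thesis using old x by blast
    next
      case False
      then have "negative F {a, b}" using edge mem ab by (auto simp: negative_doubleton)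
      moreover have "node_comp F {a, b} = component (graph_at F (Suc j)) x"
        using edge mem ab False by (simp add: node_comp_edge G component_insert_edge)
      ultimately show ?thesis using negative_is_node ab by (metis lessI)
    qed
  qed
qed

lemma component_negative_notin:
  "negative F {x, y} \<Longrightarrow> y \<notin> component (graph_at F (idx F {x, y})) x"
  by (simp add: negative_doubleton)

text \<open>Once \<open>e\<close> is present, every component containing \<open>x\<close> contains
  the other endpoint of \<open>e\<close>, which the component just before \<open>e\<close> does not.
  Hence a set is merged away only once, which gives both the uniqueness of parents and the absence
  of parents for roots.\<close>

lemma component_at_merge_unique:
  assumes e: "negative F e" "x \<in> e" and k: "idx F e < k"
  shows "component (graph_at F (idx F e)) x \<noteq> component (graph_at F k) y"
proof
  assume eq: "component (graph_at F (idx F e)) x = component (graph_at F k) y"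
  obtain a b where ab: "e = {a, b}" "\<not> connected_in (graph_at F (idx F e)) a b"
    using e negative_obtain by metis
  then obtain z where z: "z \<in> e" "e = {x, z}" "\<not> connected_in (graph_at F (idx F e)) x z"
    using e(2) connected_in_sym by (metis insertE insert_commute insertI1 singletonD)
  have "e \<in> graph_at F k" using e k by (simp add: mem_graph_at negative_in_set)
  then have "connected_in (graph_at F k) x z" using z by (auto intro: connected_in_edge)
  moreover have "connected_in (graph_at F k) y x" using eq by (metis connected_in_refl mem_component)
  ultimately have "z \<in> component (graph_at F k) y" by (metis connected_in_trans mem_component)
  then show False using eq z by auto
qed

lemma is_parent_unique:
  assumes "is_parent F e s" "is_parent F e' s" shows "e = e'"
proof -
  obtain x y where xy: "negative F e" "negative F e'" "x \<in> e" "y \<in> e'"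
    "component (graph_at F (idx F e)) x = component (graph_at F (idx F e')) y"
    using assms by (auto simp: is_parent_def)
  then have "\<not> idx F e < idx F e'" "\<not> idx F e' < idx F e"
    using component_at_merge_unique[of e x "idx F e'" y] component_at_merge_unique[of e' y "idx F e" x]
    by auto
  then show ?thesis using idx_eq_iff negative_in_set xy(1,2) by (metis linorder_neqE_nat)
qed

lemma merge_child:
  assumes e: "negative F e" and x: "x \<in> e"
  shows "\<exists>s. is_parent F e s \<and> idx F s < idx F e \<and>
    node_comp F s = component (graph_at F (idx F e)) x"
proof -
  have "{x} \<in> graph_at F (idx F e)"
    using edge_endpoint[OF negative_in_set[OF e] negative_is_edge[OF e] x] by (simp add: mem_graph_at)
  then show ?thesis
    using active_node[of "idx F e" x] idx_less[OF negative_in_set[OF e]] e x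
    by (auto simp: is_parent_def)
qed

lemma is_parent_idx_less:
  assumes "is_parent F e s" shows "idx F s < idx F e"
  using assms merge_child node_comp_inj unfolding is_parent_def by metis

lemma is_parent_subset:
  assumes "is_parent F e s" shows "node_comp F s \<subseteq> node_comp F e"
proof -
  obtain x where "x \<in> e" "node_comp F s = component (graph_at F (idx F e)) x" "negative F e"
    using assms by (auto simp: is_parent_def)
  then show ?thesis using node_comp_eq[of e x] negative_in_set[of e]
    by (simp add: component_mono graph_at_mono)
qed

text \<open>The component of \<open>s\<close> is complete before \<open>z\<close> is added, hence it
  lies in one of the two components that \<open>z\<close> merges. The child of \<open>z\<close>
  creating that component is the one sought.\<close>

lemma node_comp_descend:
  assumes "is_node F s" "is_node F z" "node_comp F s \<subset> node_comp F z"
  shows "\<exists>c. is_parent F z c \<and> node_comp F s \<subseteq> node_comp F c"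
proof -
  have "s \<noteq> z" using assms by auto
  from assms(2) show ?thesis
  proof (cases rule: node_cases)
    case (vertex x)
    then have "node_comp F s = {}" using assms by auto
    then show ?thesis using assms subset_node_comp node_nonempty node_in_set by (metis subset_empty)
  next
    case (edge x y)
    have "idx F s \<le> idx F z"
      using node_comp_subset_idx assms subset_node_comp node_in_set by (metis order_trans psubset_imp_subset)
    with \<open>s \<noteq> z\<close> have less: "idx F s < idx F z" using assms idx_eq_iff node_in_set by (metis le_neq_implies_less)
    obtain a where a: "a \<in> s" "a \<in> node_comp F s"
      using assms node_nonempty node_in_set subset_node_comp by blast
    then have "a \<in> node_comp F z" using assms by blast
    then obtain w where w: "w \<in> z" "connected_in (graph_at F (idx F z)) w a"
      using edge node_comp_edge negative_in_set by auto
    then obtain c where c: "is_parent F z c" "node_comp F c = component (graph_at F (idx F z)) w"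
      using merge_child[of z w] edge by auto
    have "node_comp F s = component (graph_at F (Suc (idx F s))) a"
      using node_comp_eq a assms node_in_set by metis
    also have "\<dots> \<subseteq> component (graph_at F (idx F z)) a"
      using less by (intro component_mono graph_at_mono) simp
    also have "\<dots> = node_comp F c" using w c by (simp add: component_eq_iff connected_in_commute)
    finally show ?thesis using c by auto
  qed
qed

end


subsection \<open>Rooted forests\<close>

lemma ancestor_refl [simp]: "ancestor T x x"
  by (simp add: ancestor_def)

lemma ancestor_trans: "ancestor T z y \<Longrightarrow> ancestor T y x \<Longrightarrow> ancestor T z x"
  by (simp add: ancestor_def)

lemma ancestor_parent: "parent T x = Some y \<Longrightarrow> ancestor T y x"
  by (auto simp: ancestor_def)

lemma ancestor_induct [consumes 1, case_names refl step]:
  assumes "ancestor T z x" and "P x"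
    and "\<And>y w. ancestor T y x \<Longrightarrow> parent T y = Some w \<Longrightarrow> P y \<Longrightarrow> P w"
  shows "P z"
  using assms(1) unfolding ancestor_def
  by (induction rule: rtrancl_induct) (use assms in \<open>auto simp: ancestor_def\<close>)

lemma ancestor_unfold: "ancestor T z x \<longleftrightarrow> z = x \<or> (\<exists>y. parent T x = Some y \<and> ancestor T z y)"
  unfolding ancestor_def by (auto elim: converse_rtranclE intro: converse_rtrancl_into_rtrancl)

text \<open>Parents are unique, so two upward walks from \<open>x\<close> cannot diverge.\<close>

lemma ancestor_linear:
  assumes "ancestor T z x" "ancestor T z' x"
  shows "ancestor T z z' \<or> ancestor T z' z"
  using assms
proof (induction rule: ancestor_induct)
  case (step y w)
  show ?case
  proof (cases "ancestor T y z'")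
    case True
    then show ?thesis using step.hyps ancestor_parent ancestor_trans by metis
  next
    case False
    then have "ancestor T z' y" using step by blast
    then show ?thesis using step.hyps ancestor_unfold[of T z' y] ancestor_parent[of T y w] by auto
  qed
qed auto

lemma root_of_eqI:
  assumes "ancestor T r x" "parent T r = None" shows "root_of T x = r"
  unfolding root_of_def
proof (rule the_equality)
  fix r' assume "ancestor T r' x \<and> parent T r' = None"
  then show "r' = r" using ancestor_linear[OF assms(1)] assms(2) ancestor_unfold
    by (metis option.distinct(1))
qed (use assms in simp)

lemma forest_eqI:
  fixes S T :: "'a forest"
  shows "parent S = parent T \<Longrightarrow> level S = level T \<Longrightarrow> S = T"
  by simp

lemma option_eqI_Some: "(\<And>x. a = Some x \<longleftrightarrow> b = Some x) \<Longrightarrow> a = b"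
  by (cases a; cases b) auto


subsection \<open>The merge forest\<close>

context graph_filtration
begin

text \<open>The closed form established by induction in \<open>mf_at_MF_upto\<close>. It is a
  property of an arbitrary \<open>T\<close>, so that its consequences hold for the intermediate
  forests, where they are needed to evaluate the next step, and for the final one.\<close>

definition mf_at :: "nat \<Rightarrow> 'v simplex forest \<Rightarrow> bool" where
  "mf_at j T \<longleftrightarrow>
     (\<forall>s. level T s = (if is_node F s \<and> idx F s < j then Some (idx F s) else None)) \<and>
     (\<forall>s e. parent T s = Some e \<longleftrightarrow> is_parent F e s \<and> idx F e < j)"

lemma mf_at_level:
  "mf_at j T \<Longrightarrow> level T s = (if is_node F s \<and> idx F s < j then Some (idx F s) else None)"
  and mf_at_parent: "mf_at j T \<Longrightarrow> parent T s = Some e \<longleftrightarrow> is_parent F e s \<and> idx F e < j"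
  by (simp_all add: mf_at_def)

lemma mf_at_nodes: "mf_at j T \<Longrightarrow> s \<in> nodes T \<longleftrightarrow> is_node F s \<and> idx F s < j"
  by (auto simp: nodes_def mf_at_level dom_def split: if_splits)

lemma is_parent_nodes: "is_parent F e s \<Longrightarrow> is_node F s \<and> is_node F e"
  by (simp add: is_parent_def negative_is_node)

text \<open>Upward steps enlarge the component. Conversely one descends from \<open>z\<close>
  through the children whose sets contain that of \<open>s\<close>; indices decrease, and the
  descent ends when the sets, and hence the nodes, coincide.\<close>

lemma mf_at_ancestor:
  assumes T: "mf_at j T" and s: "s \<in> nodes T"
  shows "ancestor T z s \<longleftrightarrow> z \<in> nodes T \<and> node_comp F s \<subseteq> node_comp F z"
proof
  assume "ancestor T z s"
  then show "z \<in> nodes T \<and> node_comp F s \<subseteq> node_comp F z"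
  proof (induction rule: ancestor_induct)
    case (step y w)
    then have "is_parent F w y" "idx F w < j" using T by (simp_all add: mf_at_parent)
    then show ?case using step.IH T is_parent_subset is_parent_nodes
      by (metis mf_at_nodes order_trans)
  qed (use s in simp)
next
  assume "z \<in> nodes T \<and> node_comp F s \<subseteq> node_comp F z"
  then show "ancestor T z s"
  proof (induction "idx F z" arbitrary: z rule: less_induct)
    case less
    show ?case
    proof (cases "node_comp F s = node_comp F z")
      case True
      then show ?thesis using node_comp_inj less s T by (metis ancestor_refl mf_at_nodes)
    next
      case False
      then obtain c where c: "is_parent F z c" "node_comp F s \<subseteq> node_comp F c"
        using node_comp_descend[of s z] less s T by (auto simp: mf_at_nodes)
      then have "parent T c = Some z" "c \<in> nodes T" "idx F c < idx F z"
        using T less.prems is_parent_idx_less[OF c(1)] is_parent_nodes[OF c(1)]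
        by (auto simp: mf_at_nodes mf_at_parent)
      then show ?thesis using less.hyps c ancestor_parent ancestor_trans by metis
    qed
  qed
qed

lemma mf_at_is_leaf: "mf_at j T \<Longrightarrow> is_leaf T s \<longleftrightarrow> (\<exists>x. s = {x}) \<and> s \<in> graph_at F j"
proof -
  assume T: "mf_at j T"
  have "children T s = {} \<longleftrightarrow> (\<exists>x. s = {x})" if s: "s \<in> nodes T"
  proof -
    have "is_node F s" "idx F s < j" using s T by (auto simp: mf_at_nodes)
    from this(1) show ?thesis
    proof (cases rule: node_cases)
      case (vertex x)
      then show ?thesis using T by (auto simp: children_def mf_at_parent is_parent_def dest!: negative_is_edge)
    next
      case (edge x y)
      then obtain c where "is_parent F s c" using merge_child[of s x] by auto
      then have "c \<in> children T s" using T \<open>idx F s < j\<close> by (auto simp: children_def mf_at_parent)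
      then show ?thesis using edge by (auto simp: doubleton_eq_iff)
    qed
  qed
  then show ?thesis using T
    by (auto simp: is_leaf_def mf_at_nodes mem_graph_at is_node_def)
qed

lemma mf_at_component_of_node:
  assumes T: "mf_at j T" and r: "r \<in> nodes T"
  shows "component_of_node T r = node_comp F r"
proof -
  have "{x} \<in> leaves T r \<longleftrightarrow> x \<in> node_comp F r" for x
  proof
    assume x: "x \<in> node_comp F r"
    then have "{x} \<in> set F" "idx F {x} < j"
      using node_comp_vertices[of r x] r T by (auto simp: mf_at_nodes is_node_def)
    then show "{x} \<in> leaves T r" using x r T vertex_is_node[of x]
      by (auto simp: leaves_def mf_at_is_leaf mf_at_ancestor mf_at_nodes mem_graph_at)
  next
    assume "{x} \<in> leaves T r"
    then show "x \<in> node_comp F r"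
      using T mf_at_ancestor[OF T, of "{x}" r] by (auto simp: leaves_def is_leaf_def mf_at_nodes is_node_def)
  qed
  then show ?thesis by (simp add: component_of_node_def)
qed

text \<open>A parent \<open>e\<close> of \<open>r\<close> would have been added before time
  \<open>j\<close>, but then its presence contradicts that the set of \<open>r\<close> is still a
  component at time \<open>j\<close>.\<close>

lemma mf_at_root_of_component:
  assumes T: "mf_at j T" and r: "r \<in> nodes T" "node_comp F r = component (graph_at F j) x"
  shows "root_of_component T (component (graph_at F j) x) = r"
  unfolding root_of_component_def
proof (rule the_equality)
  have "parent T r = None"
  proof (rule ccontr)
    assume "parent T r \<noteq> None"
    then obtain e where e: "is_parent F e r" "idx F e < j" using T by (auto simp: mf_at_parent)
    then show False using component_at_merge_unique[of e _ j x] r by (auto simp: is_parent_def)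
  qed
  then show "r \<in> nodes T \<and> parent T r = None \<and> component_of_node T r = component (graph_at F j) x"
    using assms mf_at_component_of_node by auto
next
  fix r' assume "r' \<in> nodes T \<and> parent T r' = None \<and> component_of_node T r' = component (graph_at F j) x"
  then show "r' = r" using assms mf_at_component_of_node node_comp_inj by (metis mf_at_nodes)
qed

lemma mf_at_MF_upto: "j \<le> length F \<Longrightarrow> mf_at j (MF_upto F j)"
proof (induction j)
  case 0
  then show ?case by (simp add: mf_at_def)
next
  case (Suc j)
  let ?M = "MF_upto F j" and ?s = "F ! j"
  have M: "mf_at j ?M" and j: "j < length F" using Suc by auto
  have s: "?s \<in> set F" "idx F ?s = j" using j by auto
  have less: "idx F t < Suc j \<longleftrightarrow> idx F t < j \<or> t = ?s" if "t \<in> set F" for t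
    using that s by (metis less_Suc_eq nth_idx)
  consider (vertex) "is_vertex ?s" | (negative) "\<not> is_vertex ?s" "negative F ?s"
    | (positive) "\<not> is_vertex ?s" "\<not> negative F ?s" by blast
  then show ?case
  proof cases
    case vertex
    then have "MF_upto F (Suc j) = ?M\<lparr>level := (level ?M)(?s \<mapsto> j)\<rparr>" by (simp add: Let_def)
    moreover have "\<not> negative F ?s" using vertex negative_is_edge is_edge_not_vertex by metis
    ultimately show ?thesis using M s less vertex
      by (auto simp: mf_at_def is_node_def is_parent_def negative_in_set)
  next
    case positive
    then have "MF_upto F (Suc j) = ?M" by (simp add: Let_def)
    then show ?thesis using M s less positive
      by (auto simp: mf_at_def is_node_def is_parent_def negative_in_set)
  next
    case negative
    \<comment> \<open>This resolves the \<open>THE\<close> in \<open>root_of_component\<close>: each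
      endpoint of the new edge has an active node, and by injectivity of \<open>node_comp\<close> it
      is the only candidate.\<close>
    have root: "(\<exists>x\<in>?s. r = root_of_component ?M (component (graph_at F j) x)) \<longleftrightarrow> is_parent F ?s r" for r
    proof -
      have "r = root_of_component ?M (component (graph_at F j) x) \<longleftrightarrow>
          is_node F r \<and> component (graph_at F j) x = node_comp F r" if x: "x \<in> ?s" for x
      proof -
        obtain c where c: "is_parent F ?s c" "idx F c < j" "node_comp F c = component (graph_at F j) x"
          using merge_child[OF negative(2) x] s by auto
        then have "root_of_component ?M (component (graph_at F j) x) = c"
          using mf_at_root_of_component[OF M] M is_parent_nodes by (simp add: mf_at_nodes)
        then show ?thesis using c is_parent_nodes node_comp_inj by metis
      qed
      then show ?thesis using negative s by (auto simp: is_parent_def)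
    qed
    have "MF_upto F (Suc j) = \<lparr>parent = (\<lambda>r. if is_parent F ?s r then Some ?s else parent ?M r),
         level = (level ?M)(?s \<mapsto> j)\<rparr>"
      using negative by (simp add: Let_def root)
    \<comment> \<open>No link is overwritten: the parent of \<open>r\<close> is unique and has index
      \<open>j\<close>, while parents in \<open>?M\<close> have smaller indices.\<close>
    moreover have "parent ?M r = None" if "is_parent F ?s r" for r
      using that mf_at_parent[OF M, of r] s is_parent_unique[of ?s r] by (metis less_irrefl not_None_eq)
    moreover have "is_node F ?s" "\<And>e r. is_parent F e r \<Longrightarrow> e \<in> set F"
      using negative negative_is_node by (auto simp: is_parent_def negative_in_set)
    moreover have "\<And>r. is_node F r \<Longrightarrow> r \<in> set F" by (rule node_in_set)
    ultimately show ?thesis using M s less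
      unfolding mf_at_def by (auto split: if_splits dest: is_parent_unique[of ?s])
  qed
qed

lemma mf_at_MF: "mf_at (length F) (MF F)"
  by (simp add: MF_def mf_at_MF_upto)

lemma nodes_MF [simp]: "s \<in> nodes (MF F) \<longleftrightarrow> is_node F s"
  using mf_at_nodes[OF mf_at_MF] idx_less node_in_set by metis

lemma parent_MF: "parent (MF F) s = Some e \<longleftrightarrow> is_parent F e s"
  using mf_at_parent[OF mf_at_MF] idx_less node_in_set is_parent_nodes by metis

lemma level_MF: "level (MF F) s = (if is_node F s then Some (idx F s) else None)"
  using mf_at_level[OF mf_at_MF] idx_less node_in_set by metis

lemma children_MF: "children (MF F) e = {s. is_parent F e s}"
  by (simp add: children_def parent_MF)

lemma is_leaf_MF: "is_leaf (MF F) s \<longleftrightarrow> s \<in> set F \<and> is_vertex s"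
  using mf_at_is_leaf[OF mf_at_MF] by (auto simp: is_vertex_def)

lemma ancestor_MF:
  "is_node F s \<Longrightarrow> ancestor (MF F) z s \<longleftrightarrow> is_node F z \<and> node_comp F s \<subseteq> node_comp F z"
  using mf_at_ancestor[OF mf_at_MF] by simp

lemma component_of_node_MF: "is_node F r \<Longrightarrow> component_of_node (MF F) r = node_comp F r"
  using mf_at_component_of_node[OF mf_at_MF] by simp

lemma finite_nodes_MF: "finite (nodes (MF F))"
  by (rule finite_subset[of _ "set F"]) (auto simp: is_node_def)

lemma leaves_MF:
  assumes "is_node F r" shows "leaves (MF F) r = {{x} | x. x \<in> node_comp F r}"
proof -
  have "s \<in> leaves (MF F) r \<longleftrightarrow> (\<exists>x. s = {x} \<and> x \<in> node_comp F r)" for s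
    using component_of_node_MF[OF assms]
    by (auto simp: component_of_node_def leaves_def is_leaf_MF is_vertex_def)
  then show ?thesis by auto
qed

text \<open>The root is the ancestor of largest index, as a parent is always younger than its
  child.\<close>

lemma root_of_MF:
  assumes "is_node F s"
  obtains r where "is_node F r" "ancestor (MF F) r s" "parent (MF F) r = None" "root_of (MF F) s = r"
proof -
  let ?A = "{z. ancestor (MF F) z s}"
  have "?A \<subseteq> nodes (MF F)" using assms by (auto simp: ancestor_MF)
  then have "finite ?A" using finite_nodes_MF finite_subset by metis
  moreover have "?A \<noteq> {}" using ancestor_refl[of "MF F" s] by blast
  ultimately have "Max (idx F ` ?A) \<in> idx F ` ?A" "\<forall>z\<in>?A. idx F z \<le> Max (idx F ` ?A)"
    by (intro Max_in ballI Max_ge; simp)+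
  then obtain r where r: "r \<in> ?A" "\<And>z. z \<in> ?A \<Longrightarrow> idx F z \<le> idx F r"
    by fastforce
  have "parent (MF F) r = None"
  proof (rule ccontr)
    assume "parent (MF F) r \<noteq> None"
    then obtain e where e: "parent (MF F) r = Some e" by auto
    then have "e \<in> ?A" using r(1) ancestor_parent ancestor_trans by fastforce
    moreover have "idx F r < idx F e" using e is_parent_idx_less by (simp add: parent_MF)
    ultimately show False using r(2) by fastforce
  qed
  moreover have "ancestor (MF F) r s" using r by simp
  ultimately show thesis using that[of r] root_of_eqI ancestor_MF assms by metis
qed

lemma oldest_eqI:
  assumes "x \<in> C" "\<And>y. y \<in> C \<Longrightarrow> {y} \<in> set F \<and> idx F {x} \<le> idx F {y}"
  shows "oldest F C = {x}"
proof -
  let ?a = "ARG_MIN (\<lambda>x. idx F {x}) x. x \<in> C"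
  have "?a \<in> C" "idx F {?a} \<le> idx F {x}"
    using arg_min_nat_lemma[of "\<lambda>x. x \<in> C" x "\<lambda>x. idx F {x}"] assms(1) by auto
  then have "idx F {?a} = idx F {x}" using assms(2) by (meson le_antisym)
  then have "{?a} = {x}" using idx_eq_iff assms \<open>?a \<in> C\<close> by blast
  then show ?thesis by (simp add: oldest_def)
qed

end


subsection \<open>Cycles and bridges\<close>

definition deg :: "'v simplex set \<Rightarrow> 'v \<Rightarrow> nat" where
  "deg c z = card {e \<in> c. z \<in> e}"

text \<open>\<open>c'\<close> is the sum of the chains \<open>c\<close> and \<open>{e}\<close> over
  the field with two elements, and the parity of the degree is additive.\<close>

lemma deg_sym_diff_parity:
  assumes "finite c" "e \<notin> c \<longrightarrow> c' = insert e c" "e \<in> c \<longrightarrow> c' = c - {e}"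
  shows "even (deg c' z) \<longleftrightarrow> (even (deg c z) \<longleftrightarrow> z \<notin> e)"
proof (cases "e \<in> c")
  case True
  then have c: "c = insert e c'" "e \<notin> c'" "finite c'" using assms by auto
  have "{f \<in> c. z \<in> f} = (if z \<in> e then insert e {f \<in> c'. z \<in> f} else {f \<in> c'. z \<in> f})"
    using c by auto
  then show ?thesis using c by (auto simp: deg_def)
next
  case False
  then have c: "c' = insert e c" using assms by auto
  have "{f \<in> c'. z \<in> f} = (if z \<in> e then insert e {f \<in> c. z \<in> f} else {f \<in> c. z \<in> f})"
    using c by auto
  then show ?thesis using False assms(1) by (auto simp: deg_def)
qed

text \<open>The edges of a walk, added modulo two, form a chain whose boundary consists of the two
  ends of the walk. An edge passed twice cancels, so the walk need not be simple.\<close>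

lemma connected_in_chain:
  assumes "connected_in E x y" "\<forall>e\<in>E. is_edge e"
  shows "\<exists>c. finite c \<and> c \<subseteq> E \<and> (\<forall>z. odd (deg c z) \<longleftrightarrow> x \<noteq> y \<and> (z = x \<or> z = y))"
  using assms(1)
proof (induction rule: connected_in_induct)
  case refl
  show ?case by (rule exI[of _ "{}"]) (simp add: deg_def)
next
  case (step y z)
  then obtain c where c: "finite c" "c \<subseteq> E" "\<And>v. odd (deg c v) \<longleftrightarrow> x \<noteq> y \<and> (v = x \<or> v = y)"
    by blast
  have yz: "y \<noteq> z" using step.hyps(2) assms(2) by force
  define c' where "c' = (if {y, z} \<in> c then c - {{y, z}} else insert {y, z} c)"
  have "even (deg c' v) \<longleftrightarrow> (even (deg c v) \<longleftrightarrow> v \<notin> {y, z})" for v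
    by (rule deg_sym_diff_parity) (use c in \<open>auto simp: c'_def\<close>)
  then have "odd (deg c' v) \<longleftrightarrow> x \<noteq> z \<and> (v = x \<or> v = z)" for v
    using c(3)[of v] yz by auto
  moreover have "finite c'" "c' \<subseteq> E" using c step.hyps by (auto simp: c'_def)
  ultimately show ?case by blast
qed

lemma one_cycle_deg: "one_cycle E c \<longleftrightarrow> finite c \<and> c \<subseteq> E \<and> (\<forall>z. even (deg c z))"
  by (simp add: one_cycle_def deg_def)

lemma connected_in_cycle:
  assumes "connected_in (E - {{x, y}}) x y" "x \<noteq> y" "{x, y} \<in> E" "\<forall>e\<in>E. is_edge e"
  shows "\<exists>c. one_cycle E c \<and> {x, y} \<in> c"
proof -
  obtain c where c: "finite c" "c \<subseteq> E - {{x, y}}" "\<And>z. odd (deg c z) \<longleftrightarrow> x \<noteq> y \<and> (z = x \<or> z = y)"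
    using connected_in_chain[OF assms(1)] assms(4) by auto
  have "even (deg (insert {x, y} c) v) \<longleftrightarrow> (even (deg c v) \<longleftrightarrow> v \<notin> {x, y})" for v
    by (rule deg_sym_diff_parity) (use c in auto)
  then have "one_cycle E (insert {x, y} c)"
    using c assms by (auto simp: one_cycle_deg)
  then show ?thesis by blast
qed

text \<open>
  Count incidences between the edges of the cycle and the component of \<open>x\<close>: every edge other than
  \<open>{x, y}\<close> contributes an even number, so the endpoint \<open>x\<close> alone cannot have odd degree.
\<close>

lemma bridge_not_in_cycle:
  assumes "\<not> connected_in (E - {{x, y}}) x y" "\<forall>e\<in>E. is_edge e" "one_cycle E c"
  shows "{x, y} \<notin> c"
proof
  assume e: "{x, y} \<in> c"
  let ?e = "{x, y}"
  define c' where "c' = c - {?e}"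
  have c: "finite c" "c \<subseteq> E" "\<And>z. even (deg c z)" using assms by (auto simp: one_cycle_deg)
  have parity: "even (deg c' z) \<longleftrightarrow> (even (deg c z) \<longleftrightarrow> z \<notin> ?e)" for z
    by (rule deg_sym_diff_parity) (use c e in \<open>auto simp: c'_def\<close>)
  have fin: "finite c'" using c by (simp add: c'_def)
  have edge: "is_edge f" "f \<in> E - {?e}" if "f \<in> c'" for f
    using that c assms(2) by (auto simp: c'_def)
  \<comment> \<open>The component of \<open>x\<close> may be infinite, so only its points on
    \<open>c'\<close> are kept. The point \<open>x\<close> is added separately so that its summand
    can be split off below.\<close>
  define Z where "Z = insert x (\<Union>c' \<inter> component (E - {?e}) x)"
  have "finite f" if "f \<in> c'" for f using edge(1)[OF that] by (auto simp: is_edge_def)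
  then have finZ: "finite Z" using fin by (auto simp: Z_def)
  have "even (card (f \<inter> Z))" if f: "f \<in> c'" for f
  proof -
    obtain a b where ab: "f = {a, b}" "a \<noteq> b" using edge[OF f] by (auto simp: is_edge_def)
    have conn: "connected_in (E - {?e}) a b" using edge[OF f] ab by (intro connected_in_edge) simp
    have "a \<in> Z \<longleftrightarrow> connected_in (E - {?e}) x a" "b \<in> Z \<longleftrightarrow> connected_in (E - {?e}) x b"
      using f ab by (auto simp: Z_def)
    then have "a \<in> Z \<longleftrightarrow> b \<in> Z" using conn connected_in_trans connected_in_sym by metis
    then have "f \<inter> Z = (if a \<in> Z then {a, b} else {})" using ab by auto
    then show ?thesis using ab by simp
  qed
  then have even_sum: "even (\<Sum>f\<in>c'. card (f \<inter> Z))" by (intro dvd_sum)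
  have "(\<Sum>z\<in>Z. deg c' z) = (\<Sum>z\<in>Z. \<Sum>f\<in>c'. if z \<in> f then 1 else 0)"
    using fin by (simp add: deg_def sum.If_cases Int_def)
  also have "\<dots> = (\<Sum>f\<in>c'. \<Sum>z\<in>Z. if z \<in> f then 1 else 0)" by (rule sum.swap)
  also have "\<dots> = (\<Sum>f\<in>c'. card (f \<inter> Z))"
    using finZ by (simp add: sum.If_cases Int_commute)
  finally have "even (\<Sum>z\<in>Z. deg c' z)" using even_sum by simp
  moreover have "(\<Sum>z\<in>Z. deg c' z) = deg c' x + (\<Sum>z\<in>Z - {x}. deg c' z)"
    using finZ by (intro sum.remove) (auto simp: Z_def)
  moreover have "even (\<Sum>z\<in>Z - {x}. deg c' z)"
  proof (intro dvd_sum)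
    fix z assume z: "z \<in> Z - {x}"
    then have "z \<noteq> y" using assms(1) by (auto simp: Z_def)
    then show "even (deg c' z)" using parity[of z] c z by simp
  qed
  moreover have "odd (deg c' x)" using parity[of x] c by simp
  ultimately show False by simp
qed

definition acyclic_edges :: "'v simplex set \<Rightarrow> bool" where
  "acyclic_edges E \<longleftrightarrow> (\<forall>e\<in>E. is_edge e) \<and> (\<forall>c. one_cycle E c \<longrightarrow> c = {})"

lemma acyclic_edges_subset: "acyclic_edges E \<Longrightarrow> S \<subseteq> E \<Longrightarrow> acyclic_edges S"
  unfolding acyclic_edges_def one_cycle_def by blast

lemma acyclic_edges_bridge:
  "acyclic_edges E \<Longrightarrow> {x, y} \<in> E \<Longrightarrow> \<not> connected_in (E - {{x, y}}) x y"
  using connected_in_cycle[of E x y] unfolding acyclic_edges_def by (metis empty_iff is_edge_doubleton)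

lemma acyclic_edges_insert:
  assumes "acyclic_edges E" "\<not> connected_in E x y" shows "acyclic_edges (insert {x, y} E)"
  unfolding acyclic_edges_def
proof (intro conjI allI impI)
  have xy: "x \<noteq> y" using assms by auto
  have e: "insert {x, y} E - {{x, y}} = E"
    using assms connected_in_edge[of x y E] by auto
  show edge: "\<forall>e\<in>insert {x, y} E. is_edge e" using assms xy by (auto simp: acyclic_edges_def)
  fix c assume c: "one_cycle (insert {x, y} E) c"
  then have "{x, y} \<notin> c" using bridge_not_in_cycle[OF _ edge c] assms e by metis
  then have "one_cycle E c" using c by (auto simp: one_cycle_def)
  then show "c = {}" using assms by (simp add: acyclic_edges_def)
qed

text \<open>An edge lies on a cycle exactly if it is no bridge. Passing to \<open>edges G\<close>
  drops the vertices, which are mere loops for connectivity.\<close>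

lemma in_one_cycle_iff:
  assumes "{x, y} \<in> G" "x \<noteq> y"
  shows "in_one_cycle G {x, y} \<longleftrightarrow> connected_in (G - {{x, y}}) x y"
proof -
  have "edges G - {{x, y}} = edges (G - {{x, y}})" by (auto simp: edges_def)
  then have "connected_in (edges G - {{x, y}}) x y \<longleftrightarrow> connected_in (G - {{x, y}}) x y"
    by (simp add: connected_in_edges)
  moreover have "\<forall>e\<in>edges G. is_edge e" "{x, y} \<in> edges G" using assms by (auto simp: edges_def)
  ultimately show ?thesis
    using connected_in_cycle[of "edges G" x y] bridge_not_in_cycle[of "edges G" x y] assms
    unfolding in_one_cycle_def by metis
qed

text \<open>Every edge of a forest joins two different components when it is added and so lowers
  their number by one. Conversely to counting edges, components on a fixed vertex set can be
  compared between different forests.\<close>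

lemma card_components:
  assumes "finite E" "acyclic_edges E" "\<Union>E \<subseteq> V" "finite V"
  shows "card E + card (component E ` V) = card V"
  using assms(1-3)
proof (induction E rule: finite_induct)
  case empty
  have "component {} x = {x}" for x :: 'a
    by (auto simp: connected_in_def)
  then have "component {} ` V = (\<lambda>x. {x}) ` V" by simp
  then show ?case by (simp add: card_image)
next
  case (insert e E)
  have "is_edge e" using insert.prems by (auto simp: acyclic_edges_def)
  then obtain a b where e: "e = {a, b}" "a \<noteq> b" by (auto simp: is_edge_def)
  have "acyclic_edges E" using insert.prems acyclic_edges_subset by blast
  then have IH: "card E + card (component E ` V) = card V" using insert by simp
  have nc: "\<not> connected_in E a b"
    using acyclic_edges_bridge[of "insert e E" a b] insert e by simp
  have ab: "a \<in> V" "b \<in> V" using insert.prems e by auto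
  let ?A = "component E a" and ?B = "component E b"
  have AB: "?A \<noteq> ?B" using nc by (simp add: component_eq_iff)
  have img: "component (insert e E) ` V = insert (?A \<union> ?B) (component E ` V - {?A, ?B})"
  proof (intro equalityI subsetI)
    fix X assume "X \<in> component (insert e E) ` V"
    then obtain x where x: "x \<in> V" "X = component (insert e E) x" by auto
    then show "X \<in> insert (?A \<union> ?B) (component E ` V - {?A, ?B})"
      by (auto simp: e component_insert_edge component_eq_iff)
  next
    fix X assume X: "X \<in> insert (?A \<union> ?B) (component E ` V - {?A, ?B})"
    then consider "X = ?A \<union> ?B" | x where "x \<in> V" "X = component E x" "X \<noteq> ?A" "X \<noteq> ?B" by auto
    then show "X \<in> component (insert e E) ` V"
    proof cases
      case 1
      then have "X = component (insert e E) a" by (simp add: e component_insert_left)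
      then show ?thesis using ab by simp
    next
      case 2
      then have "X = component (insert e E) x" by (simp add: e component_insert_edge component_eq_iff)
      then show ?thesis using 2 by simp
    qed
  qed
  have new: "?A \<union> ?B \<notin> component E ` V - {?A, ?B}"
  proof
    assume "?A \<union> ?B \<in> component E ` V - {?A, ?B}"
    then obtain x where "?A \<union> ?B = component E x" by auto
    then have "connected_in E x a" "connected_in E x b" by (metis UnCI connected_in_refl mem_component)+
    then show False using nc connected_in_sym connected_in_trans by metis
  qed
  have "card {?A, ?B} = 2" using AB by simp
  moreover have "{?A, ?B} \<subseteq> component E ` V" using ab by auto
  ultimately have "card (component E ` V - {?A, ?B}) = card (component E ` V) - 2" "2 \<le> card (component E ` V)"
    using card_mono[of "component E ` V" "{?A, ?B}"] assms(4) by (simp_all add: card_Diff_subset)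
  then have "card (component (insert e E) ` V) + 1 = card (component E ` V)"
    using img new assms(4) by simp
  then show ?case using IH insert by simp
qed

text \<open>On a common vertex set a coarser partition has fewer parts, and by
  \<open>card_components\<close> fewer parts mean more edges.\<close>

lemma acyclic_card_le:
  assumes "finite E" "finite E'" "acyclic_edges E" "acyclic_edges E'"
    and sub: "\<And>x y. connected_in E x y \<Longrightarrow> connected_in E' x y"
  shows "card E \<le> card E'"
proof -
  let ?V = "\<Union>E \<union> \<Union>E'"
  have "finite f" if "f \<in> E \<union> E'" for f
    using assms(3,4) that by (auto simp: acyclic_edges_def is_edge_def)
  then have V: "finite ?V" using assms(1,2) by auto
  \<comment> \<open>Each component of \<open>E'\<close> is a union determined by a component of
    \<open>E\<close>, so the former are an image of the latter.\<close>
  have "component E' ` ?V = (\<lambda>C. \<Union>y\<in>C. component E' y) ` component E ` ?V"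
  proof -
    have *: "component E' x = (\<Union>y\<in>component E x. component E' y)" for x
    proof -
      have "component E' y = component E' x" if "y \<in> component E x" for y
        using sub[of x y] that by (auto simp: component_eq_iff dest: connected_in_sym)
      moreover have "x \<in> component E x" by simp
      ultimately show ?thesis by blast
    qed
    show ?thesis unfolding image_image by (rule image_cong[OF refl *])
  qed
  then have "card (component E' ` ?V) \<le> card (component E ` ?V)"
    using V by (metis card_image_le finite_imageI)
  moreover have "card E + card (component E ` ?V) = card ?V" "card E' + card (component E' ` ?V) = card ?V"
    using card_components[of E ?V] card_components[of E' ?V] assms V by auto
  ultimately show ?thesis by linarith
qed


subsection \<open>The minimum spanning forest\<close>

context graph_filtration
begin

lemma negatives_Suc:
  assumes "j < length F"
  shows "{e. negative F e \<and> idx F e < Suc j} =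
    (if negative F (F ! j) then insert (F ! j) {e. negative F e \<and> idx F e < j}
     else {e. negative F e \<and> idx F e < j})"
proof -
  have "negative F e \<and> idx F e < Suc j \<longleftrightarrow> negative F e \<and> idx F e < j \<or> negative F e \<and> e = F ! j" for e
    using negative_in_set[of e] nth_idx[of e] assms by (auto simp: less_Suc_eq)
  then show ?thesis by auto
qed

text \<open>A positive edge never changes the components, so omitting all of them loses no
  connection.\<close>

lemma negatives_connected:
  "j \<le> length F \<Longrightarrow> connected_in {e. negative F e \<and> idx F e < j} = connected_in (graph_at F j)"
proof (induction j)
  case 0
  then show ?case by (simp add: graph_at_def)
next
  case (Suc j)
  let ?N = "\<lambda>j. {e. negative F e \<and> idx F e < j}"
  have j: "j < length F" and IH: "connected_in (?N j) = connected_in (graph_at F j)" using Suc by auto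
  then have compIH: "component (?N j) = component (graph_at F j)" by (simp add: component_def fun_eq_iff)
  have s: "F ! j \<in> set F" "idx F (F ! j) = j" using j by auto
  have N: "?N (Suc j) = (if negative F (F ! j) then insert (F ! j) (?N j) else ?N j)"
    by (rule negatives_Suc[OF j])
  have "component (?N (Suc j)) x = component (graph_at F (Suc j)) x" for x
    using s(1)
  proof (cases rule: simplex_cases)
    case (vertex a)
    then show ?thesis using compIH negative_is_edge[of "F ! j"] unfolding N graph_at_Suc[OF j] by auto
  next
    case (edge a b)
    then have "negative F (F ! j) \<longleftrightarrow> \<not> connected_in (graph_at F j) a b"
      using s by (auto simp: negative_doubleton)
    moreover have "component (insert {a, b} (?N j)) x = component (insert {a, b} (graph_at F j)) x"
      by (simp only: component_insert_edge compIH IH)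
    ultimately show ?thesis
      using component_insert_connected[of "graph_at F j" a b x] fun_cong[OF compIH, of x]
      unfolding N graph_at_Suc[OF j] by (cases "negative F (F ! j)") (simp_all add: edge(1))
  qed
  then have "connected_in (?N (Suc j)) x y \<longleftrightarrow> connected_in (graph_at F (Suc j)) x y" for x y
    by (metis mem_component)
  then show ?case by blast
qed

lemma negatives_finite: "finite {e. negative F e}"
  by (rule finite_subset[of _ "set F"]) (auto simp: negative_in_set)

lemma negatives_acyclic: "acyclic_edges {e. negative F e}"
proof -
  let ?N = "\<lambda>j. {e. negative F e \<and> idx F e < j}"
  have "j \<le> length F \<Longrightarrow> acyclic_edges (?N j)" for j
  proof (induction j)
    case (Suc j)
    have j: "j < length F" using Suc by simp
    have s: "F ! j \<in> set F" "idx F (F ! j) = j" using j by auto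
    have N: "?N (Suc j) = (if negative F (F ! j) then insert (F ! j) (?N j) else ?N j)"
      by (rule negatives_Suc[OF j])
    show ?case
    proof (cases "negative F (F ! j)")
      case True
      then obtain a b where ab: "F ! j = {a, b}" "\<not> connected_in (graph_at F j) a b"
        using negative_obtain[OF True] s(2) by metis
      then have "\<not> connected_in (?N j) a b" using negatives_connected[of j] j by simp
      then show ?thesis using Suc True N ab acyclic_edges_insert[of "?N j" a b] by simp
    qed (use Suc N in simp)
  qed (simp add: acyclic_edges_def one_cycle_def)
  from this[of "length F"] show ?thesis
    using idx_less negative_in_set by (metis (no_types, lifting) Collect_cong le_refl)
qed

lemma negatives_connected_all: "connected_in {e. negative F e} = connected_in (set F)"
  using negatives_connected[of "length F"] idx_less negative_in_set
  by (metis (no_types, lifting) Collect_cong graph_at_length le_refl)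

lemma negatives_spanning_forest: "spanning_forest (set F) {e. negative F e}"
  using negatives_acyclic
  by (auto simp: spanning_forest_def acyclic_edges_def negatives_connected_all edges_def
      negative_in_set negative_is_edge)

lemma connected_in_set_vertices:
  "connected_in (set F) x y \<Longrightarrow> x \<noteq> y \<Longrightarrow> x \<in> verts (set F) \<and> y \<in> verts (set F)"
  using connected_in_graph_at_vertices[of "length F" x y] by (simp add: verts_def)

text \<open>The index of \<open>e\<close> is the number of \<open>j\<close> below it, that is, of
  the graphs with number \<open>Suc j\<close> in which \<open>e\<close> is still missing. Exchanging
  the two sums expresses the weight by the ranks of \<open>S\<close> over time.\<close>

lemma sum_idx:
  assumes "S \<subseteq> set F"
  shows "sum (idx F) S = (\<Sum>j<length F. card S - card (S \<inter> graph_at F (Suc j)))"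
proof -
  have fin: "finite S" using assms finite_subset by auto
  have "sum (idx F) S = (\<Sum>e\<in>S. \<Sum>j<length F. if j < idx F e then 1 else 0)"
  proof (rule sum.cong)
    fix e assume "e \<in> S"
    then have "{..<length F} \<inter> {j. j < idx F e} = {..<idx F e}" using idx_less assms by force
    then show "idx F e = (\<Sum>j<length F. if j < idx F e then 1 else 0)" by (simp add: sum.If_cases)
  qed simp
  also have "\<dots> = (\<Sum>j<length F. \<Sum>e\<in>S. if j < idx F e then 1 else 0)" by (rule sum.swap)
  also have "\<dots> = (\<Sum>j<length F. card S - card (S \<inter> graph_at F (Suc j)))"
  proof (rule sum.cong)
    fix j
    have "S \<inter> {e. j < idx F e} = S - (S \<inter> graph_at F (Suc j))" using assms by (auto simp: mem_graph_at)
    then show "(\<Sum>e\<in>S. if j < idx F e then 1 else 0) = card S - card (S \<inter> graph_at F (Suc j))"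
      using fin by (simp add: sum.If_cases card_Diff_subset)
  qed simp
  finally show ?thesis .
qed

text \<open>At every time the negative edges connect whatever the graph connects, so no other forest
  inside this graph can have more edges. At the end both forests have the same components.\<close>

lemma spanning_forest_rank:
  assumes S: "spanning_forest (set F) S"
  shows "card (S \<inter> graph_at F j) \<le> card ({e. negative F e} \<inter> graph_at F j)"
    and "card S = card {e. negative F e}"
proof -
  have SF: "S \<subseteq> set F" and acyc: "acyclic_edges S"
    using S by (auto simp: spanning_forest_def acyclic_edges_def edges_def)
  have fin: "finite S" using SF finite_subset by auto
  show "card (S \<inter> graph_at F j) \<le> card ({e. negative F e} \<inter> graph_at F j)"
  proof (cases "j \<le> length F")
    case True
    have "{e. negative F e} \<inter> graph_at F j = {e. negative F e \<and> idx F e < j}"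
      by (auto simp: mem_graph_at negative_in_set)
    then have "connected_in ({e. negative F e} \<inter> graph_at F j) = connected_in (graph_at F j)"
      using negatives_connected[OF True] by simp
    then show ?thesis using fin negatives_finite acyc negatives_acyclic
      by (intro acyclic_card_le) (auto elim: acyclic_edges_subset connected_in_mono)
  next
    case False
    then have "graph_at F j = set F" by (simp add: graph_at_def)
    have "connected_in S x y \<Longrightarrow> connected_in {e. negative F e} x y" for x y
      using SF negatives_connected_all connected_in_mono by metis
    then show ?thesis using fin negatives_finite acyc negatives_acyclic SF \<open>graph_at F j = set F\<close>
        acyclic_card_le[of S "{e. negative F e}"] negative_in_set
      by (metis (mono_tags, lifting) inf.absorb1 mem_Collect_eq subsetI)
  qed
  have "connected_in S x y \<longleftrightarrow> connected_in {e. negative F e} x y" for x y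
  proof (cases "x = y")
    case False
    then show ?thesis
      using S connected_in_set_vertices[of x y] SF connected_in_mono[of S x y "set F"]
      unfolding spanning_forest_def negatives_connected_all by blast
  qed simp
  then show "card S = card {e. negative F e}"
    using acyclic_card_le[of S] acyclic_card_le[of _ S] fin negatives_finite acyc negatives_acyclic
    by (metis le_antisym)
qed

text \<open>By \<open>sum_idx\<close> and \<open>spanning_forest_rank\<close> the weights are
  compared term by term. Equal total weight therefore forces equal ranks at all times, and the ranks
  determine the set; this also makes the minimum unique.\<close>

lemma minimum_spanning_forest_iff:
  "minimum_spanning_forest (idx F) (set F) S \<longleftrightarrow> S = {e. negative F e}"
proof -
  let ?N = "{e. negative F e}"
  have N: "?N \<subseteq> set F" by (auto simp: negative_in_set)
  have le: "sum (idx F) ?N \<le> sum (idx F) S" if "spanning_forest (set F) S" for S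
  proof -
    have "S \<subseteq> set F" using that by (auto simp: spanning_forest_def edges_def)
    then show ?thesis using spanning_forest_rank[OF that] N
      by (auto simp: sum_idx intro!: sum_mono diff_le_mono2)
  qed
  have eq: "S = ?N" if S: "spanning_forest (set F) S" and min: "sum (idx F) S \<le> sum (idx F) ?N" for S
  proof -
    have SF: "S \<subseteq> set F" using S by (auto simp: spanning_forest_def edges_def)
    then have fin: "finite S" using finite_subset by auto
    have cle: "card (S \<inter> graph_at F j) \<le> card S" "card (?N \<inter> graph_at F j) \<le> card ?N" for j
      using fin negatives_finite by (auto intro: card_mono)
    have "(\<Sum>j<length F. card ?N - card (?N \<inter> graph_at F (Suc j))) =
        (\<Sum>j<length F. card S - card (S \<inter> graph_at F (Suc j)))"
      using le[OF S] min sum_idx SF N by (metis le_antisym)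
    then have "card ?N - card (?N \<inter> graph_at F (Suc j)) = card S - card (S \<inter> graph_at F (Suc j))"
      if "j < length F" for j
      by (rule sum_mono_inv) (use spanning_forest_rank[OF S] that in \<open>auto intro!: diff_le_mono2\<close>)
    then have card_eq: "card (?N \<inter> graph_at F (Suc j)) = card (S \<inter> graph_at F (Suc j))" if "j < length F" for j
      using that cle[of "Suc j"] spanning_forest_rank(2)[OF S] by (metis diff_diff_cancel)
    \<comment> \<open>The rank increases between consecutive times exactly if the simplex added
      there belongs to the set.\<close>
    have step: "card (X \<inter> graph_at F (Suc j)) = card (X \<inter> graph_at F j) + (if F ! j \<in> X then 1 else 0)"
      if "j < length F" "finite X" for X j
    proof -
      have "F ! j \<notin> graph_at F j" using that by (simp add: mem_graph_at)
      then show ?thesis using that by (auto simp: graph_at_Suc)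
    qed
    have "F ! j \<in> S \<longleftrightarrow> F ! j \<in> ?N" if j: "j < length F" for j
    proof -
      have "card (?N \<inter> graph_at F j) = card (S \<inter> graph_at F j)"
      proof (cases j)
        case (Suc k)
        then show ?thesis using card_eq[of k] j by simp
      qed (simp add: graph_at_def)
      then show ?thesis using card_eq[OF j] step[OF j fin] step[OF j negatives_finite]
        by (auto split: if_splits)
    qed
    then have "e \<in> S \<longleftrightarrow> e \<in> ?N" if "e \<in> set F" for e using that by (metis in_set_conv_nth)
    then show ?thesis using SF N by blast
  qed
  show ?thesis using le eq negatives_spanning_forest unfolding minimum_spanning_forest_def by blast
qed

end


subsection \<open>Bottlenecks\<close>

lemma simple_path_Cons:
  "simple_path E x y (v # p) \<longleftrightarrow> v = x \<and> (p = [] \<and> x = y \<or> p \<noteq> [] \<and> x \<notin> set p \<and> {x, hd p} \<in> E \<and> simple_path E (hd p) y p)"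
proof (cases p)
  case (Cons w q)
  have "(\<forall>k. Suc k < length (v # p) \<longrightarrow> {(v # p) ! k, (v # p) ! Suc k} \<in> E) \<longleftrightarrow>
      {v, w} \<in> E \<and> (\<forall>k. Suc k < length p \<longrightarrow> {p ! k, p ! Suc k} \<in> E)"
    using Cons by (auto simp: less_Suc_eq_0_disj nth_Cons split: nat.splits)
  then show ?thesis using Cons unfolding simple_path_def by auto
qed (auto simp: simple_path_def)

lemma path_edges_Cons: "p \<noteq> [] \<Longrightarrow> path_edges (v # p) = insert {v, hd p} (path_edges p)"
proof -
  assume p: "p \<noteq> []"
  have "{k. Suc k < length (v # p)} = insert 0 (Suc ` {k. Suc k < length p})"
    using p by (auto simp: image_iff) (metis Suc_pred' bot_nat_0.not_eq_extremum less_Suc_eq_0_disj)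
  moreover have "path_edges q = (\<lambda>k. {q ! k, q ! Suc k}) ` {k. Suc k < length q}" for q :: "'a list"
    by (auto simp: path_edges_def)
  ultimately show ?thesis using p by (simp add: image_image hd_conv_nth)
qed

lemma path_edges_Nil [simp]: "path_edges [] = {}" "path_edges [v] = {}"
  by (auto simp: path_edges_def)

lemma finite_path_edges: "finite (path_edges p)"
  unfolding path_edges_def by (rule finite_image_set) (simp add: finite_subset[of _ "{..<length p}"] subset_iff)

lemma simple_path_subset: "simple_path E x y p \<Longrightarrow> path_edges p \<subseteq> E"
  by (auto simp: simple_path_def path_edges_def)

lemma simple_path_path_edges: "simple_path E x y p \<Longrightarrow> path_edges p \<subseteq> E' \<Longrightarrow> simple_path E' x y p"
  by (auto simp: simple_path_def path_edges_def)

lemma simple_path_connected: "simple_path E x y p \<Longrightarrow> connected_in E x y"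
proof (induction p arbitrary: x)
  case (Cons v p)
  then show ?case by (auto simp: simple_path_Cons) (meson connected_in_edge connected_in_trans)
qed (simp add: simple_path_def)

lemma connected_simple_path:
  assumes "connected_in E x y" shows "\<exists>p. simple_path E x y p"
proof -
  have "connected_in E y x" using assms by (rule connected_in_sym)
  then show ?thesis
  proof (induction rule: connected_in_induct)
    case refl
    show ?case by (rule exI[of _ "[y]"]) (simp add: simple_path_def)
  next
    case (step v z)
    then obtain p where p: "simple_path E v y p" by blast
    show ?case
    proof (cases "z \<in> set p")
      case True
      \<comment> \<open>If the new first point already lies on the path, the part of the path from
        there on is taken instead.\<close>
      have "simple_path E v y p \<Longrightarrow> z \<in> set p \<Longrightarrow> \<exists>q. simple_path E z y q" for v p
      proof (induction p arbitrary: v)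
        case (Cons w p)
        show ?case
        proof (cases "z = w")
          case True
          then have "simple_path E z y (w # p)" using Cons.prems(1) by (auto simp: simple_path_Cons)
          then show ?thesis by blast
        next
          case False
          then have "z \<in> set p" "simple_path E (hd p) y p"
            using Cons.prems by (auto simp: simple_path_Cons)
          then show ?thesis using Cons.IH by blast
        qed
      qed simp
      then show ?thesis using p True by blast
    next
      case False
      then have "simple_path E z y (z # p)"
        using p step.hyps unfolding simple_path_Cons by (auto simp: simple_path_def insert_commute)
      then show ?thesis by blast
    qed
  qed
qed

lemma simple_path_avoids: "simple_path E x y p \<Longrightarrow> a \<notin> set p \<Longrightarrow> simple_path (E - {{a, b}}) x y p"
proof (induction p arbitrary: x)
  case (Cons v p)
  then show ?case using hd_in_set[of p] by (auto simp: simple_path_Cons doubleton_eq_iff)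
qed (simp add: simple_path_def)

text \<open>If the paths took different first steps, the first edge of \<open>p\<close> could be
  bypassed: go along \<open>q\<close> to \<open>y\<close> and back along \<open>p\<close>. In an
  acyclic set every edge is a bridge, which rules this out.\<close>

lemma simple_path_unique:
  assumes "acyclic_edges E" "simple_path E x y p" "simple_path E x y q"
  shows "p = q"
  using assms(2,3)
proof (induction p arbitrary: x q)
  case (Cons v p)
  then obtain w q' where q: "q = w # q'" by (cases q) (auto simp: simple_path_def)
  have lastE: "last p = y" if "p \<noteq> []" using Cons.prems that by (simp add: simple_path_def)
  have lastq: "last q' = y" if "q' \<noteq> []" using Cons.prems that q by (simp add: simple_path_def)
  note P = Cons.prems(1)[unfolded simple_path_Cons] and Q = Cons.prems(2)[unfolded q simple_path_Cons]
  show ?case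
  proof (cases "x = y")
    case True
    then have "p = []" "q' = []" using P Q lastE lastq last_in_set by metis+
    then show ?thesis using P Q q by simp
  next
    case False
    then have p: "p \<noteq> []" "x \<notin> set p" "{x, hd p} \<in> E" "simple_path E (hd p) y p"
      and q': "q' \<noteq> []" "x \<notin> set q'" "{x, hd q'} \<in> E" "simple_path E (hd q') y q'"
      using P Q by auto
    have "hd p = hd q'"
    proof (rule ccontr)
      assume ne: "hd p \<noteq> hd q'"
      let ?E = "E - {{x, hd p}}"
      have "connected_in ?E (hd p) y" "connected_in ?E (hd q') y"
        using p q' simple_path_avoids simple_path_connected by metis+
      moreover have "{x, hd q'} \<in> ?E" using q' ne by (auto simp: doubleton_eq_iff)
      ultimately have "connected_in ?E x (hd p)"
        by (meson connected_in_edge connected_in_sym connected_in_trans)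
      then show False using acyclic_edges_bridge[OF assms(1) p(3)] by simp
    qed
    then show ?thesis using Cons.IH p q' P Q q by metis
  qed
qed (simp add: simple_path_def)

text \<open>A path consisting of light edges is a path of the whole forest and thus, by uniqueness,
  the very path on which the maximum is taken.\<close>

lemma bottleneck_le_iff:
  assumes ac: "acyclic_edges (dom W)" and xy: "connected_in (dom W) x y" "x \<noteq> y"
  shows "bottleneck W x y \<le> k \<longleftrightarrow> connected_in {e \<in> dom W. the (W e) \<le> k} x y"
proof -
  obtain p where p: "simple_path (dom W) x y p" using connected_simple_path[OF xy(1)] by auto
  then have the_p: "(THE p. simple_path (dom W) x y p) = p"
    using simple_path_unique[OF ac] by (intro the_equality)
  have "path_edges p \<noteq> {}"
  proof (cases p)
    case (Cons v q)
    then have "q \<noteq> []" using p xy by (auto simp: simple_path_def)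
    then show ?thesis using Cons by (simp add: path_edges_Cons)
  qed (use p in \<open>simp add: simple_path_def\<close>)
  then have "bottleneck W x y \<le> k \<longleftrightarrow> (\<forall>e\<in>path_edges p. the (W e) \<le> k)"
    unfolding bottleneck_def the_p by (simp add: finite_path_edges)
  also have "\<dots> \<longleftrightarrow> connected_in {e \<in> dom W. the (W e) \<le> k} x y"
  proof
    assume "\<forall>e\<in>path_edges p. the (W e) \<le> k"
    then have "simple_path {e \<in> dom W. the (W e) \<le> k} x y p"
      using p simple_path_subset[OF p] by (intro simple_path_path_edges[OF p]) auto
    then show "connected_in {e \<in> dom W. the (W e) \<le> k} x y" by (rule simple_path_connected)
  next
    assume "connected_in {e \<in> dom W. the (W e) \<le> k} x y"
    then obtain q where q: "simple_path {e \<in> dom W. the (W e) \<le> k} x y q"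
      using connected_simple_path by fast
    then have "simple_path (dom W) x y q"
      using simple_path_subset[OF q] by (intro simple_path_path_edges[OF q]) auto
    then have "q = p" using simple_path_unique[OF ac] p by blast
    then show "\<forall>e\<in>path_edges p. the (W e) \<le> k" using simple_path_subset[OF q] by auto
  qed
  finally show ?thesis .
qed

text \<open>The shift by one is due to an edge of index \<open>k\<close> being present only from the
  graph with number \<open>Suc k\<close> on.\<close>

lemma (in graph_filtration) bottleneck_le_iff_connected:
  assumes W: "dom W = {e. negative F e}" "\<forall>e\<in>dom W. W e = Some (idx F e)"
    and xy: "connected_in (set F) x y" "x \<noteq> y" and k: "k < length F"
  shows "bottleneck W x y \<le> k \<longleftrightarrow> connected_in (graph_at F (Suc k)) x y"
proof -
  have "{e \<in> dom W. the (W e) \<le> k} = {e. negative F e \<and> idx F e < Suc k}"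
    using W by (auto simp: less_Suc_eq_le)
  then show ?thesis
    using bottleneck_le_iff[of W x y k] negatives_acyclic negatives_connected[of "Suc k"]
      negatives_connected_all W(1) xy k by simp
qed


subsection \<open>Switches\<close>

text \<open>The position \<open>i\<close> of the switch is \<open>Suc k\<close>, which removes the
  subtraction \<open>i - 1\<close>. \<open>G\<close> is the last graph that contains neither of the
  switched simplices.\<close>

locale graph_switch = graph_filtration F for F :: "'v simplex list" +
  fixes k :: nat
  assumes k: "Suc k < length F" and not_subset: "\<not> F ! k \<subseteq> F ! Suc k"
begin

abbreviation "F' \<equiv> switch F (Suc k)"
abbreviation "\<sigma> \<equiv> F ! k"
abbreviation "\<tau> \<equiv> F ! Suc k"
abbreviation "G \<equiv> graph_at F k"

lemma length_switch [simp]: "length F' = length F"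
  by (simp add: switch_def)

lemma mem_switched [simp]: "\<sigma> \<in> set F" "\<tau> \<in> set F"
  using k by auto

lemma idx_switched [simp]: "idx F \<sigma> = k" "idx F \<tau> = Suc k"
  using k by auto

lemma switched_neq [simp]: "\<sigma> \<noteq> \<tau>" "\<tau> \<noteq> \<sigma>"
  using not_subset by auto

lemma set_switch [simp]: "set F' = set F"
  using k by (simp add: switch_def)

lemma nth_switch:
  "j < length F \<Longrightarrow> F' ! j = (if j = Suc k then \<sigma> else if j = k then \<tau> else F ! j)"
  using k by (auto simp: switch_def nth_list_update)

lemma graph_at_Suc_k: "graph_at F (Suc k) = insert \<sigma> G"
  using graph_at_Suc[of k F] k by simp

lemma graph_at_Suc_Suc_k: "graph_at F (Suc (Suc k)) = insert \<tau> (insert \<sigma> G)"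
  using graph_at_Suc[of "Suc k" F] k by (simp add: graph_at_Suc_k)

lemma graph_at_switch_below: "j \<le> k \<Longrightarrow> graph_at F' j = graph_at F j"
  unfolding graph_at_def switch_def by simp

lemma graph_at_switch_Suc_k: "graph_at F' (Suc k) = insert \<tau> G"
  using graph_at_Suc[of k F'] k graph_at_switch_below[of k] by (simp add: nth_switch)

lemma graph_at_switch: "j \<noteq> Suc k \<Longrightarrow> graph_at F' j = graph_at F j"
proof (cases "j \<le> k")
  case False
  assume "j \<noteq> Suc k"
  with False have "Suc (Suc k) \<le> j" by simp
  then show ?thesis
  proof (induction j rule: dec_induct)
    case base
    have "graph_at F' (Suc (Suc k)) = insert \<sigma> (insert \<tau> G)"
      using graph_at_Suc[of "Suc k" F'] k by (simp add: graph_at_switch_Suc_k nth_switch)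
    then show ?case by (simp add: graph_at_Suc_Suc_k insert_commute)
  next
    case (step j)
    show ?case
    proof (cases "j < length F")
      case True
      then show ?thesis using step graph_at_Suc[of j F] graph_at_Suc[of j F'] k
        by (simp add: nth_switch)
    next
      case False
      then show ?thesis using graph_at_length[of F] graph_at_length[of F'] by (simp add: graph_at_def)
    qed
  qed
qed (simp add: graph_at_switch_below)

lemma filtration_switch: "filtration F'"
  unfolding filtration_def
proof (intro conjI allI impI)
  show "distinct F'" using distinct k by (simp add: switch_def)
  fix j assume j: "j < length F'"
  have *: "is_vertex (F ! j) \<or> is_edge (F ! j) \<and> F ! j \<subseteq> verts (graph_at F j)" if "j < length F" for j
    using filtration that by (auto simp: filtration_def)
  \<comment> \<open>The point where the side condition of a switch enters: the endpoints of
    \<open>\<tau>\<close> are already present in \<open>G\<close>.\<close>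
  have "{x} \<noteq> \<sigma>" if "x \<in> \<tau>" for x using not_subset that by (metis empty_subsetI insert_subset)
  then have "\<tau> \<subseteq> verts (graph_at F (Suc k)) \<Longrightarrow> \<tau> \<subseteq> verts G"
    by (auto simp: graph_at_Suc_k verts_def)
  moreover have "verts G \<subseteq> verts (graph_at F' (Suc k))"
    by (auto simp: graph_at_switch_Suc_k verts_def)
  ultimately show "is_vertex (F' ! j) \<or> is_edge (F' ! j) \<and> F' ! j \<subseteq> verts (graph_at F' j)"
    using j *[of j] *[of k] *[of "Suc k"] k graph_at_switch[of j] by (auto simp: nth_switch)
qed

end

text \<open>From here on every fact about filtrations is available for \<open>F'\<close> too, under
  the prefix \<open>sw\<close>.\<close>

sublocale graph_switch \<subseteq> sw: graph_filtration "switch F (Suc k)"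
  by unfold_locales (rule filtration_switch)

lemma switchable_graph_switch:
  assumes "switchable F i"
  obtains k where "i = Suc k" "graph_switch F k"
  using assms by (cases i)
    (auto simp: switchable_def graph_switch_def graph_filtration_def graph_switch_axioms_def)

section \<open>Comparison of a filtration before and after a switch\<close>

context graph_switch
begin

lemma idx_other_neq:
  assumes "s \<in> set F" "s \<noteq> \<sigma>" "s \<noteq> \<tau>"
  shows "idx F s \<noteq> Suc k" "idx F s \<noteq> k"
  using assms idx_switched idx_eq_iff mem_switched by metis+

lemma idx_switch:
  assumes "s \<in> set F"
  shows "idx F' s = (if s = \<sigma> then Suc k else if s = \<tau> then k else idx F s)"
proof -
  define l where "l = (if s = \<sigma> then Suc k else if s = \<tau> then k else idx F s)"
  have "l < length F'" using k idx_less[OF assms] by (simp add: l_def)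
  moreover have "F' ! l = s"
    using assms k idx_less[OF assms] idx_other_neq[OF assms] by (simp add: l_def nth_switch)
  ultimately show ?thesis using sw.idx_nth l_def by metis
qed

lemma idx_switch_switched [simp]: "idx F' \<sigma> = Suc k" "idx F' \<tau> = k"
  by (simp_all add: idx_switch)

lemma idx_other:
  assumes "s \<in> set F" "s \<noteq> \<sigma>" "s \<noteq> \<tau>"
  shows "idx F' s = idx F s"
  using assms by (simp add: idx_switch)

text \<open>The two exchanged indices are consecutive, so no third simplex lies between them and
  only their mutual order is reversed.\<close>

lemma idx_switch_less:
  assumes "s \<in> set F" "t \<in> set F" "{s, t} \<noteq> {\<sigma>, \<tau>}"
  shows "idx F' s < idx F' t \<longleftrightarrow> idx F s < idx F t"
proof -
  have neq: "idx F r \<noteq> k" "idx F r \<noteq> Suc k" if "r \<in> {s, t}" "r \<noteq> \<sigma>" "r \<noteq> \<tau>" for r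
    using assms idx_other_neq[of r] that by blast+
  have iff: "n < Suc k \<longleftrightarrow> n < k" "k < n \<longleftrightarrow> Suc k < n" if "n \<noteq> k" "n \<noteq> Suc k" for n
    using that by linarith+
  consider "s = t" | "s = \<sigma>" "t \<noteq> \<sigma>" "t \<noteq> \<tau>" | "s = \<tau>" "t \<noteq> \<sigma>" "t \<noteq> \<tau>"
    | "t = \<sigma>" "s \<noteq> \<sigma>" "s \<noteq> \<tau>" | "t = \<tau>" "s \<noteq> \<sigma>" "s \<noteq> \<tau>"
    | "s \<noteq> \<sigma>" "s \<noteq> \<tau>" "t \<noteq> \<sigma>" "t \<noteq> \<tau>"
    using assms(3) by (metis insert_commute)
  then show ?thesis
    using neq[of s] neq[of t] iff[of "idx F s"] iff[of "idx F t"] assms(1,2)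
    by cases (simp_all add: idx_switch)
qed

lemma idx_switch_le:
  assumes "s \<in> set F" "t \<in> set F" "{s, t} \<noteq> {\<sigma>, \<tau>}"
  shows "idx F' s \<le> idx F' t \<longleftrightarrow> idx F s \<le> idx F t"
  using idx_switch_less[of t s] assms by (metis insert_commute not_le)

text \<open>The only graph that differs is the one with number \<open>Suc k\<close>, and no simplex
  other than \<open>\<sigma>\<close> and \<open>\<tau>\<close> is added directly before or after
  it.\<close>

lemma other_graphs:
  assumes "s \<in> set F" "s \<noteq> \<sigma>" "s \<noteq> \<tau>"
  shows "graph_at F' (idx F' s) = graph_at F (idx F s)"
    "graph_at F' (Suc (idx F' s)) = graph_at F (Suc (idx F s))"
  using idx_other[OF assms] idx_other_neq[OF assms] graph_at_switch by simp_all

lemma other_negative: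
  "s \<in> set F \<Longrightarrow> s \<noteq> \<sigma> \<Longrightarrow> s \<noteq> \<tau> \<Longrightarrow> negative F' s \<longleftrightarrow> negative F s"
  by (simp add: negative_def other_graphs)

lemma other_node_comp:
  "s \<in> set F \<Longrightarrow> s \<noteq> \<sigma> \<Longrightarrow> s \<noteq> \<tau> \<Longrightarrow> node_comp F' s = node_comp F s"
  by (simp add: node_comp_def other_graphs)

lemma other_node:
  "s \<noteq> \<sigma> \<Longrightarrow> s \<noteq> \<tau> \<Longrightarrow> is_node F' s \<longleftrightarrow> is_node F s"
  by (metis is_node_def other_negative set_switch)

lemma graphs_switched:
  "graph_at F (idx F \<sigma>) = G" "graph_at F' (idx F' \<tau>) = G"
  "graph_at F (idx F \<tau>) = insert \<sigma> G" "graph_at F' (idx F' \<sigma>) = insert \<tau> G"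
  using graph_at_switch[of k] by (simp_all add: graph_at_Suc_k graph_at_switch_Suc_k)

text \<open>Unless \<open>C\<close> contains both switched vertices, the age order inside
  \<open>C\<close> is unchanged.\<close>

lemma oldest_switch:
  assumes "x \<in> C" "\<And>y. y \<in> C \<Longrightarrow> {y} \<in> set F \<and> idx F {x} \<le> idx F {y}"
    "\<not> (is_vertex \<sigma> \<and> is_vertex \<tau> \<and> \<sigma> \<union> \<tau> \<subseteq> C)"
  shows "oldest F' C = oldest F C"
proof -
  have "oldest F C = {x}" using assms by (intro oldest_eqI)
  moreover have "oldest F' C = {x}"
  proof (rule sw.oldest_eqI)
    fix y assume y: "y \<in> C"
    have "{{x}, {y}} \<noteq> {\<sigma>, \<tau>}"
      using assms(1,3) y by (auto simp: doubleton_eq_iff) (metis is_vertex_singleton)+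
    then show "{y} \<in> set F' \<and> idx F' {x} \<le> idx F' {y}"
      using assms(1,2) y idx_switch_le by (metis set_switch)
  qed (use assms in simp)
  ultimately show ?thesis by simp
qed

text \<open>It suffices to compare the structure: the levels of inner nodes are recomputed.\<close>

lemma update_levels_eqI:
  assumes nodes: "\<And>s. s \<in> nodes T \<longleftrightarrow> is_node F' s"
    and parent: "\<And>s e. parent T s = Some e \<longleftrightarrow> is_parent F' e s"
    and level: "\<And>x. {x} \<in> set F \<Longrightarrow> level T {x} = Some (idx F {x})"
  shows "update_levels F (Suc k) T = MF F'"
proof (rule forest_eqI)
  have "parent T s = parent (MF F') s" for s
    by (rule option_eqI_Some) (simp add: parent sw.parent_MF)
  then have par: "parent T = parent (MF F')" by blast
  then show "parent (update_levels F (Suc k) T) = parent (MF F')" by (simp add: update_levels_def)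
  have "is_leaf T s \<longleftrightarrow> is_leaf (MF F') s" for s
    unfolding is_leaf_def children_def par nodes sw.nodes_MF ..
  then have leaf: "is_leaf T s \<longleftrightarrow> s \<in> set F \<and> is_vertex s" for s
    by (simp add: sw.is_leaf_MF)
  show "level (update_levels F (Suc k) T) = level (MF F')"
  proof
    fix s
    show "level (update_levels F (Suc k) T) s = level (MF F') s"
    proof (cases "is_leaf T s \<and> s \<notin> {\<sigma>, \<tau>}")
      case True
      then have "level T s = Some (idx F s)" "is_node F' s" "idx F' s = idx F s"
        using leaf level idx_other[of s] by (auto simp: is_vertex_def is_node_def)
      then show ?thesis using True nodes by (simp add: update_levels_def sw.level_MF)
    next
      case False
      then show ?thesis using nodes by (simp add: update_levels_def sw.level_MF) blast
    qed
  qed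
qed

text \<open>The common criterion for all cases that keep the structure of the forest; unless two
  vertices are switched, it also keeps the pairing. Only \<open>\<sigma>\<close> and
  \<open>\<tau>\<close> need inspection, because all other simplices are added to the same graph as
  before.\<close>

definition stable :: bool where
  "stable \<longleftrightarrow> (\<forall>s\<in>{\<sigma>, \<tau>}. negative F' s \<longleftrightarrow> negative F s) \<and>
     (\<forall>s\<in>{\<sigma>, \<tau>}. \<forall>x\<in>s. negative F s \<longrightarrow>
        component (graph_at F' (idx F' s)) x = component (graph_at F (idx F s)) x)"

lemma stable_negative: "stable \<Longrightarrow> negative F' s \<longleftrightarrow> negative F s"
  using other_negative[of s] negative_in_set[of s] sw.negative_in_set[of s]
  unfolding stable_def set_switch by blast

lemma stable_component:
  "stable \<Longrightarrow> negative F s \<Longrightarrow> x \<in> s \<Longrightarrow>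
     component (graph_at F' (idx F' s)) x = component (graph_at F (idx F s)) x"
  using other_graphs(1)[of s] negative_in_set[of s] unfolding stable_def by (metis insertCI)

lemma stable_node: "stable \<Longrightarrow> is_node F' s \<longleftrightarrow> is_node F s"
  by (simp add: is_node_def stable_negative)

lemma stable_node_comp:
  assumes "stable" "is_node F s" shows "node_comp F' s = node_comp F s"
  using assms(2)
proof (cases rule: node_cases)
  case (edge x y)
  then show ?thesis
    using node_comp_edge[of x y] sw.node_comp_edge[of x y] negative_in_set[of s]
      stable_component[OF assms(1), of s] by simp
qed simp

lemma stable_is_parent: "stable \<Longrightarrow> is_parent F' e s \<longleftrightarrow> is_parent F e s"
  unfolding is_parent_def
  by (metis stable_component stable_negative stable_node stable_node_comp)

lemma stable_MF: "stable \<Longrightarrow> update_levels F (Suc k) (MF F) = MF F'"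
  by (intro update_levels_eqI) (auto simp: stable_node stable_is_parent parent_MF level_MF vertex_is_node)

end

section \<open>The pairing in terms of oldest vertices of components\<close>

context graph_filtration
begin

lemma oldest_component:
  assumes "j \<le> length F" "{x} \<in> graph_at F j"
  obtains y where "oldest F (component (graph_at F j) x) = {y}" "y \<in> component (graph_at F j) x"
    "\<And>z. z \<in> component (graph_at F j) x \<Longrightarrow> {z} \<in> set F \<and> idx F {y} \<le> idx F {z}"
proof -
  let ?C = "component (graph_at F j) x"
  have v: "{z} \<in> set F" if "z \<in> ?C" for z
    using that assms connected_in_graph_at_vertices[of j x z] by (cases "x = z") (auto simp: mem_graph_at)
  obtain y where "y \<in> ?C" "\<forall>z. z \<in> ?C \<longrightarrow> idx F {y} \<le> idx F {z}"
    using ex_has_least_nat[of "\<lambda>z. z \<in> ?C" x "\<lambda>z. idx F {z}"] by auto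
  then show thesis using that[of y] v oldest_eqI[of y ?C] by blast
qed

definition oldest_pt :: "nat \<Rightarrow> 'v \<Rightarrow> 'v simplex" where
  "oldest_pt j x = oldest F (component (graph_at F j) x)"

text \<open>The definition of \<open>pairing\<close> admits both orders of the endpoints. They
  agree, since the two oldest vertices lie in different components and so have different indices,
  for which \<open>younger\<close> is symmetric.\<close>

lemma pairing_iff:
  assumes "negative F {x, y}"
  shows "(s, {x, y}) \<in> pairing F \<longleftrightarrow>
    s = younger F (oldest_pt (idx F {x, y}) x) (oldest_pt (idx F {x, y}) y)"
proof -
  let ?j = "idx F {x, y}"
  have xy: "{x} \<in> graph_at F ?j" "{y} \<in> graph_at F ?j" "?j \<le> length F"
    using edge_endpoint[OF negative_in_set[OF assms] negative_is_edge[OF assms]]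
      idx_less[OF negative_in_set[OF assms]] by (auto simp: mem_graph_at)
  have "oldest_pt ?j x \<noteq> oldest_pt ?j y \<and> oldest_pt ?j x \<in> set F \<and> oldest_pt ?j y \<in> set F"
    unfolding oldest_pt_def
    by (rule oldest_component[OF xy(3,1)], rule oldest_component[OF xy(3,2)])
      (use assms in \<open>auto simp: negative_doubleton dest: connected_in_sym intro: connected_in_trans\<close>)
  then have "younger F (oldest_pt ?j x) (oldest_pt ?j y) = younger F (oldest_pt ?j y) (oldest_pt ?j x)"
    unfolding younger_def using idx_eq_iff by (metis linorder_less_linear order_less_asym)
  then show ?thesis using assms unfolding pairing_def oldest_pt_def
    by (auto simp: doubleton_eq_iff insert_commute)
qed

lemma pairing_negative: "(s, e) \<in> pairing F \<Longrightarrow> negative F e"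
  by (simp add: pairing_def)

end

context graph_switch
begin

lemma younger_switch:
  "s \<in> set F \<Longrightarrow> t \<in> set F \<Longrightarrow> {s, t} \<noteq> {\<sigma>, \<tau>} \<Longrightarrow> younger F' s t = younger F s t"
  by (simp add: younger_def idx_switch_less)

lemma oldest_pt_switch:
  assumes "\<not> (is_vertex \<sigma> \<and> is_vertex \<tau>)" "negative F e" "x \<in> e"
    and "component (graph_at F' j) x' = component (graph_at F (idx F e)) x"
  shows "sw.oldest_pt j x' = oldest_pt (idx F e) x"
proof -
  have "{x} \<in> graph_at F (idx F e)" "idx F e \<le> length F"
    using edge_endpoint[of e x] assms idx_less[of e] negative_in_set negative_is_edge
    by (simp_all add: mem_graph_at less_imp_le)
  then obtain y where "y \<in> component (graph_at F (idx F e)) x"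
    "\<And>z. z \<in> component (graph_at F (idx F e)) x \<Longrightarrow> {z} \<in> set F \<and> idx F {y} \<le> idx F {z}"
    using oldest_component by metis
  then show ?thesis unfolding oldest_pt_def sw.oldest_pt_def assms(4)
    using assms(1) by (intro oldest_switch) auto
qed

lemma oldest_pt_vertex:
  assumes "negative F e" "x \<in> e"
  obtains y where "oldest_pt (idx F e) x = {y}" "{y} \<in> set F"
proof -
  have "{x} \<in> graph_at F (idx F e)" "idx F e \<le> length F"
    using edge_endpoint[of e x] assms idx_less[of e] negative_in_set negative_is_edge
    by (simp_all add: mem_graph_at less_imp_le)
  then show thesis using oldest_component[of "idx F e" x] that unfolding oldest_pt_def by blast
qed

text \<open>The two edges may differ. This is needed when \<open>\<tau>\<close> takes over the merge
  that \<open>\<sigma>\<close> performed before the switch.\<close>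

lemma pairing_transfer:
  assumes nv: "\<not> (is_vertex \<sigma> \<and> is_vertex \<tau>)"
    and neg: "negative F {x, y}" "negative F' {x', y'}"
    and comp: "component (graph_at F' (idx F' {x', y'})) x' = component (graph_at F (idx F {x, y})) x"
      "component (graph_at F' (idx F' {x', y'})) y' = component (graph_at F (idx F {x, y})) y"
  shows "(s, {x', y'}) \<in> pairing F' \<longleftrightarrow> (s, {x, y}) \<in> pairing F"
proof -
  obtain p q where pq: "oldest_pt (idx F {x, y}) x = {p}" "{p} \<in> set F"
    "oldest_pt (idx F {x, y}) y = {q}" "{q} \<in> set F"
    using oldest_pt_vertex[OF neg(1)] by (metis insertI1 insertI2)
  have "{{p}, {q}} \<noteq> {\<sigma>, \<tau>}" using nv by (metis doubleton_eq_iff is_vertex_singleton)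
  then show ?thesis
    using oldest_pt_switch[OF nv neg(1) _ comp(1)] oldest_pt_switch[OF nv neg(1) _ comp(2)] pq
    by (simp add: pairing_iff neg sw.pairing_iff younger_switch)
qed

lemma stable_pairing:
  assumes "stable" "\<not> (is_vertex \<sigma> \<and> is_vertex \<tau>)"
  shows "pairing F' = pairing F"
proof -
  have "(s, e) \<in> pairing F' \<longleftrightarrow> (s, e) \<in> pairing F" for s e
  proof (cases "negative F e")
    case True
    then obtain x y where e: "e = {x, y}" by (rule negative_obtain)
    have "negative F' e" using True assms by (simp add: stable_negative)
    then show ?thesis unfolding e
      by (intro pairing_transfer) (use assms True e stable_component in auto)
  next
    case False
    then show ?thesis using pairing_negative sw.pairing_negative assms(1) stable_negative by blast
  qed
  then show ?thesis by auto
qed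

text \<open>Adding a vertex changes no component, so if the other simplex is an edge it finds the
  same components in both orders. Vertices are never negative.\<close>

lemma stable_if_vertex:
  assumes "is_vertex \<sigma> \<or> is_vertex \<tau>" shows "stable"
proof -
  have comp: "component (graph_at F' (idx F' s)) = component (graph_at F (idx F s))"
    if s: "s \<in> {\<sigma>, \<tau>}" "\<not> is_vertex s" for s
  proof -
    from s have "s = \<sigma> \<and> is_vertex \<tau> \<or> s = \<tau> \<and> is_vertex \<sigma>" using assms by auto
    then show ?thesis
      by (elim disjE conjE) (simp_all only: graphs_switched is_vertex_def, auto)
  qed
  have conn: "connected_in (graph_at F' (idx F' s)) = connected_in (graph_at F (idx F s))"
    if s: "s \<in> {\<sigma>, \<tau>}" "\<not> is_vertex s" for s
    using comp[OF that] unfolding fun_eq_iff by (metis mem_component)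
  have neg: "negative F' s \<longleftrightarrow> negative F s" if s: "s \<in> {\<sigma>, \<tau>}" for s
  proof (cases "is_vertex s")
    case True
    then show ?thesis using is_edge_not_vertex negative_is_edge sw.negative_is_edge by metis
  next
    case False
    then show ?thesis using conn[OF s] s by (simp add: negative_def)
  qed
  have "\<not> is_vertex s" if "negative F s" for s
    using that negative_is_edge is_edge_not_vertex by metis
  then show ?thesis unfolding stable_def using neg comp by metis
qed

section \<open>Switching two edges: unchanged structure and relabelling\<close>

lemma negative_switched_edges:
  assumes "\<sigma> = {a, b}" "a \<noteq> b" "\<tau> = {c, d}" "c \<noteq> d"
  shows "negative F {a, b} \<longleftrightarrow> \<not> connected_in G a b"
    "negative F {c, d} \<longleftrightarrow> \<not> connected_in (insert {a, b} G) c d"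
    "negative F' {c, d} \<longleftrightarrow> \<not> connected_in G c d"
    "negative F' {a, b} \<longleftrightarrow> \<not> connected_in (insert {c, d} G) a b"
  using graphs_switched mem_switched assms by (simp_all add: negative_doubleton sw.negative_doubleton)

lemma stable_edgesI:
  assumes e: "\<sigma> = {a, b}" "a \<noteq> b" "\<tau> = {c, d}" "c \<noteq> d"
    and "connected_in (insert {c, d} G) a b \<longleftrightarrow> connected_in G a b"
    and "connected_in (insert {a, b} G) c d \<longleftrightarrow> connected_in G c d"
    and "\<And>x. \<not> connected_in G a b \<Longrightarrow> x \<in> {a, b} \<Longrightarrow>
      component (insert {c, d} G) x = component G x"
    and "\<And>x. \<not> connected_in (insert {a, b} G) c d \<Longrightarrow> x \<in> {c, d} \<Longrightarrow>
      component (insert {a, b} G) x = component G x"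
  shows "stable"
  unfolding stable_def
  using assms(5-8) graphs_switched[unfolded e(1,3)] negative_switched_edges[OF e]
  unfolding e(1,3) by simp

text \<open>Cases (3a) and (3b). The endpoints of \<open>\<sigma>\<close> are connected in
  \<open>G\<close>, hence also after \<open>\<tau>\<close>, and for \<open>\<tau>\<close> the
  presence of \<open>\<sigma>\<close> makes no difference.\<close>

lemma stable_nonnegative_first:
  assumes "is_edge \<sigma>" "is_edge \<tau>" "\<not> negative F \<sigma>" shows "stable"
proof -
  obtain a b c d where e: "\<sigma> = {a, b}" "a \<noteq> b" "\<tau> = {c, d}" "c \<noteq> d"
    using assms by (auto simp: is_edge_def)
  then have ab: "connected_in G a b" using assms negative_switched_edges[OF e] by simp
  then have comp: "component (insert {a, b} G) x = component G x" for x
    by (rule component_insert_connected)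
  then have conn: "connected_in (insert {a, b} G) x y \<longleftrightarrow> connected_in G x y" for x y
    by (metis mem_component)
  show ?thesis
    by (rule stable_edgesI[OF e]) (use ab comp conn in \<open>auto elim: connected_in_mono\<close>)
qed

text \<open>If \<open>\<sigma>\<close> is no child of \<open>\<tau>\<close>, then neither endpoint
  of \<open>\<tau>\<close> lies in the component formed by \<open>\<sigma>\<close>. The two merges
  concern four different components of \<open>G\<close> and commute.\<close>

lemma stable_negatives_not_child:
  assumes "negative F \<sigma>" "negative F \<tau>" "\<not> is_parent F \<tau> \<sigma>" shows "stable"
proof -
  obtain a b c d where e: "\<sigma> = {a, b}" "a \<noteq> b" "\<tau> = {c, d}" "c \<noteq> d"
    using assms negative_is_edge by (metis is_edge_def)
  note neg = negative_switched_edges[OF e]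
  have "node_comp F {a, b} = component (insert {a, b} G) a"
    using node_comp_eq[of "{a, b}" a] mem_switched(1) idx_switched(1) graph_at_Suc_k
    unfolding e(1) by simp
  then have "component (insert {a, b} G) x \<noteq> component (insert {a, b} G) a" if "x \<in> {c, d}" for x
    using assms that graphs_switched(3) negative_is_node unfolding is_parent_def e(1,3) by auto
  then have ne: "\<not> connected_in G x a" "\<not> connected_in G x b" if "x \<in> {c, d}" for x
    using that component_insert_edge[of a b G x] component_insert_left[of a b G] by metis+
  have ne': "\<not> connected_in G x c" "\<not> connected_in G x d" if "x \<in> {a, b}" for x
    using ne that connected_in_sym by (metis insertE insertI1 insertI2 singletonD)+
  show ?thesis
  proof (rule stable_edgesI[OF e])
    show "connected_in (insert {c, d} G) a b \<longleftrightarrow> connected_in G a b"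
      using ne'[of a] by (simp add: connected_in_insert)
    show "connected_in (insert {a, b} G) c d \<longleftrightarrow> connected_in G c d"
      using ne[of c] by (simp add: connected_in_insert)
    show "component (insert {c, d} G) x = component G x" if "x \<in> {a, b}" for x
      using ne'[OF that] by (simp add: component_insert_edge)
    show "component (insert {a, b} G) x = component G x" if "x \<in> {c, d}" for x
      using ne[OF that] by (simp add: component_insert_edge)
  qed
qed

text \<open>\<open>\<sigma>\<close> lies on a cycle exactly if \<open>\<tau>\<close> reconnects its
  endpoints after its removal. As \<open>\<tau>\<close> is positive, its endpoints are connected by
  \<open>G\<close> with \<open>\<sigma>\<close>; they can replace the connection through
  \<open>\<sigma>\<close> only if they were not connected in \<open>G\<close> alone.\<close>

lemma in_one_cycle_switched:
  assumes "negative F \<sigma>" "positive F \<tau>" "\<tau> = {c, d}"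
  shows "in_one_cycle (graph_at F (Suc (Suc k))) \<sigma> \<longleftrightarrow> \<not> connected_in G c d"
proof -
  obtain a b where ab: "\<sigma> = {a, b}" "a \<noteq> b" using assms negative_obtain by metis
  have cd: "c \<noteq> d" using assms by (auto simp: positive_iff)
  note neg = negative_switched_edges[OF ab assms(3) cd]
  have nab: "\<not> connected_in G a b" and con: "connected_in (insert {a, b} G) c d"
    using assms neg ab by (auto simp: positive_iff)
  have "{a, b} \<notin> G" using nab connected_in_edge by metis
  then have "graph_at F (Suc (Suc k)) - {{a, b}} = insert {c, d} G"
    unfolding graph_at_Suc_Suc_k using switched_neq unfolding ab(1) assms(3) by blast
  moreover have "{a, b} \<in> graph_at F (Suc (Suc k))" unfolding graph_at_Suc_Suc_k ab(1) by simp
  ultimately have "in_one_cycle (graph_at F (Suc (Suc k))) {a, b} \<longleftrightarrow> connected_in (insert {c, d} G) a b"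
    using in_one_cycle_iff[of a b] ab by simp
  also have "\<dots> \<longleftrightarrow> \<not> connected_in G c d"
    using nab con unfolding connected_in_insert
    by (meson connected_in_sym connected_in_trans)
  finally show ?thesis unfolding ab(1) .
qed

text \<open>Without such a cycle the endpoints of \<open>\<tau>\<close> are connected already in
  \<open>G\<close>, so \<open>\<tau>\<close> is positive in either order and changes no
  component.\<close>

lemma stable_negative_positive:
  assumes "negative F \<sigma>" "positive F \<tau>" "\<not> in_one_cycle (graph_at F (Suc (Suc k))) \<sigma>"
  shows "stable"
proof -
  obtain a b where ab: "\<sigma> = {a, b}" "a \<noteq> b" using assms negative_obtain by metis
  obtain c d where cd: "\<tau> = {c, d}" "c \<noteq> d" using assms by (auto simp: positive_def is_edge_def)
  have con: "connected_in G c d" using in_one_cycle_switched assms cd by metis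
  then have con': "connected_in (insert {a, b} G) c d" by (auto elim: connected_in_mono)
  have comp: "component (insert {c, d} G) x = component G x" for x
    using con by (rule component_insert_connected)
  then have "connected_in (insert {c, d} G) x y \<longleftrightarrow> connected_in G x y" for x y
    by (metis mem_component)
  then show ?thesis using con con' comp by (intro stable_edgesI[OF ab cd]) auto
qed

text \<open>The endpoints of \<open>\<tau>\<close> lie in the two components merged by
  \<open>\<sigma>\<close>, one in each. Whichever edge comes first performs this merge and the other
  one is positive, so the two edges exchange their roles and nothing else changes.\<close>

lemma
  assumes neg: "negative F \<sigma>" "positive F \<tau>" "in_one_cycle (graph_at F (Suc (Suc k))) \<sigma>"
  defines "f \<equiv> transpose \<sigma> \<tau>"
  shows relabel_is_node: "is_node F' s \<longleftrightarrow> is_node F (f s)"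
    and relabel_is_parent: "is_parent F' e s \<longleftrightarrow> is_parent F (f e) (f s)"
    and relabel_pairing: "(v, e) \<in> pairing F' \<longleftrightarrow> (v, f e) \<in> pairing F"
proof -
  obtain a b where ab: "\<sigma> = {a, b}" "a \<noteq> b" using neg negative_obtain by metis
  obtain c' d' where cd': "\<tau> = {c', d'}" "c' \<noteq> d'" using neg by (auto simp: positive_def is_edge_def)
  have "\<not> connected_in G c' d'" using in_one_cycle_switched neg cd' by metis
  moreover have "connected_in (insert {a, b} G) c' d'"
    using negative_switched_edges[OF ab cd'] neg cd' by (auto simp: positive_iff)
  ultimately have "connected_in G a c' \<and> connected_in G b d' \<or> connected_in G a d' \<and> connected_in G b c'"
    unfolding connected_in_insert using connected_in_sym by metis
  \<comment> \<open>The endpoints of \<open>\<tau>\<close> are ordered such that \<open>c\<close>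
    lies on the side of \<open>a\<close> and \<open>d\<close> on the side of
    \<open>b\<close>.\<close>
  then obtain c d where cd: "\<tau> = {c, d}" "c \<noteq> d" and con: "connected_in G a c" "connected_in G b d"
    using cd' by (metis insert_commute)
  have ncd: "\<not> connected_in G c d" using in_one_cycle_switched neg cd by metis
  note negs = negative_switched_edges[OF ab cd]
  have eq: "component G c = component G a" "component G d = component G b"
    using con by (simp_all add: component_eq_iff connected_in_commute)
  have neg\<tau>: "negative F' \<tau>" "\<not> negative F \<tau>" using ncd negs neg unfolding cd(1) by (auto simp: positive_iff)
  have "connected_in (insert {c, d} G) a b"
    unfolding connected_in_insert using con connected_in_sym by metis
  then have neg\<sigma>: "\<not> negative F' \<sigma>" using negs unfolding ab(1) by simp
  have fs: "f \<sigma> = \<tau>" "f \<tau> = \<sigma>" "s \<noteq> \<sigma> \<Longrightarrow> s \<noteq> \<tau> \<Longrightarrow> f s = s" for s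
    by (simp_all add: f_def)
  have fneg: "negative F' s \<longleftrightarrow> negative F (f s)" for s
    using neg(1) neg\<tau> neg\<sigma> fs other_negative[of s] negative_in_set[of s] sw.negative_in_set[of s]
    by (cases "s = \<sigma>"; cases "s = \<tau>") auto
  have edge: "is_edge \<sigma>" "is_edge \<tau>" using ab cd by auto
  have fnode: "is_node F' s \<longleftrightarrow> is_node F (f s)" for s
    using fneg[of s] fs edge is_edge_not_vertex unfolding is_node_def
    by (cases "s = \<sigma>"; cases "s = \<tau>") auto
  then show "is_node F' s \<longleftrightarrow> is_node F (f s)" .
  have nc: "node_comp F' s = node_comp F (f s)" if "is_node F' s" for s
  proof (cases "s = \<tau>")
    case True
    have "node_comp F' {c, d} = component G c \<union> component G d"
      using sw.node_comp_edge[of c d] graphs_switched(2) mem_switched(2) unfolding cd(1) by simp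
    moreover have "node_comp F {a, b} = component G a \<union> component G b"
      using node_comp_edge[of a b] graphs_switched(1) mem_switched(1) unfolding ab(1) by simp
    ultimately show ?thesis using True fs eq ab cd by simp
  next
    case False
    moreover have "s \<noteq> \<sigma>" using that neg\<sigma> edge is_edge_not_vertex by (auto simp: is_node_def)
    moreover have "s \<in> set F" using that sw.node_in_set by simp
    ultimately show ?thesis by (simp add: fs other_node_comp)
  qed
  have cmp: "(\<exists>x\<in>e. component (graph_at F' (idx F' e)) x = X) \<longleftrightarrow>
      (\<exists>x\<in>f e. component (graph_at F (idx F (f e))) x = X)" if "negative F' e" for e X
  proof (cases "e = \<tau>")
    case True
    then show ?thesis using fs graphs_switched eq ab cd by auto
  next
    case False
    moreover have "e \<noteq> \<sigma>" using that neg\<sigma> by auto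
    moreover have "e \<in> set F" using that sw.negative_in_set by simp
    ultimately show ?thesis by (simp add: fs other_graphs)
  qed
  show "is_parent F' e s \<longleftrightarrow> is_parent F (f e) (f s)"
    unfolding is_parent_def using fneg[of e] fnode[of s] nc[of s] cmp[of e "node_comp F' s"] by auto
  have nv: "\<not> (is_vertex \<sigma> \<and> is_vertex \<tau>)" using edge is_edge_not_vertex by metis
  show "(v, e) \<in> pairing F' \<longleftrightarrow> (v, f e) \<in> pairing F"
  proof (cases "negative F' e")
    case True
    show ?thesis
    proof (cases "e = \<tau>")
      case True
      have "(v, {c, d}) \<in> pairing F' \<longleftrightarrow> (v, {a, b}) \<in> pairing F"
        by (rule pairing_transfer[OF nv])
          (use neg(1) neg\<tau> eq graphs_switched ab cd in simp_all)
      then show ?thesis using True fs ab cd by simp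
    next
      case False
      moreover have "e \<noteq> \<sigma>" using True neg\<sigma> by auto
      moreover have "e \<in> set F" using True sw.negative_in_set by simp
      moreover obtain x y where "e = {x, y}" using True by (rule sw.negative_obtain)
      ultimately show ?thesis using True fneg[of e] pairing_transfer[OF nv, of x y x y] other_graphs
        by (simp add: fs)
    qed
  next
    case False
    then show ?thesis using fneg[of e] pairing_negative sw.pairing_negative by metis
  qed
qed

lemma update_negative_positive_correct:
  assumes neg: "negative F \<sigma>" "positive F \<tau>"
    and "update_negative_positive F (Suc k) (MF F, pairing F) = (T, P)"
  shows "update_levels F (Suc k) T = MF F' \<and> P = pairing F'"
proof (cases "in_one_cycle (graph_at F (Suc (Suc k))) \<sigma>")
  case False
  then have "T = MF F" "P = pairing F"
    using assms(3) by (simp_all add: update_negative_positive_def Let_def)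
  moreover have "stable" using neg False by (rule stable_negative_positive)
  ultimately show ?thesis
    using stable_MF stable_pairing neg negative_is_edge is_edge_not_vertex by metis
next
  case True
  let ?f = "transpose \<sigma> \<tau>"
  have T: "T = \<lparr>parent = (\<lambda>x. map_option ?f (parent (MF F) (?f x))), level = (\<lambda>x. level (MF F) (?f x))\<rparr>"
    and P: "P = (\<lambda>(v, h). (v, ?f h)) ` pairing F"
    using assms(3) True by (simp_all add: update_negative_positive_def Let_def)
  have edge: "is_edge \<sigma>" "is_edge \<tau>" using neg negative_is_edge by (auto simp: positive_iff)
  have "update_levels F (Suc k) T = MF F'"
  proof (rule update_levels_eqI)
    show "s \<in> nodes T \<longleftrightarrow> is_node F' s" for s
      using relabel_is_node[OF neg True] nodes_MF[of "?f s"]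
      by (simp add: T nodes_def domIff)
    fix s e
    have "map_option ?f p = Some e \<longleftrightarrow> p = Some (?f e)" for p
      by (cases p) (simp, simp, metis transpose_involutory)
    then show "parent T s = Some e \<longleftrightarrow> is_parent F' e s"
      unfolding relabel_is_parent[OF neg True] parent_MF[symmetric] T by simp
  next
    fix x assume "{x} \<in> set F"
    moreover have "{x} \<noteq> \<sigma>" "{x} \<noteq> \<tau>" using edge not_is_edge_singleton by metis+
    ultimately show "level T {x} = Some (idx F {x})" by (simp add: T level_MF vertex_is_node)
  qed
  moreover have "(v, e) \<in> P \<longleftrightarrow> (v, ?f e) \<in> pairing F" for v e
    unfolding P by (force simp: image_iff)
  then have "P = pairing F'" using relabel_pairing[OF neg True] by auto
  ultimately show ?thesis ..
qed

end


section \<open>Oldest vertices, merge times and nearest common ancestors\<close>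

context graph_filtration
begin

lemma oldest_pt_eqI:
  assumes "y \<in> component (graph_at F j) x"
    and "\<And>z. z \<in> component (graph_at F j) x \<Longrightarrow> {z} \<in> set F \<and> idx F {y} \<le> idx F {z}"
  shows "oldest_pt j x = {y}"
  unfolding oldest_pt_def using assms by (rule oldest_eqI)

lemma component_vertices:
  "{x} \<in> graph_at F j \<Longrightarrow> y \<in> component (graph_at F j) x \<Longrightarrow> {y} \<in> graph_at F j"
  using connected_in_graph_at_vertices[of j x y] by (cases "x = y") auto

lemma oldest_pt_obtain:
  assumes "j \<le> length F" "{x} \<in> graph_at F j"
  obtains y where "oldest_pt j x = {y}" "y \<in> component (graph_at F j) x"
    "\<And>z. z \<in> component (graph_at F j) x \<Longrightarrow> {z} \<in> set F \<and> idx F {y} \<le> idx F {z}"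
  using oldest_component[OF assms] unfolding oldest_pt_def by metis

lemma oldest_pt_cong: "connected_in (graph_at F j) x y \<Longrightarrow> oldest_pt j x = oldest_pt j y"
  by (simp add: oldest_pt_def flip: component_eq_iff)

lemma merge_oldest:
  assumes "negative F {p, q}"
  defines "j \<equiv> idx F {p, q}"
  obtains y z where "oldest_pt j p = {y}" "oldest_pt j q = {z}"
    "y \<in> component (graph_at F j) p" "z \<in> component (graph_at F j) q"
    "\<And>v. v \<in> component (graph_at F j) p \<Longrightarrow> {v} \<in> graph_at F j \<and> idx F {y} \<le> idx F {v}"
    "\<And>v. v \<in> component (graph_at F j) q \<Longrightarrow> {v} \<in> graph_at F j \<and> idx F {z} \<le> idx F {v}"
    "\<And>s. (s, {p, q}) \<in> pairing F \<longleftrightarrow> s = (if idx F {y} < idx F {z} then {z} else {y})"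
proof -
  have mem: "{p, q} \<in> set F" "is_edge {p, q}"
    using negative_in_set[OF assms(1)] negative_is_edge[OF assms(1)] by blast+
  have pq: "{p} \<in> graph_at F j" "{q} \<in> graph_at F j" "j \<le> length F"
    using edge_endpoint[OF mem] idx_less[OF mem(1)] by (simp_all add: mem_graph_at j_def less_imp_le)
  obtain y where y: "oldest_pt j p = {y}" "y \<in> component (graph_at F j) p"
    "\<And>v. v \<in> component (graph_at F j) p \<Longrightarrow> {v} \<in> set F \<and> idx F {y} \<le> idx F {v}"
    using oldest_pt_obtain[OF pq(3,1)] by metis
  obtain z where z: "oldest_pt j q = {z}" "z \<in> component (graph_at F j) q"
    "\<And>v. v \<in> component (graph_at F j) q \<Longrightarrow> {v} \<in> set F \<and> idx F {z} \<le> idx F {v}"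
    using oldest_pt_obtain[OF pq(3,2)] by metis
  show thesis
    by (rule that[OF y(1) z(1) y(2) z(2)])
      (use y z pq component_vertices pairing_iff[OF assms(1)] in \<open>auto simp: younger_def j_def\<close>)
qed

lemma oldest_union:
  assumes "y \<in> A" "z \<in> B"
    "\<And>v. v \<in> A \<Longrightarrow> {v} \<in> set F \<and> idx F {y} \<le> idx F {v}"
    "\<And>v. v \<in> B \<Longrightarrow> {v} \<in> set F \<and> idx F {z} \<le> idx F {v}"
  shows "oldest F (A \<union> B) = (if idx F {y} < idx F {z} then {y} else {z})"
proof (cases "idx F {y} < idx F {z}")
  case True
  then have "oldest F (A \<union> B) = {y}"
    by (intro oldest_eqI) (use assms in \<open>auto intro: order_trans less_imp_le\<close>)
  then show ?thesis using True by simp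
next
  case False
  then have "oldest F (A \<union> B) = {z}"
    by (intro oldest_eqI) (use assms in \<open>auto intro: order_trans simp: not_less\<close>)
  then show ?thesis using False by simp
qed

lemma pairing_vertex_older:
  assumes "({x}, h) \<in> pairing F" shows "idx F {x} < idx F h"
proof -
  have h: "negative F h" using assms by (rule pairing_negative)
  then obtain p q where pq: "h = {p, q}" by (rule negative_obtain)
  have "{x} \<in> graph_at F (idx F {p, q})"
    by (rule merge_oldest[OF h[unfolded pq]]) (use assms pq in \<open>auto split: if_splits\<close>)
  then show ?thesis by (simp add: mem_graph_at pq)
qed

text \<open>Induction over the additions. A vertex stops being the oldest of its component exactly
  at the merge in which it is the younger of the two oldest vertices, and this is the merge at which
  it receives its partner.\<close>

lemma oldest_pt_self_iff:
  assumes "j \<le> length F" "{x} \<in> graph_at F j"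
  shows "oldest_pt j x = {x} \<longleftrightarrow> (\<forall>h. ({x}, h) \<in> pairing F \<longrightarrow> j \<le> idx F h)"
  using assms
proof (induction j)
  case 0
  then show ?case by (simp add: graph_at_def)
next
  case (Suc j)
  then have j: "j < length F" by simp
  let ?s = "F ! j"
  have s: "?s \<in> set F" "idx F ?s = j" using j by auto
  have G: "graph_at F (Suc j) = insert ?s (graph_at F j)" using j by (rule graph_at_Suc)
  show ?case
  proof (cases "?s = {x}")
    case True
    then have "component (graph_at F (Suc j)) x = {x}" using component_after_vertex s by metis
    then have "oldest_pt (Suc j) x = {x}" using True s by (intro oldest_pt_eqI) auto
    moreover have "Suc j \<le> idx F h" if "({x}, h) \<in> pairing F" for h
      using pairing_vertex_older[OF that] True s by simp
    ultimately show ?thesis by simp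
  next
    case False
    then have x: "{x} \<in> graph_at F j" using Suc.prems G by auto
    then have IH: "oldest_pt j x = {x} \<longleftrightarrow> (\<forall>h. ({x}, h) \<in> pairing F \<longrightarrow> j \<le> idx F h)"
      using Suc.IH j by simp
    have "Suc j \<le> idx F h \<longleftrightarrow> j \<le> idx F h \<and> h \<noteq> ?s" if "({x}, h) \<in> pairing F" for h
    proof -
      have "h \<in> set F" using that pairing_negative negative_in_set by metis
      then show ?thesis using s idx_eq_iff by (metis Suc_leD Suc_le_eq le_neq_implies_less less_irrefl)
    qed
    then have rhs: "(\<forall>h. ({x}, h) \<in> pairing F \<longrightarrow> Suc j \<le> idx F h) \<longleftrightarrow>
        oldest_pt j x = {x} \<and> ({x}, ?s) \<notin> pairing F"
      unfolding IH by blast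
    show ?thesis
    proof (cases "negative F ?s")
      case False
      have "component (graph_at F (Suc j)) x = component (graph_at F j) x"
        using s(1)
      proof (cases rule: simplex_cases)
        case (vertex a)
        then show ?thesis by (simp add: G)
      next
        case (edge a b)
        then have "connected_in (graph_at F j) a b" using False s by (auto simp: negative_doubleton)
        then show ?thesis using edge G component_insert_connected by metis
      qed
      then have "oldest_pt (Suc j) x = oldest_pt j x" by (simp add: oldest_pt_def)
      then show ?thesis using rhs False pairing_negative by auto
    next
      case True
      then obtain p' q' where "?s = {p', q'}" by (rule negative_obtain)
      \<comment> \<open>As \<open>x\<close> is not connected to both endpoints, the edge can be
        oriented such that \<open>q\<close> is on a side without \<open>x\<close>.\<close>
      then obtain p q where pq: "?s = {p, q}"
        and x_pq: "\<not> connected_in (graph_at F j) x q" by (metis True component_negative_notin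
          connected_in_commute connected_in_trans insert_commute mem_component s(2))
      have neg: "negative F {p, q}" and idx: "idx F {p, q} = j" using True pq s by simp_all
      obtain y z where yz: "oldest_pt j p = {y}" "oldest_pt j q = {z}"
        "y \<in> component (graph_at F j) p" "z \<in> component (graph_at F j) q"
        "\<And>v. v \<in> component (graph_at F j) p \<Longrightarrow> {v} \<in> graph_at F j \<and> idx F {y} \<le> idx F {v}"
        "\<And>v. v \<in> component (graph_at F j) q \<Longrightarrow> {v} \<in> graph_at F j \<and> idx F {z} \<le> idx F {v}"
        "\<And>s. (s, {p, q}) \<in> pairing F \<longleftrightarrow> s = (if idx F {y} < idx F {z} then {z} else {y})"
        by (rule merge_oldest[OF neg, unfolded idx]) (rule that; blast)
      have "x \<noteq> z" using x_pq yz(4) connected_in_sym by (metis mem_component)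
      show ?thesis
      proof (cases "connected_in (graph_at F j) x p")
        case True
        have "oldest_pt (Suc j) x = (if idx F {y} < idx F {z} then {y} else {z})"
        proof -
          have "component (graph_at F (Suc j)) x = component (graph_at F j) p \<union> component (graph_at F j) q"
            using True unfolding G pq component_insert_edge by simp
          moreover have "oldest F (component (graph_at F j) p \<union> component (graph_at F j) q) =
              (if idx F {y} < idx F {z} then {y} else {z})"
            by (rule oldest_union[OF yz(3,4)]) (use yz(5,6) mem_graph_at in blast)+
          ultimately show ?thesis by (simp add: oldest_pt_def)
        qed
        moreover have "oldest_pt j x = {y}" using oldest_pt_cong[OF True] yz by simp
        ultimately show ?thesis using rhs yz(7)[of "{x}"] \<open>x \<noteq> z\<close> unfolding pq by (auto split: if_splits)
      next
        case False
        then have "oldest_pt (Suc j) x = oldest_pt j x"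
          using x_pq unfolding oldest_pt_def G pq component_insert_edge by simp
        moreover have "x \<noteq> y" using False yz(3) connected_in_sym by (metis mem_component)
        ultimately show ?thesis using rhs yz(7)[of "{x}"] \<open>x \<noteq> z\<close> unfolding pq by (auto split: if_splits)
      qed
    qed
  qed
qed

text \<open>The least number of a graph connecting \<open>a\<close> and \<open>b\<close> is
  positive, as the empty graph does not connect them. The simplex added just before must be a
  negative edge between their components. It is oriented with \<open>p\<close> on the side of
  \<open>a\<close>.\<close>

lemma merge_time:
  assumes "connected_in (graph_at F n) a b" "a \<noteq> b" "n \<le> length F"
  obtains j p q where "j < n" "F ! j = {p, q}" "negative F {p, q}"
    "connected_in (graph_at F j) a p" "connected_in (graph_at F j) b q"
    "\<not> connected_in (graph_at F j) a b"
    "\<And>l. connected_in (graph_at F l) a b \<Longrightarrow> j < l"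
proof -
  define l where "l = (LEAST l. connected_in (graph_at F l) a b)"
  have l: "connected_in (graph_at F l) a b" "l \<le> n" "\<And>m. connected_in (graph_at F m) a b \<Longrightarrow> l \<le> m"
    unfolding l_def using assms(1) by (auto intro: LeastI Least_le)
  have "\<not> connected_in (graph_at F 0) a b" using assms(2) by (auto simp: graph_at_def connected_in_def)
  then obtain j where j: "l = Suc j" using l by (cases l) auto
  have jn: "j < n" and min: "\<And>m. connected_in (graph_at F m) a b \<Longrightarrow> j < m"
    using l(2,3) j by (simp, meson Suc_le_lessD)
  have jF: "j < length F" using j l(2) assms(3) by linarith
  have nj: "\<not> connected_in (graph_at F j) a b" using l(3)[of j] j by auto
  have s: "F ! j \<in> set F" "idx F (F ! j) = j" using jF by auto
  have G: "graph_at F (Suc j) = insert (F ! j) (graph_at F j)" using jF by (rule graph_at_Suc)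
  from s(1) show thesis
  proof (cases rule: simplex_cases)
    case (vertex x)
    then show ?thesis using l(1) nj G j connected_in_insert_vertex by metis
  next
    case (edge p q)
    have con: "connected_in (insert {p, q} (graph_at F j)) a b" using l(1) G edge j by simp
    then have "\<not> connected_in (graph_at F j) p q"
      using nj unfolding connected_in_insert by (meson connected_in_sym connected_in_trans)
    then have neg: "negative F {p, q}" "negative F {q, p}"
      using s edge by (auto simp: negative_doubleton insert_commute)
    from con consider "connected_in (graph_at F j) a p" "connected_in (graph_at F j) b q"
      | "connected_in (graph_at F j) a q" "connected_in (graph_at F j) b p"
      using nj unfolding connected_in_insert by (metis connected_in_sym)
    then show ?thesis
    proof cases
      case 1
      show ?thesis by (rule that[OF jn edge(1) neg(1) 1 nj min])
    next
      case 2
      have "F ! j = {q, p}" using edge by (simp add: insert_commute)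
      then show ?thesis by (rule that[OF jn _ neg(2) 2 nj min])
    qed
  qed
qed

text \<open>A common ancestor has a component containing \<open>a\<close> and \<open>b\<close>,
  hence it is not older than the edge that first connects them; laminarity then gives inclusion. The
  first conclusion is kept besides the \<open>THE\<close> term of \<open>nca\<close> because the
  universal property is what carries over to handles in \<open>nca_lab\<close>.\<close>

lemma
  assumes "{a} \<in> set F" "{b} \<in> set F" "F ! j = {p, q}" "j < length F" "negative F {p, q}"
    "connected_in (graph_at F j) a p" "connected_in (graph_at F j) b q"
    "\<And>l. connected_in (graph_at F l) a b \<Longrightarrow> j < l"
  shows ancestor_merge: "ancestor (MF F) {p, q} {a} \<and> ancestor (MF F) {p, q} {b} \<and>
      (\<forall>z. ancestor (MF F) z {a} \<and> ancestor (MF F) z {b} \<longrightarrow> ancestor (MF F) z {p, q})" (is ?P)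
    and nca_MF_merge: "nca (MF F) {a} {b} = {p, q}"
proof -
  have idx: "idx F {p, q} = j" using assms(3,4) by (metis idx_nth)
  have anc: "ancestor (MF F) z {v} \<longleftrightarrow> is_node F z \<and> v \<in> node_comp F z" if "v \<in> {a, b}" for z v
    using that assms(1,2) vertex_is_node by (auto simp: ancestor_MF)
  have nc: "a \<in> node_comp F {p, q}" "b \<in> node_comp F {p, q}"
    using node_comp_edge[OF negative_in_set[OF assms(5)]] idx assms(6,7)[THEN connected_in_sym] by auto
  have below: "ancestor (MF F) z {p, q}" if z: "is_node F z" "a \<in> node_comp F z" "b \<in> node_comp F z" for z
  proof -
    obtain w where "w \<in> z" using z node_in_set node_nonempty by blast
    then have "connected_in (graph_at F (Suc (idx F z))) a b"
      using z node_comp_eq node_in_set connected_in_sym connected_in_trans by (metis mem_component)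
    then have "idx F {p, q} \<le> idx F z" using assms(8) idx by fastforce
    then have "node_comp F {p, q} \<subseteq> node_comp F z"
      using node_comp_laminar z nc assms(5) negative_is_node by metis
    then show ?thesis using ancestor_MF z assms(5) negative_is_node by metis
  qed
  show P: ?P using nc anc below assms(5) negative_is_node by auto
  show "nca (MF F) {a} {b} = {p, q}"
    unfolding nca_def
  proof (rule the_equality)
    show ?P by (rule P)
    fix z assume z: "ancestor (MF F) z {a} \<and> ancestor (MF F) z {b} \<and>
      (\<forall>z'. ancestor (MF F) z' {a} \<and> ancestor (MF F) z' {b} \<longrightarrow> ancestor (MF F) z' z)"
    then have "ancestor (MF F) z {p, q}" "ancestor (MF F) {p, q} z" using P by blast+
    moreover have "is_node F z" using z anc by blast
    ultimately show "z = {p, q}"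
      using ancestor_MF assms(5) negative_is_node node_comp_inj by (metis subset_antisym)
  qed
qed

lemma same_tree_MF_vertices:
  assumes "{a} \<in> set F" "{b} \<in> set F"
  shows "same_tree (MF F) {a} {b} \<longleftrightarrow> connected_in (set F) a b"
proof
  assume eq: "same_tree (MF F) {a} {b}"
  obtain r where "is_node F r" "ancestor (MF F) r {a}" "root_of (MF F) {a} = r"
    using root_of_MF vertex_is_node[OF assms(1)] by metis
  moreover obtain r' where "ancestor (MF F) r' {b}" "root_of (MF F) {b} = r'"
    using root_of_MF vertex_is_node[OF assms(2)] by metis
  ultimately have r: "is_node F r" "a \<in> node_comp F r" "b \<in> node_comp F r"
    using eq assms vertex_is_node by (auto simp: same_tree_def ancestor_MF)
  obtain w where "w \<in> r" using r node_in_set node_nonempty by blast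
  then have "connected_in (graph_at F (Suc (idx F r))) a b"
    using r node_comp_eq node_in_set connected_in_sym connected_in_trans by (metis mem_component)
  then show "connected_in (set F) a b" using graph_at_subset connected_in_mono by metis
next
  assume con: "connected_in (set F) a b"
  show "same_tree (MF F) {a} {b}"
  proof (cases "a = b")
    case False
    obtain j p q where j: "j < length F" "F ! j = {p, q}" "negative F {p, q}"
      "connected_in (graph_at F j) a p" "connected_in (graph_at F j) b q"
      using merge_time[of "length F" a b] con False by (metis graph_at_length le_refl)
    then have idx: "idx F {p, q} = j" by (metis idx_nth)
    have e: "is_node F {p, q}" using j negative_is_node by simp
    have "a \<in> node_comp F {p, q}" "b \<in> node_comp F {p, q}"
      using node_comp_edge[OF negative_in_set[OF j(3)]] idx j(4,5)[THEN connected_in_sym] by auto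
    then have anc: "ancestor (MF F) {p, q} {a}" "ancestor (MF F) {p, q} {b}"
      using assms e vertex_is_node by (auto simp: ancestor_MF)
    obtain r where r: "ancestor (MF F) r {p, q}" "parent (MF F) r = None"
      using root_of_MF[OF e] by metis
    then have "root_of (MF F) {a} = r" "root_of (MF F) {b} = r"
      using anc ancestor_trans root_of_eqI by metis+
    then show ?thesis by (simp add: same_tree_def)
  qed (simp add: same_tree_def)
qed

text \<open>Leaf levels are distinct indices, so the lowest leaf is unique. Thus the arbitrary
  lowest leaf that the data structure returns is the one meant by the algorithm.\<close>

lemma is_lowest_leaf_MF:
  assumes "is_node F r"
  shows "is_lowest_leaf (MF F) r l \<longleftrightarrow> l = oldest F (node_comp F r)"
proof -
  obtain x where x: "x \<in> r" using assms node_in_set node_nonempty by blast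
  have r: "r \<in> set F" using assms by (rule node_in_set)
  have "{x} \<in> graph_at F (Suc (idx F r))" "Suc (idx F r) \<le> length F"
    using simplex_endpoint[OF r x] idx_less[OF r] by (auto simp: mem_graph_at)
  then obtain y where y: "oldest F (node_comp F r) = {y}" "y \<in> node_comp F r"
    "\<And>z. z \<in> node_comp F r \<Longrightarrow> {z} \<in> set F \<and> idx F {y} \<le> idx F {z}"
    using oldest_component unfolding node_comp_eq[OF r x] by metis
  have lev: "the (level (MF F) {z}) = idx F {z}" if "z \<in> node_comp F r" for z
    using y(3)[OF that] by (simp add: level_MF vertex_is_node)
  show ?thesis
  proof
    assume "l = oldest F (node_comp F r)"
    then show "is_lowest_leaf (MF F) r l"
      using y lev by (auto simp: is_lowest_leaf_def leaves_MF[OF assms])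
  next
    assume "is_lowest_leaf (MF F) r l"
    then have l: "l \<in> leaves (MF F) r" "\<forall>l'\<in>leaves (MF F) r. the (level (MF F) l) \<le> the (level (MF F) l')"
      by (simp_all add: is_lowest_leaf_def)
    obtain z where z: "l = {z}" "z \<in> node_comp F r" using l(1) by (auto simp: leaves_MF[OF assms])
    have "{y} \<in> leaves (MF F) r" using y(2) by (auto simp: leaves_MF[OF assms])
    then have "the (level (MF F) {z}) \<le> the (level (MF F) {y})" using l(2) z(1) by blast
    then have "idx F {z} \<le> idx F {y}" using lev[OF y(2)] lev[OF z(2)] by simp
    with z show "l = oldest F (node_comp F r)" using y idx_eq_iff by (metis le_antisym)
  qed
qed

lemma lowest_leaf_MF: "is_node F r \<Longrightarrow> lowest_leaf (MF F) r = oldest F (node_comp F r)"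
  unfolding lowest_leaf_def by (rule the_equality) (simp_all add: is_lowest_leaf_MF)

end

section \<open>Switching two vertices\<close>

context graph_switch
begin

text \<open>Exchanging the names of the two simplices turns the new age order into the old
  one.\<close>

lemma idx_switch_transpose: "s \<in> set F \<Longrightarrow> idx F' (transpose \<sigma> \<tau> s) = idx F s"
  by (cases "s = \<sigma>"; cases "s = \<tau>") (simp_all add: idx_other)

text \<open>The condition under which the algorithm swaps partners, with \<open>j\<close> the index of the nearest common ancestor.\<close>

definition swaps :: "'v \<Rightarrow> 'v \<Rightarrow> nat \<Rightarrow> bool" where
  "swaps a b j \<longleftrightarrow> j < length F \<and> \<not> connected_in (graph_at F j) a b \<and>
     connected_in (graph_at F (Suc j)) a b \<and> oldest_pt j a = {a} \<and> oldest_pt j b = {b}"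

text \<open>After the switch \<open>b\<close> comes directly before \<open>a\<close>. So the oldest
  element changes only in sets that had \<open>a\<close> as the oldest element and also contain
  \<open>b\<close>.\<close>

lemma oldest_switch_vertices:
  assumes ab: "\<sigma> = {a}" "\<tau> = {b}"
    and y: "y \<in> C" "\<And>z. z \<in> C \<Longrightarrow> {z} \<in> set F \<and> idx F {y} \<le> idx F {z}"
  shows "oldest F' C = (if y = a \<and> b \<in> C then {b} else {y})"
proof -
  have idx: "idx F {a} = k" "idx F {b} = Suc k" "idx F' {a} = Suc k" "idx F' {b} = k"
    using idx_switched idx_switch_switched unfolding ab by simp_all
  have other: "idx F' {z} = idx F {z}" if "{z} \<in> set F" "z \<noteq> a" "z \<noteq> b" for z
    using idx_other[of "{z}"] that unfolding ab by simp
  show ?thesis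
  proof (cases "y = a \<and> b \<in> C")
    case True
    have "idx F' {b} \<le> idx F' {z}" if "z \<in> C" for z
      using y(2)[OF that] True idx other[of z] by (cases "z = a"; cases "z = b") auto
    then have "oldest F' C = {b}" using True y(2) by (intro sw.oldest_eqI) auto
    then show ?thesis using True by simp
  next
    case False
    have "idx F' {y} \<le> idx F' {z}" if "z \<in> C" for z
    proof -
      have "{{y}, {z}} \<noteq> {\<sigma>, \<tau>}" using False that y(2)[OF that] idx unfolding ab
        by (auto simp: doubleton_eq_iff)
      then show ?thesis using idx_switch_le y that by metis
    qed
    then have "oldest F' C = {y}" using y by (intro sw.oldest_eqI) auto
    then show ?thesis using False by auto
  qed
qed

text \<open>Let \<open>y\<close>, \<open>z\<close> be the two oldest vertices at the merge by
  \<open>e\<close>, and \<open>y'\<close>, \<open>z'\<close> those after the switch. If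
  \<open>swaps\<close> never holds, no component with oldest vertex \<open>a\<close> contains
  \<open>b\<close>, so nothing changes. If it holds at time \<open>j0\<close>, merges before
  \<open>j0\<close> pair neither \<open>a\<close> nor \<open>b\<close>, the merge at
  \<open>j0\<close> compares exactly \<open>a\<close> with \<open>b\<close>, and later merges see
  \<open>b\<close> in the role of \<open>a\<close>.\<close>

lemma pairing_switch_vertices:
  assumes ab: "\<sigma> = {a}" "\<tau> = {b}" and e: "negative F e"
  shows "(s, e) \<in> pairing F' \<longleftrightarrow> (if \<exists>j. swaps a b j then transpose \<sigma> \<tau> s else s, e) \<in> pairing F"
proof -
  have idx: "idx F {a} = k" "idx F {b} = Suc k" "{a} \<in> set F" "{b} \<in> set F"
    using idx_switched mem_switched unfolding ab by simp_all
  have stable: stable using ab by (intro stable_if_vertex) simp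
  obtain p q where pq: "e = {p, q}" using e by (rule negative_obtain)
  define j where "j = idx F {p, q}"
  let ?G = "graph_at F j"
  have neg: "negative F {p, q}" using e pq by simp
  then have neg': "negative F' {p, q}" using stable stable_negative by simp
  have npq: "\<not> connected_in ?G p q" using neg by (simp add: negative_doubleton j_def)
  have jl: "j < length F" using neg idx_less negative_in_set j_def by blast
  have GS: "graph_at F (Suc j) = insert {p, q} ?G"
    using graph_at_Suc_idx negative_in_set neg j_def by simp
  obtain y z where yz: "oldest_pt j p = {y}" "oldest_pt j q = {z}"
    "y \<in> component ?G p" "z \<in> component ?G q"
    "\<And>v. v \<in> component ?G p \<Longrightarrow> {v} \<in> graph_at F j \<and> idx F {y} \<le> idx F {v}"
    "\<And>v. v \<in> component ?G q \<Longrightarrow> {v} \<in> graph_at F j \<and> idx F {z} \<le> idx F {v}"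
    "\<And>s. (s, {p, q}) \<in> pairing F \<longleftrightarrow> s = (if idx F {y} < idx F {z} then {z} else {y})"
    by (rule merge_oldest[OF neg, folded j_def]) (rule that; blast)
  define y' where "y' = (if y = a \<and> b \<in> component ?G p then b else y)"
  define z' where "z' = (if z = a \<and> b \<in> component ?G q then b else z)"
  have mem: "{y} \<in> set F" "{z} \<in> set F" using yz by (auto simp: mem_graph_at)
  have "component (graph_at F' (idx F' {p, q})) x = component ?G x" if "x \<in> {p, q}" for x
    using stable_component[OF stable neg that] j_def by simp
  then have "sw.oldest_pt (idx F' {p, q}) p = {y'}" "sw.oldest_pt (idx F' {p, q}) q = {z'}"
    using oldest_switch_vertices[OF ab yz(3)] oldest_switch_vertices[OF ab yz(4)] yz(5,6)
    by (simp_all add: sw.oldest_pt_def y'_def z'_def mem_graph_at)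
  then have pair': "(s, {p, q}) \<in> pairing F' \<longleftrightarrow> s = younger F' {y'} {z'}"
    using sw.pairing_iff[OF neg'] by simp
  have pair: "(s, {p, q}) \<in> pairing F \<longleftrightarrow> s = younger F {y} {z}" for s
    using yz(7) by (auto simp: younger_def)
  have tr: "transpose \<sigma> \<tau> s = t \<longleftrightarrow> s = transpose \<sigma> \<tau> t" for t
    by (metis transpose_involutory)
  \<comment> \<open>A merge at which \<open>a\<close> and \<open>b\<close> are compared directly is
    a witness for \<open>swaps\<close>.\<close>
  have swaps_j: "swaps a b j" if "{y, z} = {a, b}"
  proof -
    have con: "connected_in ?G p y" "connected_in ?G q z" using yz(3,4) by simp_all
    have "\<not> connected_in ?G y z"
      using npq con by (meson connected_in_sym connected_in_trans)
    moreover have "connected_in (graph_at F (Suc j)) y z"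
      using con unfolding GS connected_in_insert by (meson connected_in_sym)
    moreover have "oldest_pt j y = {y}" "oldest_pt j z = {z}"
      using oldest_pt_cong con yz(1,2) by metis+
    moreover have "connected_in ?G b a \<longleftrightarrow> connected_in ?G a b"
      "connected_in (graph_at F (Suc j)) b a \<longleftrightarrow> connected_in (graph_at F (Suc j)) a b"
      by (rule connected_in_commute)+
    ultimately show ?thesis using that jl unfolding swaps_def
      by (auto simp: doubleton_eq_iff)
  qed
  \<comment> \<open>If \<open>b\<close> belongs to a component whose oldest vertex is
    \<open>a\<close>, the merge that first brought the two together is a witness for
    \<open>swaps\<close>.\<close>
  have swaps_ex: "\<exists>j. swaps a b j"
    if x: "\<And>v. v \<in> component ?G x \<Longrightarrow> {v} \<in> ?G \<and> idx F {a} \<le> idx F {v}"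
      "a \<in> component ?G x" "b \<in> component ?G x" for x
  proof -
    have "connected_in ?G a b" "a \<noteq> b"
      using x connected_in_sym connected_in_trans idx by (metis mem_component, force)
    then obtain j0 p0 q0 where j0: "j0 < j" "F ! j0 = {p0, q0}" "negative F {p0, q0}"
      "connected_in (graph_at F j0) a p0" "connected_in (graph_at F j0) b q0"
      "\<not> connected_in (graph_at F j0) a b"
      using merge_time[of j a b] jl by (metis less_imp_le_nat)
    have sub: "graph_at F j0 \<subseteq> ?G" using j0 by (simp add: graph_at_mono)
    have in_x: "{v} \<in> set F \<and> idx F {a} \<le> idx F {v}"
      if "v \<in> component (graph_at F j0) a \<or> v \<in> component (graph_at F j0) b" for v
      using that x connected_in_mono[OF _ sub] connected_in_trans
      by (metis mem_component mem_graph_at)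
    have "oldest_pt j0 a = {a}" using in_x by (intro oldest_pt_eqI) auto
    moreover have "oldest_pt j0 b = {b}"
    proof (rule oldest_pt_eqI)
      fix v assume v: "v \<in> component (graph_at F j0) b"
      \<comment> \<open>All vertices considered have index at least \<open>k\<close>, and only
        \<open>a\<close> has index \<open>k\<close>. So the others have index at least
        \<open>Suc k\<close>, which is that of \<open>b\<close>.\<close>
      then have "v \<noteq> a" using j0(6) connected_in_commute[of "graph_at F j0" a b] by auto
      then have "idx F {a} \<noteq> idx F {v}" using in_x v idx idx_eq_iff by (metis singleton_inject)
      then show "{v} \<in> set F \<and> idx F {b} \<le> idx F {v}" using in_x v idx by fastforce
    qed simp
    moreover have "connected_in (graph_at F (Suc j0)) a b"
    proof -
      have "graph_at F (Suc j0) = insert {p0, q0} (graph_at F j0)"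
        using graph_at_Suc[of j0 F] j0 jl by simp
      then show ?thesis using j0(4) j0(5)[THEN connected_in_sym] by (simp add: connected_in_insert)
    qed
    ultimately show ?thesis using j0 jl by (auto simp: swaps_def intro!: exI[of _ j0])
  qed
  show ?thesis
  proof (cases "\<exists>j. swaps a b j")
    case False
    then have "y' = y" "z' = z"
      using swaps_ex[of p] swaps_ex[of q] yz(3-6) by (auto simp: y'_def z'_def)
    moreover have "{{y}, {z}} \<noteq> {\<sigma>, \<tau>}" using False swaps_j unfolding ab by (auto simp: doubleton_eq_iff)
    ultimately show ?thesis using False pair pair' younger_switch mem unfolding pq by simp
  next
    case True
    then obtain j0 where j0: "swaps a b j0" by blast
    have before: "\<not> connected_in (graph_at F l) a b" if "l \<le> j0" for l
      using j0 connected_in_mono graph_at_mono[OF that] unfolding swaps_def by metis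
    have after: "connected_in (graph_at F l) a b" if "j0 < l" for l
    proof -
      have "Suc j0 \<le> l" using that by simp
      then show ?thesis using j0 connected_in_mono graph_at_mono unfolding swaps_def by metis
    qed
    have "younger F' {y'} {z'} = transpose \<sigma> \<tau> (younger F {y} {z})"
    proof (cases "{y, z} = {a, b}")
      case True
      have "\<not> connected_in ?G a b" using swaps_j True by (simp add: swaps_def)
      then have "y' = y" "z' = z" using yz(3,4) True connected_in_sym connected_in_trans
        unfolding y'_def z'_def by (metis mem_component)+
      then show ?thesis using True idx idx_switch_switched unfolding ab
        by (auto simp: doubleton_eq_iff younger_def)
    next
      case False
      consider "j < j0" | "j = j0" | "j0 < j" by linarith
      then show ?thesis
      proof cases
        case 1
        have "\<not> connected_in ?G a b" using before 1 by simp
        then have "y' = y" "z' = z" using yz(3,4) connected_in_sym connected_in_trans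
          unfolding y'_def z'_def by (metis mem_component)+
        moreover have "{{y}, {z}} \<noteq> {\<sigma>, \<tau>}" using False unfolding ab by (auto simp: doubleton_eq_iff)
        \<comment> \<open>Otherwise \<open>a\<close> or \<open>b\<close> would be paired at the time
          \<open>j\<close> before \<open>j0\<close> and could not be the oldest of its component at
          \<open>j0\<close>. Hence the transposition fixes the paired vertex.\<close>
        moreover have "younger F {y} {z} \<notin> {\<sigma>, \<tau>}"
        proof
          assume "younger F {y} {z} \<in> {\<sigma>, \<tau>}"
          then obtain v where v: "v \<in> {a, b}" "younger F {y} {z} = {v}" unfolding ab by auto
          then have "({v}, {p, q}) \<in> pairing F" using pair by simp
          moreover have "{v} \<in> graph_at F j0"
          proof -
            have "{v} \<in> ?G" using v(2) yz(3-6) by (auto simp: younger_def split: if_splits)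
            then show ?thesis using graph_at_mono[of j j0 F] 1 by auto
          qed
          ultimately have "oldest_pt j0 v \<noteq> {v}"
            using oldest_pt_self_iff[of j0 v] j0 1 unfolding swaps_def j_def by auto
          then show False using v j0 by (auto simp: swaps_def)
        qed
        ultimately show ?thesis using younger_switch mem by simp
      next
        case 2
        then have "connected_in (insert {p, q} ?G) a b" "\<not> connected_in ?G a b"
          and ab_old: "oldest_pt j a = {a}" "oldest_pt j b = {b}"
          using j0 GS unfolding swaps_def by auto
        then have "connected_in ?G a p \<and> connected_in ?G q b \<or> connected_in ?G a q \<and> connected_in ?G p b"
          by (simp add: connected_in_insert)
        then have "{a} = {y} \<and> {z} = {b} \<or> {a} = {z} \<and> {y} = {b}"
          using oldest_pt_cong[of j a p] oldest_pt_cong[of j q b] oldest_pt_cong[of j a q]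
            oldest_pt_cong[of j p b] yz(1,2) ab_old by auto
        then have "{y, z} = {a, b}" by auto
        then show ?thesis using False by simp
      next
        case 3
        have con: "connected_in ?G a b" using after 3 by simp
        have iff: "a \<in> component ?G x \<longleftrightarrow> b \<in> component ?G x" for x
          using con connected_in_sym connected_in_trans by (metis mem_component)
        \<comment> \<open>Now \<open>a\<close> and \<open>b\<close> share a component in which
          \<open>a\<close> is older, so \<open>b\<close> is not the oldest vertex. Replacing
          \<open>a\<close> by \<open>b\<close> then acts on \<open>y\<close> and \<open>z\<close>
          like the transposition.\<close>
        have "y \<noteq> b" "z \<noteq> b" using yz(3-6) iff idx by (metis Suc_n_not_le_n)+
        then have "{y'} = transpose \<sigma> \<tau> {y}" "{z'} = transpose \<sigma> \<tau> {z}"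
          using yz(3,4) iff unfolding y'_def z'_def ab by (auto simp: transpose_def)
        then show ?thesis using idx_switch_transpose mem by (simp add: younger_def)
      qed
    qed
    then show ?thesis using True pair pair' tr unfolding pq by auto
  qed
qed

text \<open>Only the merge time of \<open>a\<close> and \<open>b\<close> can satisfy
  \<open>swaps\<close>, and it is the index of their nearest common ancestor. Being oldest there
  means, by \<open>oldest_pt_self_iff\<close>, having no earlier partner, which is the test of the
  algorithm.\<close>

lemma swaps_iff:
  assumes ab: "\<sigma> = {a}" "\<tau> = {b}"
  shows "(\<exists>j. swaps a b j) \<longleftrightarrow> same_tree (MF F) \<sigma> \<tau> \<and>
    (\<forall>v\<in>{\<sigma>, \<tau>}. \<forall>h. (v, h) \<in> pairing F \<longrightarrow> idx F h \<ge> idx F (nca (MF F) \<sigma> \<tau>))"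
proof (cases "connected_in (set F) a b")
  case False
  then have "\<not> same_tree (MF F) \<sigma> \<tau>" using same_tree_MF_vertices mem_switched unfolding ab by metis
  moreover have "\<not> swaps a b j" for j
    using False connected_in_mono[OF _ graph_at_subset] unfolding swaps_def by metis
  ultimately show ?thesis by simp
next
  case True
  have mem: "{a} \<in> set F" "{b} \<in> set F" and "a \<noteq> b"
    using mem_switched switched_neq unfolding ab by auto
  obtain j p q where j: "j < length F" "F ! j = {p, q}" "negative F {p, q}"
    "connected_in (graph_at F j) a p" "connected_in (graph_at F j) b q"
    "\<not> connected_in (graph_at F j) a b"
    "\<And>l. connected_in (graph_at F l) a b \<Longrightarrow> j < l"
    using merge_time[of "length F" a b] True \<open>a \<noteq> b\<close> by (metis graph_at_length le_refl)
  have idx: "idx F {p, q} = j" using j by (metis idx_nth)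
  have nca: "nca (MF F) {a} {b} = {p, q}"
    by (rule nca_MF_merge[OF mem j(2,1,3,4,5,7)])
  have "{p} \<in> graph_at F j" "{q} \<in> graph_at F j"
    using edge_endpoint[OF negative_in_set[OF j(3)] negative_is_edge[OF j(3)]] idx
    by (auto simp: mem_graph_at)
  then have vert: "{a} \<in> graph_at F j" "{b} \<in> graph_at F j"
    using component_vertices j(4,5) connected_in_sym by (metis mem_component)+
  have "connected_in (graph_at F (Suc j)) a b"
    using graph_at_Suc[OF j(1)] j(2,4) j(5)[THEN connected_in_sym] by (simp add: connected_in_insert)
  moreover have "l = j" if "swaps a b l" for l
  proof -
    have "j < Suc l" using that j(7) unfolding swaps_def by blast
    moreover have "\<not> Suc j \<le> l"
      using that \<open>connected_in (graph_at F (Suc j)) a b\<close> graph_at_mono connected_in_mono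
      unfolding swaps_def by metis
    ultimately show ?thesis by simp
  qed
  ultimately have "(\<exists>j. swaps a b j) \<longleftrightarrow> oldest_pt j a = {a} \<and> oldest_pt j b = {b}"
    using j(1,6) unfolding swaps_def by metis
  also have "\<dots> \<longleftrightarrow> (\<forall>v\<in>{\<sigma>, \<tau>}. \<forall>h. (v, h) \<in> pairing F \<longrightarrow> idx F h \<ge> j)"
    using oldest_pt_self_iff[of j] vert j(1) unfolding ab by auto
  finally show ?thesis using True same_tree_MF_vertices[OF mem] nca idx unfolding ab by simp
qed

lemma update_vertices_correct:
  assumes v: "is_vertex \<sigma>" "is_vertex \<tau>"
    and "update_vertices F (Suc k) (MF F, pairing F) = (T, P)"
  shows "T = MF F \<and> update_levels F (Suc k) T = MF F' \<and> P = pairing F'"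
proof -
  obtain a b where ab: "\<sigma> = {a}" "\<tau> = {b}" using v by (auto simp: is_vertex_def)
  have stable: stable using v by (intro stable_if_vertex) simp
  have pair: "(s, e) \<in> pairing F' \<longleftrightarrow> (if \<exists>j. swaps a b j then transpose \<sigma> \<tau> s else s, e) \<in> pairing F" for s e
    using pairing_switch_vertices[OF ab] pairing_negative sw.pairing_negative stable_negative[OF stable]
    by metis
  have eq: "(T, P) = (if \<exists>j. swaps a b j then (MF F, (\<lambda>(v, h). (transpose \<sigma> \<tau> v, h)) ` pairing F)
      else (MF F, pairing F))"
    using assms(3) unfolding swaps_iff[OF ab] by (simp add: update_vertices_def Let_def)
  have "P = pairing F'"
  proof (cases "\<exists>j. swaps a b j")
    case True
    then have P: "P = (\<lambda>(v, h). (transpose \<sigma> \<tau> v, h)) ` pairing F" using eq by simp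
    have "(s, e) \<in> P \<longleftrightarrow> (transpose \<sigma> \<tau> s, e) \<in> pairing F" for s e
      unfolding P by (force simp: image_iff)
    then show ?thesis using pair True by (simp add: set_eq_iff)
  next
    case False
    then show ?thesis using eq pair by auto
  qed
  moreover have "T = MF F" using eq by (auto split: if_splits)
  ultimately show ?thesis using stable_MF[OF stable] by simp
qed

end


section \<open>Rotation of two consecutive merges\<close>

lemma (in graph_filtration) is_parent_iff:
  assumes "negative F {x, y}" "is_node F p" "is_node F q"
    "node_comp F p = component (graph_at F (idx F {x, y})) x"
    "node_comp F q = component (graph_at F (idx F {x, y})) y"
  shows "is_parent F {x, y} s \<longleftrightarrow> s = p \<or> s = q"
proof -
  have "is_parent F {x, y} s \<longleftrightarrow> is_node F s \<and> (node_comp F p = node_comp F s \<or> node_comp F q = node_comp F s)"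
    unfolding is_parent_def by (simp add: assms)
  then show ?thesis using assms(2,3) node_comp_inj by metis
qed

text \<open>
  Both switched edges are negative, and the first one is a child of the second one.  The nodes
  \<open>ra\<close> and \<open>rb\<close> are the children of \<open>{a, b}\<close>, and \<open>rd\<close> is the other child of \<open>{c, d}\<close>;
  the latter edge directly connects the components of \<open>ra\<close> and \<open>rd\<close>.
\<close>

locale graph_rotation = graph_switch +
  fixes a b c d :: 'a and ra rb rd :: "'a simplex"
  assumes e: "\<sigma> = {a, b}" "\<tau> = {c, d}"
    and conn: "connected_in G a c" "\<not> connected_in G a b" "\<not> connected_in G a d" "\<not> connected_in G b d"
    and nodes: "is_node F ra" "is_node F rb" "is_node F rd"
    and comps: "node_comp F ra = component G a" "node_comp F rb = component G b"
      "node_comp F rd = component G d"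
begin

abbreviation "Ca \<equiv> component G a"
abbreviation "Cb \<equiv> component G b"
abbreviation "Cd \<equiv> component G d"

lemma neq: "a \<noteq> b" "c \<noteq> d"
  using conn by auto

lemma component_c: "component G c = Ca"
  using conn(1) by (simp add: component_eq_iff connected_in_commute)

lemma not_connected_c: "\<not> connected_in G c d" "\<not> connected_in G c b"
  using conn connected_in_trans by metis+

lemma disjoint: "Ca \<inter> Cb = {}" "Ca \<inter> Cd = {}" "Cb \<inter> Cd = {}"
  using conn component_disjoint_or_eq component_eq_iff by metis+

lemma graphs:
  "graph_at F (idx F {a, b}) = G" "graph_at F (idx F {c, d}) = insert {a, b} G"
  "graph_at F' (idx F' {c, d}) = G" "graph_at F' (idx F' {a, b}) = insert {c, d} G"
  using graphs_switched unfolding e by simp_all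

lemma comps_F: "component (insert {a, b} G) c = Ca \<union> Cb" "component (insert {a, b} G) d = Cd"
  using conn not_connected_c connected_in_commute[of G]
  by (simp_all add: component_insert_edge)

lemma comps_F': "component (insert {c, d} G) a = Ca \<union> Cd" "component (insert {c, d} G) b = Cb"
  using conn not_connected_c connected_in_commute[of G] component_c
  by (simp_all add: component_insert_edge)

lemma negatives: "negative F {a, b}" "negative F {c, d}" "negative F' {a, b}" "negative F' {c, d}"
proof -
  have "\<not> connected_in (insert {a, b} G) c d" "\<not> connected_in (insert {c, d} G) a b"
    using conn not_connected_c connected_in_commute[of G] by (auto simp: connected_in_insert)
  then show "negative F {a, b}" "negative F {c, d}" "negative F' {a, b}" "negative F' {c, d}"
    using negative_switched_edges[OF e(1) neq(1) e(2) neq(2)] conn not_connected_c by simp_all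
qed

lemma node_comp_switched:
  "node_comp F {a, b} = Ca \<union> Cb" "node_comp F {c, d} = Ca \<union> Cb \<union> Cd"
  "node_comp F' {c, d} = Ca \<union> Cd" "node_comp F' {a, b} = Ca \<union> Cb \<union> Cd"
  using node_comp_edge[OF negative_in_set[OF negatives(1)]] node_comp_edge[OF negative_in_set[OF negatives(2)]]
    sw.node_comp_edge[OF sw.negative_in_set[OF negatives(3)]]
    sw.node_comp_edge[OF sw.negative_in_set[OF negatives(4)]]
    comps_F comps_F' component_c by (simp_all only: graphs, auto)

lemma nodes_distinct: "ra \<noteq> rb" "ra \<noteq> rd" "rb \<noteq> rd"
  "x \<in> {ra, rb, rd} \<Longrightarrow> x \<noteq> \<sigma> \<and> x \<noteq> \<tau>"
proof -
  have mem: "a \<in> Ca" "b \<in> Cb" "d \<in> Cd" by simp_all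
  show "ra \<noteq> rb" "ra \<noteq> rd" "rb \<noteq> rd" using comps disjoint mem by (metis disjoint_iff)+
  have "b \<notin> Ca" "a \<notin> Cb" "a \<notin> Cd" using conn connected_in_commute[of G] by auto
  then have "Ca \<noteq> Ca \<union> Cb" "Cb \<noteq> Ca \<union> Cb" "Cd \<noteq> Ca \<union> Cb" "Ca \<noteq> Ca \<union> Cb \<union> Cd" "Cb \<noteq> Ca \<union> Cb \<union> Cd" "Cd \<noteq> Ca \<union> Cb \<union> Cd"
    using mem by blast+
  then have "node_comp F \<sigma> \<notin> {Ca, Cb, Cd}" "node_comp F \<tau> \<notin> {Ca, Cb, Cd}"
    unfolding e node_comp_switched by blast+
  moreover assume "x \<in> {ra, rb, rd}"
  then have "node_comp F x \<in> {Ca, Cb, Cd}" using comps by blast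
  ultimately show "x \<noteq> \<sigma> \<and> x \<noteq> \<tau>" by metis
qed

lemma nodes': "x \<in> {ra, rb, rd} \<Longrightarrow> is_node F' x \<and> node_comp F' x = node_comp F x"
proof -
  assume x: "x \<in> {ra, rb, rd}"
  then have "x \<noteq> \<sigma>" "x \<noteq> \<tau>" using nodes_distinct(4) by blast+
  moreover have "is_node F x" using x nodes by auto
  ultimately show ?thesis using other_node other_node_comp node_in_set by metis
qed

lemma children_F:
  "is_parent F {a, b} x \<longleftrightarrow> x = ra \<or> x = rb"
  "is_parent F {c, d} x \<longleftrightarrow> x = {a, b} \<or> x = rd"
  using is_parent_iff[OF negatives(1) nodes(1,2)]
    is_parent_iff[OF negatives(2) negative_is_node[OF negatives(1)] nodes(3)]
    comps comps_F node_comp_switched by (simp_all add: graphs)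

lemma children_F':
  "is_parent F' {c, d} x \<longleftrightarrow> x = ra \<or> x = rd"
  "is_parent F' {a, b} x \<longleftrightarrow> x = {c, d} \<or> x = rb"
  using sw.is_parent_iff[OF negatives(4), of ra rd]
    sw.is_parent_iff[OF negatives(3) sw.negative_is_node[OF negatives(4)], of rb]
    nodes' comps comps_F' node_comp_switched component_c by (simp_all add: graphs)

text \<open>The later of the two merges creates the union of all three components in either order.
  So \<open>\<sigma>\<close> inherits the parent of \<open>\<tau>\<close>.\<close>

lemma is_parent_other:
  assumes "p \<noteq> \<sigma>" "p \<noteq> \<tau>"
  shows "x \<noteq> \<sigma> \<Longrightarrow> x \<noteq> \<tau> \<Longrightarrow> is_parent F' p x \<longleftrightarrow> is_parent F p x"
    and "is_parent F' p \<sigma> \<longleftrightarrow> is_parent F p \<tau>"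
proof -
  have neg: "negative F' p \<longleftrightarrow> negative F p"
    using assms other_negative negative_in_set sw.negative_in_set set_switch by metis
  have gr: "negative F p \<Longrightarrow> graph_at F' (idx F' p) = graph_at F (idx F p)"
    using assms other_graphs negative_in_set by metis
  show "is_parent F' p x \<longleftrightarrow> is_parent F p x" if "x \<noteq> \<sigma>" "x \<noteq> \<tau>"
  proof -
    have "is_node F x \<Longrightarrow> node_comp F' x = node_comp F x"
      using that other_node_comp node_in_set by metis
    then show ?thesis using neg gr other_node[OF that] unfolding is_parent_def
      by (cases "negative F p"; cases "is_node F x") simp_all
  qed
  show "is_parent F' p \<sigma> \<longleftrightarrow> is_parent F p \<tau>"
    using neg gr node_comp_switched(2,4) negative_is_node[OF negatives(2)]
      sw.negative_is_node[OF negatives(3)]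
    unfolding is_parent_def e by (cases "negative F p") simp_all
qed

text \<open>The updates are listed as in \<open>update_negatives\<close>, so that both of its
  sub-cases unfold to this term once their roots are identified with \<open>ra\<close>,
  \<open>rb\<close> and \<open>rd\<close>.\<close>

definition rotated :: "'a simplex forest" where
  "rotated = (MF F)\<lparr>parent := (parent (MF F))(ra \<mapsto> \<tau>, rd \<mapsto> \<tau>, \<tau> \<mapsto> \<sigma>, rb \<mapsto> \<sigma>,
     \<sigma> := parent (MF F) \<tau>)\<rparr>"

lemma rotated_MF: "update_levels F (Suc k) rotated = MF F'"
proof (rule update_levels_eqI)
  fix s
  have "is_node F' s \<longleftrightarrow> is_node F s"
  proof (cases "s = \<sigma> \<or> s = \<tau>")
    case True
    then show ?thesis using negatives negative_is_node sw.negative_is_node unfolding e by auto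
  qed (use other_node in blast)
  then show "s \<in> nodes rotated \<longleftrightarrow> is_node F' s"
    using nodes_MF[of s] by (simp add: rotated_def nodes_def)
next
  fix s p
  have rne: "ra \<noteq> \<sigma>" "ra \<noteq> \<tau>" "rb \<noteq> \<sigma>" "rb \<noteq> \<tau>" "rd \<noteq> \<sigma>" "rd \<noteq> \<tau>"
    using nodes_distinct(4) by blast+
  consider "s = \<sigma>" | "s = rb" | "s = \<tau>" | "s = ra \<or> s = rd"
    | "s \<noteq> \<sigma>" "s \<noteq> \<tau>" "s \<noteq> ra" "s \<noteq> rb" "s \<noteq> rd" by blast
  then show "parent rotated s = Some p \<longleftrightarrow> is_parent F' p s"
  proof cases
    case 1
    have "is_parent F p \<tau> \<longleftrightarrow> is_parent F' p \<sigma>"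
    proof (cases "p = \<sigma> \<or> p = \<tau>")
      case True
      then show ?thesis
        using is_parent_idx_less[of \<sigma> \<tau>] is_parent_idx_less[of \<tau> \<tau>]
          sw.is_parent_idx_less[of \<sigma> \<sigma>] sw.is_parent_idx_less[of \<tau> \<sigma>] by auto
    qed (use is_parent_other in blast)
    then show ?thesis using 1 by (simp add: rotated_def parent_MF)
  next
    case 2
    then have "is_parent F' \<sigma> s" "parent rotated s = Some \<sigma>"
      using children_F'[folded e] rne by (simp_all add: rotated_def)
    then show ?thesis using sw.is_parent_unique by auto
  next
    case 3
    then have "is_parent F' \<sigma> s" "parent rotated s = Some \<sigma>"
      using children_F'[folded e] rne by (simp_all add: rotated_def)
    then show ?thesis using sw.is_parent_unique by auto
  next
    case 4
    then have "is_parent F' \<tau> s" "parent rotated s = Some \<tau>"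
      using children_F'[folded e] rne nodes_distinct(1-3)
      by (elim disjE; simp add: rotated_def)+
    then show ?thesis using sw.is_parent_unique by auto
  next
    case 5
    have "is_parent F p s \<longleftrightarrow> is_parent F' p s"
    proof (cases "p = \<sigma> \<or> p = \<tau>")
      case True
      then show ?thesis using children_F[folded e] children_F'[folded e] 5 by metis
    qed (use is_parent_other 5 in blast)
    then show ?thesis using 5 by (simp add: rotated_def parent_MF)
  qed
next
  fix x assume "{x} \<in> set F"
  then show "level rotated {x} = Some (idx F {x})" by (simp add: rotated_def level_MF vertex_is_node)
qed

lemma oldest_component_obtain:
  assumes "x \<in> {a, b, d}"
  obtains p where "oldest F (component G x) = {p}" "p \<in> component G x"
    "\<And>z. z \<in> component G x \<Longrightarrow> {z} \<in> set F \<and> idx F {p} \<le> idx F {z}"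
proof -
  have edges: "{a, b} \<in> set F" "{c, d} \<in> set F" "is_edge {a, b}" "is_edge {c, d}"
    using negatives negative_in_set neq by auto
  have "{x} \<in> graph_at F (Suc k)"
    using edge_endpoint[OF edges(1,3)] edge_endpoint[OF edges(2,4)] assms idx_switched
    unfolding e by (auto simp: mem_graph_at intro: less_SucI)
  then have "{x} \<in> G" using neq unfolding graph_at_Suc_k e by (auto simp: doubleton_eq_iff)
  then show thesis using oldest_component[of k x] that k by auto
qed

text \<open>In both orders the oldest of the three oldest vertices survives and the other two are
  paired. That of \<open>Cb\<close> meets the others only in the merge by \<open>\<sigma>\<close>,
  and that of \<open>Cd\<close> only in the merge by \<open>\<tau>\<close>, so these keep their
  edges if they lose. The one of \<open>Ca\<close> takes part in whichever merge comes first; if it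
  is the youngest of the three it loses there, and the partners of the two edges are
  exchanged.\<close>

lemma pairing_swap:
  defines "P \<equiv> (if idx F (oldest F Cb) < idx F (oldest F Ca) \<and> idx F (oldest F Cd) < idx F (oldest F Ca)
     then (\<lambda>(v, h). (v, transpose \<sigma> \<tau> h)) ` pairing F else pairing F)"
  shows "P = pairing F'"
proof -
  obtain pa where pa: "oldest F Ca = {pa}" "pa \<in> Ca"
    "\<And>z. z \<in> Ca \<Longrightarrow> {z} \<in> set F \<and> idx F {pa} \<le> idx F {z}"
    using oldest_component_obtain[of a] by auto
  obtain pb where pb: "oldest F Cb = {pb}" "pb \<in> Cb"
    "\<And>z. z \<in> Cb \<Longrightarrow> {z} \<in> set F \<and> idx F {pb} \<le> idx F {z}"
    using oldest_component_obtain[of b] by auto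
  obtain pd where pd: "oldest F Cd = {pd}" "pd \<in> Cd"
    "\<And>z. z \<in> Cd \<Longrightarrow> {z} \<in> set F \<and> idx F {pd} \<le> idx F {z}"
    using oldest_component_obtain[of d] by auto
  have nv: "\<not> (is_vertex \<sigma> \<and> is_vertex \<tau>)"
    using neq is_edge_not_vertex unfolding e by (metis is_edge_doubleton)
  have idx': "idx F' {z} = idx F {z}" if "{z} \<in> set F" for z
    using idx_other[OF that] neq unfolding e by (auto simp: doubleton_eq_iff)
  have mem: "{pa} \<in> set F" "{pb} \<in> set F" "{pd} \<in> set F" using pa pb pd by auto
  have ne: "pa \<noteq> pb" "pa \<noteq> pd" "pb \<noteq> pd" using disjoint pa(2) pb(2) pd(2) by auto
  then have ine: "idx F {pa} \<noteq> idx F {pb}" "idx F {pa} \<noteq> idx F {pd}" "idx F {pb} \<noteq> idx F {pd}"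
    using mem idx_eq_iff by auto
  have AB: "oldest F (Ca \<union> Cb) = (if idx F {pa} < idx F {pb} then {pa} else {pb})"
    by (rule oldest_union[OF pa(2) pb(2) pa(3) pb(3)])
  have AD: "oldest F' (Ca \<union> Cd) = (if idx F {pa} < idx F {pd} then {pa} else {pd})"
  proof -
    have "oldest F' (Ca \<union> Cd) = (if idx F' {pa} < idx F' {pd} then {pa} else {pd})"
      by (rule sw.oldest_union[OF pa(2) pd(2)]) (use pa(3) pd(3) idx' mem in auto)
    then show ?thesis using idx' mem by simp
  qed
  have old': "oldest F' Ca = {pa}" "oldest F' Cb = {pb}" "oldest F' Cd = {pd}"
    using oldest_switch[of pa Ca] oldest_switch[of pb Cb] oldest_switch[of pd Cd] pa pb pd nv by auto
  have pair: "(s, {a, b}) \<in> pairing F \<longleftrightarrow> s = younger F {pa} {pb}"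
    "(s, {c, d}) \<in> pairing F \<longleftrightarrow> s = younger F (if idx F {pa} < idx F {pb} then {pa} else {pb}) {pd}"
    "(s, {c, d}) \<in> pairing F' \<longleftrightarrow> s = younger F' {pa} {pd}"
    "(s, {a, b}) \<in> pairing F' \<longleftrightarrow> s = younger F' (if idx F {pa} < idx F {pd} then {pa} else {pd}) {pb}" for s
    using pairing_iff negatives(1,2) sw.pairing_iff negatives(3,4) AB AD old' pa(1) pb(1) pd(1) component_c
    by (simp_all add: oldest_pt_def sw.oldest_pt_def graphs comps_F comps_F')
  have P: "(s, h) \<in> P \<longleftrightarrow> (s, if idx F {pb} < idx F {pa} \<and> idx F {pd} < idx F {pa}
      then transpose \<sigma> \<tau> h else h) \<in> pairing F" for s h
    unfolding P_def pa(1) pb(1) pd(1) by (force simp: image_iff)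
  have "(s, h) \<in> P \<longleftrightarrow> (s, h) \<in> pairing F'" for s h
  proof -
    consider "h = {a, b}" | "h = {c, d}" | "h \<noteq> \<sigma>" "h \<noteq> \<tau>" unfolding e by blast
    then show ?thesis
    proof cases
      case 1
      then show ?thesis unfolding P e 1 using ine mem idx' by (auto simp: pair younger_def)
    next
      case 2
      then show ?thesis unfolding P e 2 using ine mem idx' by (auto simp: pair younger_def)
    next
      case 3
      have "(s, h) \<in> pairing F' \<longleftrightarrow> (s, h) \<in> pairing F"
      proof (cases "negative F h")
        case True
        then obtain x y where xy: "h = {x, y}" by (rule negative_obtain)
        have "negative F' h" using other_negative True 3 negative_in_set by metis
        then show ?thesis using pairing_transfer[OF nv, of x y x y] True 3 other_graphs negative_in_set
          unfolding xy by simp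
      next
        case False
        then have "\<not> negative F' h" using other_negative 3 sw.negative_in_set by (metis set_switch)
        then show ?thesis using False pairing_negative sw.pairing_negative by metis
      qed
      then show ?thesis using 3 by (simp add: P)
    qed
  qed
  then show ?thesis by auto
qed

lemma lowest_leaves:
  "lowest_leaf (MF F) ra = oldest F Ca" "lowest_leaf (MF F) rb = oldest F Cb"
  "lowest_leaf (MF F) rd = oldest F Cd"
  using lowest_leaf_MF nodes comps by simp_all

lemma the_other_child: "(THE r. r \<in> children (MF F) \<tau> \<and> r \<noteq> \<sigma>) = rd"
  by (rule the_equality) (use children_F(2) nodes_distinct(4)[of rd] in \<open>auto simp: children_MF e\<close>)

lemma oldest_neq: "idx F (oldest F Ca) \<noteq> idx F (oldest F Cb)"
proof -
  obtain pa where pa: "oldest F Ca = {pa}" "pa \<in> Ca" "{pa} \<in> set F"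
    using oldest_component_obtain[of a] by (metis insertI1)
  obtain pb where pb: "oldest F Cb = {pb}" "pb \<in> Cb" "{pb} \<in> set F"
    using oldest_component_obtain[of b] by (metis insertCI)
  show ?thesis using pa pb disjoint idx_eq_iff by (metis disjoint_iff singleton_inject)
qed

lemma the_children:
  "(THE (r1, r2). children (MF F) \<sigma> = {r1, r2} \<and>
      idx F (lowest_leaf (MF F) r2) < idx F (lowest_leaf (MF F) r1)) =
    (if idx F (oldest F Cb) < idx F (oldest F Ca) then (ra, rb) else (rb, ra))"
proof -
  have "children (MF F) \<sigma> = {ra, rb}" using children_F(1) by (auto simp: children_MF e)
  then have ch: "children (MF F) \<sigma> = {r1, r2} \<longleftrightarrow> r1 = ra \<and> r2 = rb \<or> r1 = rb \<and> r2 = ra" for r1 r2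
    by (auto simp: doubleton_eq_iff)
  have "(\<lambda>(r1, r2). children (MF F) \<sigma> = {r1, r2} \<and>
      idx F (lowest_leaf (MF F) r2) < idx F (lowest_leaf (MF F) r1)) =
    (\<lambda>r. r = (if idx F (oldest F Cb) < idx F (oldest F Ca) then (ra, rb) else (rb, ra)))"
  proof (rule ext, clarify)
    fix r1 r2
    show "(children (MF F) \<sigma> = {r1, r2} \<and>
        idx F (lowest_leaf (MF F) r2) < idx F (lowest_leaf (MF F) r1)) \<longleftrightarrow>
      (r1, r2) = (if idx F (oldest F Cb) < idx F (oldest F Ca) then (ra, rb) else (rb, ra))"
      unfolding ch using lowest_leaves oldest_neq
      by (cases "idx F (oldest F Cb) < idx F (oldest F Ca)") (simp, metis less_asym, simp, metis linorder_neqE_nat)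
  qed
  then show ?thesis by simp
qed

lemma connects: "directly_connects \<tau> Ca Cd" "\<not> directly_connects \<tau> Cb Cd"
proof -
  have "c \<in> Ca" "d \<in> Cd" using conn by simp_all
  then show "directly_connects \<tau> Ca Cd" unfolding directly_connects_def e by blast
  show "\<not> directly_connects \<tau> Cb Cd"
  proof
    assume "directly_connects \<tau> Cb Cd"
    then obtain x y where "x \<in> Cb" "y \<in> Cd" "{c, d} = {x, y}" unfolding directly_connects_def e by blast
    then show False using \<open>c \<in> Ca\<close> \<open>d \<in> Cd\<close> disjoint by (auto simp: doubleton_eq_iff)
  qed
qed

text \<open>Which child of \<open>\<sigma>\<close> is the younger one decides how the algorithm
  names the children and thereby its sub-case. In both sub-cases it is \<open>ra\<close> that moves
  below \<open>\<tau>\<close>.\<close>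

lemma update_negatives_rotated:
  "update_negatives F (Suc k) (MF F, pairing F) = (rotated, pairing F')"
proof -
  have par: "parent (MF F) \<sigma> = Some \<tau>" using children_F(2) by (simp add: parent_MF e)
  have cmp: "component_of_node (MF F) ra = Ca" "component_of_node (MF F) rb = Cb"
    "component_of_node (MF F) rd = Cd"
    using component_of_node_MF nodes comps by simp_all
  show ?thesis
  proof (cases "idx F (oldest F Cb) < idx F (oldest F Ca)")
    case True
    then have "pairing F' = (if idx F (oldest F Cd) < idx F (oldest F Ca)
        then (\<lambda>(v, h). (v, transpose \<sigma> \<tau> h)) ` pairing F else pairing F)"
      using pairing_swap by simp
    then show ?thesis using True par connects
      by (simp add: update_negatives_def Let_def the_children the_other_child cmp lowest_leaves rotated_def)
  next
    case False
    then have "pairing F' = pairing F" using pairing_swap by simp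
    then show ?thesis using False par connects
      by (simp add: update_negatives_def Let_def the_children the_other_child cmp rotated_def)
  qed
qed

end

section \<open>Correctness of the abstract update\<close>

context graph_switch
begin

text \<open>An endpoint \<open>c\<close> of \<open>\<tau>\<close> lies in the component formed by
  \<open>\<sigma>\<close>, and \<open>a\<close> is the endpoint of \<open>\<sigma>\<close> on whose
  side it was before. As \<open>\<tau>\<close> is negative, its other endpoint \<open>d\<close> is
  in neither of the two components merged by \<open>\<sigma>\<close>, hence in a third one.\<close>

lemma rotation_obtain:
  assumes "negative F \<sigma>" "negative F \<tau>" "is_parent F \<tau> \<sigma>"
  obtains a b c d ra rb rd where "graph_rotation F k a b c d ra rb rd"
proof -
  obtain a' b' where ab': "\<sigma> = {a', b'}" "a' \<noteq> b'" using assms(1) by (rule negative_obtain)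
  obtain c' d' where cd': "\<tau> = {c', d'}" "c' \<noteq> d'" using assms(2) by (rule negative_obtain)
  have "node_comp F \<sigma> = component (insert \<sigma> G) a'"
    using node_comp_eq[OF mem_switched(1), of a'] graph_at_Suc_k ab' by (metis idx_switched(1) insertI1)
  then obtain c where c: "c \<in> \<tau>" "component (insert \<sigma> G) c = component (insert \<sigma> G) a'"
    using assms(3) graphs_switched(3) unfolding is_parent_def by auto
  then have "connected_in (insert {a', b'} G) c a'" by (simp add: component_eq_iff ab')
  then obtain a where a: "a \<in> \<sigma>" "connected_in G c a"
    unfolding connected_in_insert using ab'(1) by auto
  obtain b where b: "\<sigma> = {a, b}" "a \<noteq> b" using a(1) ab' by (metis insertE insert_commute singletonD)
  obtain d where d: "\<tau> = {c, d}" "c \<noteq> d" using c(1) cd' by (metis insertE insert_commute singletonD)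
  note neg = negative_switched_edges[OF b d]
  have conn: "connected_in G a c" "\<not> connected_in G a b" "\<not> connected_in (insert {a, b} G) c d"
    using connected_in_sym[OF a(2)] assms(1)[unfolded b(1)] assms(2)[unfolded d(1)] neg(1,2)
    by simp_all
  then have "\<not> connected_in G a d" "\<not> connected_in G b d"
    unfolding connected_in_insert using connected_in_sym connected_in_trans by metis+
  moreover obtain ra where "is_node F ra" "node_comp F ra = component G a"
    using merge_child[OF assms(1), of a] is_parent_nodes graphs_switched(1) b by auto
  moreover obtain rb where "is_node F rb" "node_comp F rb = component G b"
    using merge_child[OF assms(1), of b] is_parent_nodes graphs_switched(1) b by auto
  moreover obtain rd where "is_node F rd" "node_comp F rd = component (insert \<sigma> G) d"
    using merge_child[OF assms(2), of d] is_parent_nodes graphs_switched(3) d by auto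
  moreover have "component (insert \<sigma> G) d = component G d"
    using \<open>\<not> connected_in G a d\<close> \<open>\<not> connected_in G b d\<close> b connected_in_sym
    by (metis component_insert_edge)
  ultimately have "graph_rotation F k a b c d ra rb rd"
    by (intro graph_rotation.intro graph_switch_axioms graph_rotation_axioms.intro)
      (use conn b d in simp_all)
  then show thesis by (rule that)
qed

lemma update_negatives_correct:
  assumes neg: "negative F \<sigma>" "negative F \<tau>"
    and upd: "update_negatives F (Suc k) (MF F, pairing F) = (T, P)"
  shows "update_levels F (Suc k) T = MF F' \<and> P = pairing F'"
proof (cases "is_parent F \<tau> \<sigma>")
  case True
  then obtain a b c d ra rb rd where "graph_rotation F k a b c d ra rb rd"
    using rotation_obtain neg by metis
  then interpret graph_rotation F k a b c d ra rb rd .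
  show ?thesis using upd update_negatives_rotated rotated_MF by simp
next
  case False
  then have "T = MF F" "P = pairing F"
    using upd by (simp_all add: update_negatives_def Let_def parent_MF)
  then show ?thesis
    using stable_negatives_not_child[OF neg False] stable_MF stable_pairing neg
      negative_is_edge is_edge_not_vertex by metis
qed

lemma update_correct: "update F (Suc k) (MF F, pairing F) = (MF F', pairing F')"
proof -
  have type: "is_vertex s \<or> is_edge s" "\<not> (is_vertex s \<and> is_edge s)" if "s \<in> {\<sigma>, \<tau>}" for s
    using that simplex_cases[of s] is_edge_not_vertex[of s] mem_switched
    by (metis insertE is_edge_doubleton is_vertex_singleton singletonD)+
  have stable_case: ?thesis if stable "\<not> (is_vertex \<sigma> \<and> is_vertex \<tau>)"
    "\<not> (negative F \<sigma> \<and> (positive F \<tau> \<or> negative F \<tau>))"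
    using that stable_MF stable_pairing by (auto simp: update_def Let_def)
  consider "is_vertex \<sigma>" "is_vertex \<tau>" | "is_vertex \<sigma> \<or> is_vertex \<tau>" "\<not> (is_vertex \<sigma> \<and> is_vertex \<tau>)"
    | "is_edge \<sigma>" "is_edge \<tau>" "\<not> negative F \<sigma>"
    | "negative F \<sigma>" "positive F \<tau>" | "negative F \<sigma>" "negative F \<tau>"
    using type[of \<sigma>] type[of \<tau>] positive_iff by auto
  then show ?thesis
  proof cases
    case 1
    then show ?thesis using update_vertices_correct
      by (cases "update_vertices F (Suc k) (MF F, pairing F)") (auto simp: update_def Let_def)
  next
    case 2
    then have "\<not> (negative F \<sigma> \<and> (positive F \<tau> \<or> negative F \<tau>))"
      using negative_is_edge is_edge_not_vertex by (auto simp: positive_iff)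
    then show ?thesis using 2 stable_case stable_if_vertex by blast
  next
    case 3
    then show ?thesis using stable_case stable_nonnegative_first type by blast
  next
    case 4
    then have "is_edge \<sigma>" "is_edge \<tau>" "\<not> is_vertex \<sigma>" using negative_is_edge is_edge_not_vertex by (auto simp: positive_iff)
    then show ?thesis using 4 update_negative_positive_correct
      by (cases "update_negative_positive F (Suc k) (MF F, pairing F)") (auto simp: update_def Let_def)
  next
    case 5
    then have "is_edge \<sigma>" "is_edge \<tau>" "\<not> is_vertex \<sigma>" "\<not> positive F \<tau>"
      using negative_is_edge is_edge_not_vertex by (auto simp: positive_iff)
    then show ?thesis using 5 update_negatives_correct
      by (cases "update_negatives F (Suc k) (MF F, pairing F)") (auto simp: update_def Let_def)
  qed
qed

end


subsection \<open>Verification of programs\<close>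

text \<open>Weakest preconditions. Memory and clock are separate arguments, so that elapsed time can
  be carried along in the form \<open>t + c\<close>.\<close>

definition wp ::
  "('v, 'n, 'd, 'l, 'a) prog \<Rightarrow> ('a \<Rightarrow> ('v, 'n, 'd, 'l) memory \<Rightarrow> nat \<Rightarrow> bool) \<Rightarrow>
   ('v, 'n, 'd, 'l) memory \<Rightarrow> nat \<Rightarrow> bool" where
  "wp p Q M t \<longleftrightarrow> (case run_state p (M, t) of (a, M', t') \<Rightarrow> Q a M' t')"

lemma wp_return [simp]: "wp (State_Monad.return a) Q M t \<longleftrightarrow> Q a M t"
  by (simp add: wp_def)

lemma wp_bind [simp]: "wp (State_Monad.bind p f) Q M t \<longleftrightarrow> wp p (\<lambda>a. wp (f a) Q) M t"
  by (simp add: wp_def split: prod.splits)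

text \<open>In contrast to \<open>wp_bind\<close> this also rewrites inside postconditions, where
  \<open>wp\<close> occurs without memory and clock.\<close>

lemma wp_bind_fun: "wp (State_Monad.bind p f) Q = wp p (\<lambda>a. wp (f a) Q)"
  by (simp add: fun_eq_iff)

lemma wp_look [simp]: "wp (look table x) Q M t \<longleftrightarrow> Q (table M x) M (t + 1)"
  by (simp add: wp_def look_def)

lemma wp_store [simp]:
  "wp (store partner_update s p) Q M t \<longleftrightarrow> Q () (M\<lparr>partner := (partner M)(s := p)\<rparr>) (t + 1)"
  "wp (store node_of_update s v) Q M t \<longleftrightarrow> Q () (M\<lparr>node_of := (node_of M)(s := v)\<rparr>) (t + 1)"
  "wp (store simplex_of_update n s) Q M t \<longleftrightarrow> Q () (M\<lparr>simplex_of := (simplex_of M)(n := s)\<rparr>) (t + 1)"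
  "wp (store parent_ptr_update n q) Q M t \<longleftrightarrow> Q () (M\<lparr>parent_ptr := (parent_ptr M)(n := q)\<rparr>) (t + 1)"
  "wp (store child_ptrs_update n r) Q M t \<longleftrightarrow> Q () (M\<lparr>child_ptrs := (child_ptrs M)(n := r)\<rparr>) (t + 1)"
  "wp (store simplex_at_update j s) Q M t \<longleftrightarrow> Q () (M\<lparr>simplex_at := (simplex_at M)(j := s)\<rparr>) (t + 1)"
  "wp (store index_of_update s j) Q M t \<longleftrightarrow> Q () (M\<lparr>index_of := (index_of M)(s := j)\<rparr>) (t + 1)"
  by (cases M; simp add: wp_def store_def)+

lemma wp_when [simp]: "wp (when_prog c p) Q M t \<longleftrightarrow> (if c then wp p Q M t else Q () M t)"
  by (simp add: when_prog_def)

lemma wp_get_node [simp]: "wp (get_node s) Q M t \<longleftrightarrow> Q (the (node_of M s)) M (t + 1)"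
  by (simp add: get_node_def)

lemma wp_mono: "wp p Q M t \<Longrightarrow> (\<And>a M' t'. Q a M' t' \<Longrightarrow> Q' a M' t') \<Longrightarrow> wp p Q' M t"
  by (auto simp: wp_def split: prod.splits)

lemma wp_on_dft:
  assumes "dft M = d" "performs S R b (f d)"
    and "\<And>r d c. R r \<Longrightarrow> S d \<Longrightarrow> real c \<le> b \<Longrightarrow> Q r (M\<lparr>dft := d\<rparr>) (t + c)"
  shows "wp (on_dft f) Q M t"
  using assms by (auto simp: wp_def on_dft_def performs_def split: prod.splits)

lemma wp_on_lct:
  assumes "performs S R b (f l)" "lct M = l"
    and "\<And>r l c. R r \<Longrightarrow> S l \<Longrightarrow> real c \<le> b \<Longrightarrow> Q r (M\<lparr>lct := l\<rparr>) (t + c)"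
  shows "wp (on_lct f) Q M t"
  using assms by (auto simp: wp_def on_lct_def performs_def split: prod.splits)


subsection \<open>Representations of forests\<close>

text \<open>\<open>represents\<close> keeps the links of \<open>A\<close> among its nodes but says
  nothing about \<open>T\<close> outside its nodes. The second assumption closes this gap, so that
  every child in \<open>T\<close> has a handle.\<close>

locale forest_representation =
  fixes lab :: "'n \<Rightarrow> 'v simplex" and A :: "'n forest" and T :: "'v simplex forest"
  assumes represents: "represents lab A T"
    and closed: "\<And>s e. parent T s = Some e \<Longrightarrow> s \<in> nodes T"
begin

lemma lab_nodes: "n \<in> nodes A \<Longrightarrow> lab n \<in> nodes T"
  using represents by (auto simp: represents_def bij_betw_def)

lemma lab_inj: "n \<in> nodes A \<Longrightarrow> n' \<in> nodes A \<Longrightarrow> lab n = lab n' \<longleftrightarrow> n = n'"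
  using represents by (auto simp: represents_def bij_betw_def inj_on_def)

lemma lab_surj: "s \<in> nodes T \<Longrightarrow> \<exists>n\<in>nodes A. lab n = s"
proof -
  have "nodes T = lab ` nodes A" using represents by (simp add: represents_def bij_betw_def)
  then show "s \<in> nodes T \<Longrightarrow> \<exists>n\<in>nodes A. lab n = s" by auto
qed

lemma card_nodes: "card (nodes A) = card (nodes T)"
  using represents bij_betw_same_card by (auto simp: represents_def)

lemma parent_nodes: "parent A n = Some p \<Longrightarrow> n \<in> nodes A \<and> p \<in> nodes A"
  using represents by (auto simp: represents_def)

lemma parent_lab: "n \<in> nodes A \<Longrightarrow> parent T (lab n) = map_option lab (parent A n)"
  using represents by (auto simp: represents_def)

lemma parent_iff:
  "n \<in> nodes A \<Longrightarrow> p \<in> nodes A \<Longrightarrow> parent A n = Some p \<longleftrightarrow> parent T (lab n) = Some (lab p)"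
  using parent_lab lab_inj parent_nodes by fastforce

lemma parent_None: "n \<in> nodes A \<Longrightarrow> parent A n = None \<longleftrightarrow> parent T (lab n) = None"
  by (simp add: parent_lab)

lemma ancestor_node: "ancestor A z n \<Longrightarrow> n \<in> nodes A \<Longrightarrow> z \<in> nodes A"
  by (induction rule: ancestor_induct) (auto dest: parent_nodes)

lemma ancestor_iff:
  assumes "n \<in> nodes A" "z \<in> nodes A"
  shows "ancestor A z n \<longleftrightarrow> ancestor T (lab z) (lab n)"
proof
  assume "ancestor A z n"
  then show "ancestor T (lab z) (lab n)"
  proof (induction rule: ancestor_induct)
    case (step y w)
    then have "parent T (lab y) = Some (lab w)" using parent_iff parent_nodes by blast
    then show ?case using step.IH ancestor_parent ancestor_trans by metis
  qed simp
next
  have "ancestor T r (lab n) \<Longrightarrow> \<exists>z\<in>nodes A. lab z = r \<and> ancestor A z n" for r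
  proof (induction rule: ancestor_induct)
    case (step y w)
    then obtain z where z: "z \<in> nodes A" "lab z = y" "ancestor A z n" by blast
    then obtain z' where "parent A z = Some z'" "lab z' = w" using parent_lab step.hyps by fastforce
    then show ?case using z parent_nodes ancestor_parent ancestor_trans by metis
  qed (use assms in auto)
  moreover assume "ancestor T (lab z) (lab n)"
  ultimately show "ancestor A z n" using lab_inj assms by metis
qed

lemma children_lab:
  assumes "p \<in> nodes A" shows "children T (lab p) = lab ` children A p"
proof -
  have "\<exists>n. parent A n = Some p \<and> lab n = s" if s: "parent T s = Some (lab p)" for s
    using lab_surj[OF closed[OF s]] parent_iff assms s by metis
  moreover have "parent T (lab n) = Some (lab p)" if "parent A n = Some p" for n
    using that parent_iff parent_nodes by blast
  ultimately show ?thesis unfolding children_def image_def by blast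
qed

lemma is_leaf_iff: "n \<in> nodes A \<Longrightarrow> is_leaf A n \<longleftrightarrow> is_leaf T (lab n)"
  by (simp add: is_leaf_def children_lab lab_nodes)

lemma level_leaf: "is_leaf A n \<Longrightarrow> level A n = level T (lab n)"
  using represents by (simp add: represents_def)

lemma root_of_lab:
  assumes "n \<in> nodes A" "ancestor T r (lab n)" "parent T r = None" "r \<in> nodes T"
  shows "lab (root_of A n) = r" "ancestor A (root_of A n) n" "parent A (root_of A n) = None"
    "root_of A n \<in> nodes A"
proof -
  obtain z where z: "z \<in> nodes A" "lab z = r" using lab_surj assms(4) by blast
  then have "ancestor A z n" "parent A z = None" using ancestor_iff parent_None assms by auto
  then show "lab (root_of A n) = r" "ancestor A (root_of A n) n" "parent A (root_of A n) = None"
    "root_of A n \<in> nodes A"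
    using z root_of_eqI by metis+
qed

text \<open>\<open>nca\<close> is a \<open>THE\<close> term and means something only with its
  universal property. Therefore existence and antisymmetry are assumed in \<open>T\<close> and
  pulled back along the labelling.\<close>

lemma nca_lab:
  assumes "x \<in> nodes A" "y \<in> nodes A" "nca T (lab x) (lab y) = e" "e \<in> nodes T"
    "ancestor T e (lab x)" "ancestor T e (lab y)"
    "\<And>z. ancestor T z (lab x) \<Longrightarrow> ancestor T z (lab y) \<Longrightarrow> ancestor T z e"
    "\<And>z. z \<in> nodes T \<Longrightarrow> ancestor T z e \<Longrightarrow> ancestor T e z \<Longrightarrow> z = e"
  shows "lab (nca A x y) = e"
proof -
  obtain n where n: "n \<in> nodes A" "lab n = e" using lab_surj assms(4) by blast
  have "nca A x y = n"
    unfolding nca_def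
  proof (rule the_equality)
    show P: "ancestor A n x \<and> ancestor A n y \<and> (\<forall>z. ancestor A z x \<and> ancestor A z y \<longrightarrow> ancestor A z n)"
      using n assms(1,2,5-7) ancestor_iff ancestor_node by metis
    fix z assume z: "ancestor A z x \<and> ancestor A z y \<and> (\<forall>z'. ancestor A z' x \<and> ancestor A z' y \<longrightarrow> ancestor A z' z)"
    then have "ancestor A n z" "ancestor A z n" "z \<in> nodes A" using P assms(1) ancestor_node by blast+
    then have "lab z = e" using assms(8) n ancestor_iff lab_nodes by metis
    then show "z = n" using n lab_inj \<open>z \<in> nodes A\<close> by blast
  qed
  then show ?thesis using n by simp
qed

lemma is_lowest_leaf_lab:
  assumes "n \<in> nodes A" "is_lowest_leaf A n l"
  shows "l \<in> nodes A" "is_lowest_leaf T (lab n) (lab l)"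
proof -
  have l: "is_leaf A l" "ancestor A n l" using assms by (auto simp: is_lowest_leaf_def leaves_def)
  then show "l \<in> nodes A" by (simp add: is_leaf_def)
  then have "lab l \<in> leaves T (lab n)"
    using l is_leaf_iff ancestor_iff assms by (auto simp: leaves_def)
  moreover have "the (level T (lab l)) \<le> the (level T s)" if s: "s \<in> leaves T (lab n)" for s
  proof -
    obtain n' where n': "n' \<in> nodes A" "lab n' = s"
      using s lab_surj by (auto simp: leaves_def is_leaf_def)
    then have "n' \<in> leaves A n" using s is_leaf_iff ancestor_iff assms by (auto simp: leaves_def)
    then have "the (level A l) \<le> the (level A n')" "is_leaf A n'"
      using assms(2) by (auto simp: is_lowest_leaf_def leaves_def)
    then show ?thesis using level_leaf l n' by metis
  qed
  ultimately show "is_lowest_leaf T (lab n) (lab l)" by (simp add: is_lowest_leaf_def)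
qed

end


subsection \<open>Stored filtrations\<close>

text \<open>This and the following predicates split \<open>stores\<close> into parts that the
  program changes independently. The set of simplices, the pairing and the forest are parameters,
  since in between they belong to neither filtration as a whole.\<close>

definition partner_mem :: "'v simplex set \<Rightarrow> 'v pairing \<Rightarrow> ('v simplex \<Rightarrow> 'v simplex option) \<Rightarrow> bool" where
  "partner_mem V P p \<longleftrightarrow> (\<forall>s\<in>V. \<forall>t. p s = Some t \<longleftrightarrow> (s, t) \<in> P \<or> (t, s) \<in> P)"

definition ptrs_mem ::
  "'n forest \<Rightarrow> ('n \<Rightarrow> 'n option) \<Rightarrow> ('n \<Rightarrow> ('n \<times> 'n) option) \<Rightarrow> bool" where
  "ptrs_mem A pp cp \<longleftrightarrow> (\<forall>n\<in>nodes A. pp n = parent A n \<and>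
     (case cp n of None \<Rightarrow> children A n = {} | Some (a, b) \<Rightarrow> a \<noteq> b \<and> children A n = {a, b}))"

definition tree_mem ::
  "'v simplex set \<Rightarrow> 'v simplex forest \<Rightarrow> 'n forest \<Rightarrow> ('v simplex \<Rightarrow> 'n option) \<Rightarrow> ('n \<Rightarrow> 'v simplex) \<Rightarrow> bool" where
  "tree_mem V T A no lab \<longleftrightarrow> represents lab A T \<and>
     (\<forall>s\<in>V. \<forall>n. no s = Some n \<longleftrightarrow> n \<in> nodes A \<and> lab n = s)"

definition tree_rep :: "('n, 'd) dft_ops \<Rightarrow> 'v simplex set \<Rightarrow> 'v simplex forest \<Rightarrow> ('v, 'n, 'd, 'l) memory \<Rightarrow> bool" where
  "tree_rep D V T M \<longleftrightarrow> (\<exists>A. dft_rep D (dft M) A \<and> tree_mem V T A (node_of M) (simplex_of M) \<and>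
     ptrs_mem A (parent_ptr M) (child_ptrs M))"

definition msf_mem :: "('v, 'l) lct_ops \<Rightarrow> 'v simplex list \<Rightarrow> 'l \<Rightarrow> ('v simplex \<rightharpoonup> nat) \<Rightarrow> bool" where
  "msf_mem L F l W \<longleftrightarrow> lct_rep L l (verts (set F)) W \<and> dom W = {e. negative F e} \<and>
     (\<forall>e. negative F e \<longrightarrow> W e = Some (idx F e))"

definition static_mem :: "'v simplex list \<Rightarrow> ('v, 'n, 'd, 'l) memory \<Rightarrow> bool" where
  "static_mem F M \<longleftrightarrow> (\<forall>j<length F. simplex_at M j = F ! j) \<and> (\<forall>s\<in>set F. index_of M s = idx F s) \<and>
     (\<forall>s\<in>set F. s = {fst (endpoints M s), snd (endpoints M s)})"

text \<open>The condition of \<open>stores\<close> on the levels of all nodes follows from the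
  closed form of the merge forest, and the minimum spanning forest is the set of negative
  edges.\<close>

lemma (in graph_filtration) stores_iff:
  "stores D L F M \<longleftrightarrow> static_mem F M \<and> partner_mem (set F) (pairing F) (partner M) \<and>
     tree_rep D (set F) (MF F) M \<and> (\<exists>W. msf_mem L F (lct M) W)"
proof -
  have lev: "level (MF F) (simplex_of M n) = Some (index_of M (simplex_of M n))"
    if "represents (simplex_of M) A (MF F)" "n \<in> nodes A" "\<forall>s\<in>set F. index_of M s = idx F s" for A n
  proof -
    have "simplex_of M n \<in> nodes (MF F)" using that by (auto simp: represents_def bij_betw_def)
    then show ?thesis using that(3) node_in_set by (simp add: level_MF)
  qed
  show ?thesis
    unfolding stores_def minimum_spanning_forest_iff
    by (auto simp: static_mem_def partner_mem_def tree_rep_def tree_mem_def ptrs_mem_def msf_mem_def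
        lev intro!: exI)
qed

text \<open>One number \<beta> bounds every operation on structures of size at most
  \<open>m\<close>. Requiring \<beta> \<ge> 1 allows table accesses to be charged to it.\<close>

locale data_structures =
  fixes D :: "('n, 'd) dft_ops" and L :: "('v, 'l) lct_ops" and m :: nat and \<beta> :: real
  assumes bound: "1 \<le> \<beta>"
    and dft_root: "\<And>d T x. dft_rep D d T \<Longrightarrow> card (nodes T) \<le> m \<Longrightarrow> x \<in> nodes T \<Longrightarrow>
      performs (\<lambda>d'. dft_rep D d' T) (\<lambda>r. r = root_of T x) \<beta> (dft_root D x d)"
    and dft_cut: "\<And>d T x. dft_rep D d T \<Longrightarrow> card (nodes T) \<le> m \<Longrightarrow> x \<in> nodes T \<Longrightarrow> parent T x \<noteq> None \<Longrightarrow>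
      performs (\<lambda>d'. dft_rep D d' (T\<lparr>parent := (parent T)(x := None)\<rparr>)) (\<lambda>_. True) \<beta> (dft_cut D x d)"
    and dft_link: "\<And>d T r x. dft_rep D d T \<Longrightarrow> card (nodes T) \<le> m \<Longrightarrow> r \<in> nodes T \<Longrightarrow> x \<in> nodes T \<Longrightarrow>
      parent T r = None \<Longrightarrow> root_of T x \<noteq> r \<Longrightarrow>
      performs (\<lambda>d'. dft_rep D d' (T\<lparr>parent := (parent T)(r \<mapsto> x)\<rparr>)) (\<lambda>_. True) \<beta> (dft_link D r x d)"
    and dft_nca: "\<And>d T x y. dft_rep D d T \<Longrightarrow> card (nodes T) \<le> m \<Longrightarrow> x \<in> nodes T \<Longrightarrow> y \<in> nodes T \<Longrightarrow>
      same_tree T x y \<Longrightarrow>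
      performs (\<lambda>d'. dft_rep D d' T) (\<lambda>r. r = nca T x y) \<beta> (dft_nca D x y d)"
    and dft_set_level: "\<And>d T x j. dft_rep D d T \<Longrightarrow> card (nodes T) \<le> m \<Longrightarrow> is_leaf T x \<Longrightarrow>
      performs (\<lambda>d'. dft_rep D d' (T\<lparr>level := (level T)(x \<mapsto> j)\<rparr>)) (\<lambda>_. True) \<beta> (dft_set_level D x j d)"
    and dft_lowest_leaf: "\<And>d T x. dft_rep D d T \<Longrightarrow> card (nodes T) \<le> m \<Longrightarrow> x \<in> nodes T \<Longrightarrow>
      performs (\<lambda>d'. dft_rep D d' T) (is_lowest_leaf T x) \<beta> (dft_lowest_leaf D x d)"
    and lct_link: "\<And>l V W x y j. lct_rep L l V W \<Longrightarrow> card V + card (dom W) \<le> m \<Longrightarrow> x \<in> V \<Longrightarrow> y \<in> V \<Longrightarrow>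
      \<not> connected_in (dom W) x y \<Longrightarrow>
      performs (\<lambda>l'. lct_rep L l' V (W({x, y} \<mapsto> j))) (\<lambda>_. True) \<beta> (lct_link L x y j l)"
    and lct_cut: "\<And>l V W x y. lct_rep L l V W \<Longrightarrow> card V + card (dom W) \<le> m \<Longrightarrow> x \<in> V \<Longrightarrow> y \<in> V \<Longrightarrow>
      {x, y} \<in> dom W \<Longrightarrow>
      performs (\<lambda>l'. lct_rep L l' V (W({x, y} := None))) (\<lambda>_. True) \<beta> (lct_cut L x y l)"
    and lct_bottleneck: "\<And>l V W x y. lct_rep L l V W \<Longrightarrow> card V + card (dom W) \<le> m \<Longrightarrow> x \<in> V \<Longrightarrow> y \<in> V \<Longrightarrow>
      x \<noteq> y \<Longrightarrow> connected_in (dom W) x y \<Longrightarrow>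
      performs (\<lambda>l'. lct_rep L l' V W) (\<lambda>r. r = bottleneck W x y) \<beta> (lct_bottleneck L x y l)"
begin

lemma wp_cut_msf:
  assumes "lct_rep L (lct M) V W" "card V + card (dom W) \<le> m"
    "endpoints M e = (x, y)" "e = {x, y}" "x \<in> V" "y \<in> V" "e \<in> dom W"
    and "\<And>l c. lct_rep L l V (W(e := None)) \<Longrightarrow> real c \<le> \<beta> + 1 \<Longrightarrow> Q () (M\<lparr>lct := l\<rparr>) (t + c)"
  shows "wp (cut_msf L e) Q M t"
proof -
  have "performs (\<lambda>l'. lct_rep L l' V (W({x, y} := None))) (\<lambda>_. True) \<beta> (lct_cut L x y (lct M))"
    by (rule lct_cut) (use assms in auto)
  then have "wp (on_lct (lct_cut L x y)) Q M (t + 1)"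
  proof (rule wp_on_lct[OF _ refl])
    fix r :: unit and l c assume "lct_rep L l V (W({x, y} := None))" "real c \<le> \<beta>"
    then show "Q r (M\<lparr>lct := l\<rparr>) (t + 1 + c)" using assms(8)[of l "1 + c"] assms(4) by (simp add: add.assoc)
  qed
  then show ?thesis by (simp add: cut_msf_def assms(3))
qed

lemma wp_link_msf:
  assumes "lct_rep L (lct M) V W" "card V + card (dom W) \<le> m"
    "endpoints M e = (x, y)" "e = {x, y}" "x \<in> V" "y \<in> V" "\<not> connected_in (dom W) x y"
    and "\<And>l c. lct_rep L l V (W(e \<mapsto> j)) \<Longrightarrow> real c \<le> \<beta> + 1 \<Longrightarrow> Q () (M\<lparr>lct := l\<rparr>) (t + c)"
  shows "wp (link_msf L e j) Q M t"
proof -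
  have "performs (\<lambda>l'. lct_rep L l' V (W({x, y} \<mapsto> j))) (\<lambda>_. True) \<beta> (lct_link L x y j (lct M))"
    by (rule lct_link) (use assms in auto)
  then have "wp (on_lct (lct_link L x y j)) Q M (t + 1)"
  proof (rule wp_on_lct[OF _ refl])
    fix r :: unit and l c assume "lct_rep L l V (W({x, y} \<mapsto> j))" "real c \<le> \<beta>"
    then show "Q r (M\<lparr>lct := l\<rparr>) (t + 1 + c)" using assms(8)[of l "1 + c"] assms(4) by (simp add: add.assoc)
  qed
  then show ?thesis by (simp add: link_msf_def assms(3))
qed

text \<open>Linking again is permitted after the cut because an edge of a forest is a
  bridge.\<close>

lemma wp_reweigh_msf:
  assumes rep: "lct_rep L (lct M) V W" "card V + card (dom W) \<le> m"
    and e: "endpoints M e = (x, y)" "e = {x, y}" "x \<in> V" "y \<in> V" "e \<in> dom W"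
    and ac: "acyclic_edges (dom W)" "finite (dom W)"
    and Q: "\<And>l c. lct_rep L l V (W(e \<mapsto> j)) \<Longrightarrow> real c \<le> 2 * \<beta> + 2 \<Longrightarrow> Q () (M\<lparr>lct := l\<rparr>) (t + c)"
  shows "wp (reweigh_msf L e j) Q M t"
  unfolding reweigh_msf_def wp_bind
proof (rule wp_cut_msf[OF rep e])
  fix l c assume l: "lct_rep L l V (W(e := None))" and c: "real c \<le> \<beta> + 1"
  have dom: "dom (W(e := None)) = dom W - {e}" by auto
  show "wp (link_msf L e j) Q (M\<lparr>lct := l\<rparr>) (t + c)"
  proof (rule wp_link_msf[of _ V "W(e := None)" e x y])
    show "card V + card (dom (W(e := None))) \<le> m"
      unfolding dom using rep(2) card_Diff1_le[of "dom W" e] by linarith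
    show "\<not> connected_in (dom (W(e := None))) x y"
      unfolding dom using acyclic_edges_bridge[OF ac(1)] e by simp
    fix l' c' assume "lct_rep L l' V (W(e := None, e \<mapsto> j))" "real c' \<le> \<beta> + 1"
    then show "Q () (M\<lparr>lct := l\<rparr>\<lparr>lct := l'\<rparr>) (t + c + c')"
      using Q[of l' "c + c'"] c by (simp add: add.assoc)
  qed (use l e in simp_all)
qed

end

text \<open>Transposing both components of the pairs treats the exchange of two vertices and that of
  two edges alike. As \<open>s\<close> and \<open>t\<close> are not partners of each other, the
  later writes do not touch the cells of \<open>s\<close> and \<open>t\<close>.\<close>

lemma wp_swap_partners:
  assumes p: "partner_mem V P (partner M)" and PV: "P \<subseteq> V \<times> V" and st: "s \<in> V" "t \<in> V" "s \<noteq> t"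
    and irr: "\<And>x. (x, x) \<notin> P" "(s, t) \<notin> P" "(t, s) \<notin> P"
    and P': "\<And>x y. (x, y) \<in> P' \<longleftrightarrow> (transpose s t x, transpose s t y) \<in> P"
    and Q: "\<And>p c. partner_mem V P' p \<Longrightarrow> c \<le> 6 \<Longrightarrow> Q () (M\<lparr>partner := p\<rparr>) (T + c)"
  shows "wp (swap_partners s t) Q M T"
proof -
  define S where "S = {(x, y). (x, y) \<in> P \<or> (y, x) \<in> P}"
  let ?p = "partner M"
  have pS: "?p x = Some y \<longleftrightarrow> (x, y) \<in> S" if "x \<in> V" for x y
    using p that by (auto simp: partner_mem_def S_def)
  have SV: "(x, y) \<in> S \<Longrightarrow> x \<in> V \<and> y \<in> V" and Ssym: "(x, y) \<in> S \<Longrightarrow> (y, x) \<in> S" for x y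
    using PV by (auto simp: S_def)
  have Sfun: "(x, y) \<in> S \<Longrightarrow> (x, z) \<in> S \<Longrightarrow> y = z" for x y z
    using pS SV by (metis option.inject)
  have Sirr: "(x, x) \<notin> S" "(s, t) \<notin> S" "(t, s) \<notin> S" for x using irr by (auto simp: S_def)
  \<comment> \<open>The final table written down directly. That the successive writes of the program
    lead to it is checked below with \<open>upd\<close>.\<close>
  define q where "q = (\<lambda>x. if x = s then ?p t else if x = t then ?p s else
      if ?p t = Some x then Some s else if ?p s = Some x then Some t else ?p x)"
  have "q x = Some y \<longleftrightarrow> (transpose s t x, transpose s t y) \<in> S" if x: "x \<in> V" for x y
  proof -
    consider "x = s" | "x = t" | "x \<noteq> s" "x \<noteq> t" by blast
    then show ?thesis
    proof cases
      case 1
      then have "q x = Some y \<longleftrightarrow> (t, y) \<in> S" using pS st by (simp add: q_def)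
      then show ?thesis using 1 Sirr by (auto simp: transpose_def)
    next
      case 2
      then have "q x = Some y \<longleftrightarrow> (s, y) \<in> S" using pS st by (simp add: q_def)
      then show ?thesis using 2 Sirr by (auto simp: transpose_def)
    next
      case 3
      then have q: "q x = (if (t, x) \<in> S then Some s else if (s, x) \<in> S then Some t else ?p x)"
        using pS st by (simp add: q_def)
      have "(transpose s t x, transpose s t y) \<in> S \<longleftrightarrow> (x, transpose s t y) \<in> S" using 3 by simp
      moreover have "q x = Some y \<longleftrightarrow> (x, transpose s t y) \<in> S"
      proof (cases "(t, x) \<in> S \<or> (s, x) \<in> S")
        case True
        have tr: "transpose s t y = t \<longleftrightarrow> y = s" "transpose s t y = s \<longleftrightarrow> y = t"
          by (metis transpose_apply_first transpose_apply_second transpose_involutory)+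
        from True consider "(t, x) \<in> S" | "(t, x) \<notin> S" "(s, x) \<in> S" by blast
        then show ?thesis
        proof cases
          case 1
          then have "q x = Some s" using q by simp
          moreover have "(x, transpose s t y) \<in> S \<longleftrightarrow> transpose s t y = t" using 1 Ssym Sfun by metis
          ultimately show ?thesis using tr by auto
        next
          case 2
          then have "q x = Some t" using q by simp
          moreover have "(x, transpose s t y) \<in> S \<longleftrightarrow> transpose s t y = s" using 2 Ssym Sfun by metis
          ultimately show ?thesis using tr by auto
        qed
      next
        case False
        then have "(x, s) \<notin> S" "(x, t) \<notin> S" using Ssym by blast+
        then have "(x, y) \<in> S \<longleftrightarrow> (x, transpose s t y) \<in> S"
          by (cases "y = s"; cases "y = t") simp_all
        then show ?thesis unfolding q using False pS[OF x] by simp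
      qed
      ultimately show ?thesis by simp
    qed
  qed
  then have pm: "partner_mem V P' q" unfolding partner_mem_def P' S_def by auto
  define upd where "upd = (let p1 = ?p(s := ?p t, t := ?p s);
      p2 = (case ?p s of None \<Rightarrow> p1 | Some a \<Rightarrow> p1(a := Some t))
    in (case ?p t of None \<Rightarrow> p2 | Some a \<Rightarrow> p2(a := Some s)))"
  have ne: "a \<noteq> s \<and> a \<noteq> t" if "?p s = Some a \<or> ?p t = Some a" for a
    using that pS st Sirr by auto
  have "upd = q"
    using ne st(3) by (auto simp: upd_def q_def fun_eq_iff Let_def split: option.splits)
  then have "c \<le> 6 \<Longrightarrow> Q () (M\<lparr>partner := upd\<rparr>) (T + c)" for c using Q pm by simp
  \<comment> \<open>Two reads and two writes, and one more write for each of the two simplices that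
    has a partner.\<close>
  from this[of 4] this[of 5] this[of 6] show ?thesis
    unfolding swap_partners_def
    by (cases "?p s"; cases "?p t") (simp_all add: upd_def Let_def numeral_eq_Suc)
qed


subsection \<open>Rotations\<close>

lemma nodes_parent_update [simp]: "nodes (T\<lparr>parent := f\<rparr>) = nodes T"
  by (simp add: nodes_def)

lemma ancestor_cong:
  assumes "ancestor T z x" "\<And>y. ancestor T y x \<Longrightarrow> parent T' y = parent T y"
  shows "ancestor T' z x"
  using assms(1)
proof (induction rule: ancestor_induct)
  case (step y w)
  then have "ancestor T' w y" using assms(2) ancestor_parent by metis
  then show ?case using step.IH ancestor_trans by metis
qed simp

context data_structures
begin

text \<open>At most six operations on the tree and eight table accesses are made. The order of cuts
  and links keeps the structure a forest throughout; what has to be shown for each link is that the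
  node linked is not the root of the tree it is linked to. For this \<open>avoid\<close> separates
  the nodes that move from those above \<open>n2\<close>.\<close>

lemma wp_rotate_nodes:
  fixes M :: "('v, 'n, 'd, 'l) memory" and A :: "'n forest" and n1 n2 r :: 'n
  defines "q \<equiv> parent A n2"
  defines "cp \<equiv> (case q of None \<Rightarrow> child_ptrs M
      | Some p \<Rightarrow> (case the (child_ptrs M p) of (a, b) \<Rightarrow>
          (child_ptrs M)(p \<mapsto> if a = n2 then (n1, b) else (a, n1))))"
  assumes rep: "dft_rep D (dft M) A" "card (nodes A) \<le> m"
    and closed: "\<And>n p. parent A n = Some p \<Longrightarrow> n \<in> nodes A \<and> p \<in> nodes A"
    and par: "parent A n1 = Some n2" "parent A r = Some n1"
    and neq: "n1 \<noteq> n2" "r \<noteq> n1" "r \<noteq> n2"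
    and ptr: "parent_ptr M n2 = q"
    and root: "ancestor A \<rho> n2" "parent A \<rho> = None"
    and avoid: "\<And>p y. q = Some p \<Longrightarrow> ancestor A y p \<Longrightarrow> y \<noteq> n1 \<and> y \<noteq> n2 \<and> y \<noteq> r"
    and Q: "\<And>d c. dft_rep D d (A\<lparr>parent := (parent A)(r \<mapsto> n2, n2 \<mapsto> n1, n1 := q)\<rparr>) \<Longrightarrow>
      real c \<le> 18 * \<beta> \<Longrightarrow>
      Q () (M\<lparr>dft := d, parent_ptr := (parent_ptr M)(r \<mapsto> n2, n2 \<mapsto> n1, n1 := q),
        child_ptrs := cp(n2 \<mapsto> (r, r3), n1 \<mapsto> (n2, r'))\<rparr>) (t + c)"
  shows "wp (rotate_nodes D n1 n2 r r' r3) Q M t"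
proof -
  let ?A1 = "A\<lparr>parent := (parent A)(n1 := None)\<rparr>"
  let ?A2 = "A\<lparr>parent := (parent A)(n1 := None, r := None)\<rparr>"
  let ?A3 = "A\<lparr>parent := (parent A)(n1 := None, r \<mapsto> n2)\<rparr>"
  have nodes: "n1 \<in> nodes A" "n2 \<in> nodes A" "r \<in> nodes A" using par closed by auto
  have \<rho>: "\<rho> \<noteq> n1" "\<rho> \<noteq> r" "q \<noteq> None \<Longrightarrow> \<rho> \<noteq> n2" using root(2) par by (auto simp: q_def)
  \<comment> \<open>The path from the former parent of \<open>n2\<close> to the root contains none
    of the nodes whose links change, so it survives all intermediate stages.\<close>
  have above: "ancestor T \<rho> p"
    if p: "q = Some p" and T: "\<And>y. y \<noteq> n1 \<Longrightarrow> y \<noteq> n2 \<Longrightarrow> y \<noteq> r \<Longrightarrow> parent T y = parent A y" for T p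
  proof -
    have "ancestor A \<rho> p" using root \<rho>(3) p ancestor_unfold[of A \<rho> n2] by (auto simp: q_def)
    then show ?thesis by (rule ancestor_cong) (use T avoid[OF p] in blast)
  qed
  \<comment> \<open>The precondition for linking \<open>r\<close> below \<open>n2\<close>: after the
    cuts the root above \<open>n2\<close> is \<open>n2\<close> itself or the old root.\<close>
  have root2: "root_of ?A2 n2 \<noteq> r"
  proof (cases q)
    case None
    then have "root_of ?A2 n2 = n2" using neq by (intro root_of_eqI) (auto simp: q_def)
    then show ?thesis using neq by simp
  next
    case (Some p)
    have "ancestor ?A2 \<rho> p" by (rule above[OF Some]) simp
    moreover have "ancestor ?A2 p n2" using Some neq by (intro ancestor_parent) (simp add: q_def)
    ultimately have "root_of ?A2 n2 = \<rho>"
      using root \<rho> by (intro root_of_eqI) (auto intro: ancestor_trans)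
    then show ?thesis using \<rho> by simp
  qed
  have cut1: "performs (\<lambda>d'. dft_rep D d' ?A1) (\<lambda>_. True) \<beta> (dft_cut D n1 (dft M))"
    using dft_cut[OF rep nodes(1)] par by simp
  have cut2: "performs (\<lambda>d'. dft_rep D d' ?A2) (\<lambda>_. True) \<beta> (dft_cut D r d)" if "dft_rep D d ?A1" for d
    using dft_cut[OF that, of r] rep nodes par neq by simp
  have link3: "performs (\<lambda>d'. dft_rep D d' ?A3) (\<lambda>_. True) \<beta> (dft_link D r n2 d)" if "dft_rep D d ?A2" for d
    using dft_link[OF that, of r n2] rep nodes par neq root2 by simp
  show ?thesis
  proof (cases q)
    case None
    have link4: "performs (\<lambda>d'. dft_rep D d' (A\<lparr>parent := (parent A)(r \<mapsto> n2, n2 \<mapsto> n1, n1 := q)\<rparr>))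
        (\<lambda>_. True) \<beta> (dft_link D n2 n1 d)" if d: "dft_rep D d ?A3" for d
    proof -
      have "root_of ?A3 n1 = n1" using neq by (intro root_of_eqI) auto
      moreover have "(parent A)(n1 := None, r \<mapsto> n2, n2 \<mapsto> n1) = (parent A)(r \<mapsto> n2, n2 \<mapsto> n1, n1 := q)"
        using neq None by (auto simp: fun_eq_iff)
      ultimately show ?thesis using dft_link[OF d, of n2 n1] rep nodes neq None by (simp add: q_def)
    qed
    show ?thesis
      unfolding rotate_nodes_def
      apply (simp add: ptr None)
      apply (rule wp_on_dft, simp, rule cut1)
      apply (simp, rule wp_on_dft, simp, rule cut2, assumption)
      apply (simp, rule wp_on_dft, simp, rule link3, assumption)
      apply (simp, rule wp_on_dft, simp, rule link4, assumption)
      subgoal for d1 c1 d2 c2 d3 c3 _ d4 c4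
        using Q[of d4 "1 + c1 + c2 + c3 + c4 + 5"] bound
        by (simp add: cp_def None algebra_simps numeral_eq_Suc)
      done
  next
    case (Some p)
    let ?A4 = "A\<lparr>parent := (parent A)(n1 := None, r \<mapsto> n2, n2 := None)\<rparr>"
    let ?A5 = "A\<lparr>parent := (parent A)(r \<mapsto> n2, n2 := None, n1 \<mapsto> p)\<rparr>"
    have p: "p \<in> nodes A" "p \<noteq> n1" "p \<noteq> n2" "p \<noteq> r"
      using closed Some avoid[OF Some ancestor_refl] by (auto simp: q_def)
    have cut4: "performs (\<lambda>d'. dft_rep D d' ?A4) (\<lambda>_. True) \<beta> (dft_cut D n2 d)" if "dft_rep D d ?A3" for d
      using dft_cut[OF that, of n2] rep nodes neq Some by (simp add: q_def)
    have link5: "performs (\<lambda>d'. dft_rep D d' ?A5) (\<lambda>_. True) \<beta> (dft_link D n1 p d)" if d: "dft_rep D d ?A4" for d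
    proof -
      have "ancestor ?A4 \<rho> p" by (rule above[OF Some]) simp
      then have "root_of ?A4 p = \<rho>" using root \<rho> Some by (intro root_of_eqI) auto
      then show ?thesis using dft_link[OF d, of n1 p] rep nodes neq p \<rho> by simp
    qed
    have link6: "performs (\<lambda>d'. dft_rep D d' (A\<lparr>parent := (parent A)(r \<mapsto> n2, n2 \<mapsto> n1, n1 := q)\<rparr>))
        (\<lambda>_. True) \<beta> (dft_link D n2 n1 d)" if d: "dft_rep D d ?A5" for d
    proof -
      have "ancestor ?A5 \<rho> p" by (rule above[OF Some]) simp
      moreover have "ancestor ?A5 p n1" by (intro ancestor_parent) simp
      ultimately have "root_of ?A5 n1 = \<rho>"
        using root \<rho> Some by (intro root_of_eqI) (auto intro: ancestor_trans)
      moreover have "(parent A)(r \<mapsto> n2, n2 := None, n1 \<mapsto> p, n2 \<mapsto> n1) =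
          (parent A)(r \<mapsto> n2, n2 \<mapsto> n1, n1 := q)"
        using neq Some by (auto simp: fun_eq_iff)
      ultimately show ?thesis using dft_link[OF d, of n2 n1] rep nodes neq \<rho> Some by simp
    qed
    obtain x y where xy: "the (child_ptrs M p) = (x, y)" by fastforce
    show ?thesis
      unfolding rotate_nodes_def
      apply (simp add: ptr Some)
      apply (rule wp_on_dft, simp, rule cut1)
      apply (simp, rule wp_on_dft, simp, rule cut2, assumption)
      apply (simp, rule wp_on_dft, simp, rule link3, assumption)
      apply (simp, rule wp_on_dft, simp, rule cut4, assumption)
      apply (simp, rule wp_on_dft, simp, rule link5, assumption)
      apply (simp add: xy split del: if_split)
      apply (rule wp_on_dft, simp, rule link6, assumption)
      subgoal for d1 c1 d2 c2 d3 c3 d4 c4 d5 c5 _ d6 c6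
        using Q[of d6 "1 + c1 + c2 + c3 + c4 + c5 + 2 + c6 + 5"] bound
        by (simp add: cp_def Some xy algebra_simps numeral_eq_Suc)
      done
  qed
qed

end

subsection \<open>The update of a stored filtration\<close>

context graph_filtration
begin

lemma pairing_vertex:
  assumes "(s, e) \<in> pairing F" obtains x where "s = {x}" "{x} \<in> set F"
proof -
  have neg: "negative F e" using assms by (rule pairing_negative)
  obtain p q where e: "e = {p, q}" using neg by (rule negative_obtain)
  obtain y z where "oldest_pt (idx F e) p = {y}" "{y} \<in> set F" "oldest_pt (idx F e) q = {z}" "{z} \<in> set F"
  proof -
    have "{v} \<in> graph_at F (idx F e)" if "v \<in> e" for v
      using edge_endpoint[OF negative_in_set[OF neg] negative_is_edge[OF neg] that] by (simp add: mem_graph_at)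
    then have v: "{p} \<in> graph_at F (idx F e)" "{q} \<in> graph_at F (idx F e)" using e by auto
    have j: "idx F e \<le> length F" using idx_less[OF negative_in_set[OF neg]] by simp
    obtain y where "oldest_pt (idx F e) p = {y}" "{y} \<in> set F" using oldest_pt_obtain[OF j v(1)] by metis
    moreover obtain z where "oldest_pt (idx F e) q = {z}" "{z} \<in> set F" using oldest_pt_obtain[OF j v(2)] by metis
    ultimately show thesis using that by blast
  qed
  moreover have "s = younger F (oldest_pt (idx F e) p) (oldest_pt (idx F e) q)"
    using pairing_iff[of p q s] neg assms unfolding e by blast
  ultimately show thesis using that by (auto simp: younger_def split: if_splits)
qed

lemma negative_paired: "negative F e \<Longrightarrow> \<exists>s. (s, e) \<in> pairing F"
  using pairing_iff by (metis negative_obtain)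

lemma pairing_subset: "pairing F \<subseteq> set F \<times> set F"
proof clarify
  fix s e assume se: "(s, e) \<in> pairing F"
  have "e \<in> set F" using pairing_negative[OF se] by (rule negative_in_set)
  moreover obtain x where "s = {x}" "{x} \<in> set F" using se by (rule pairing_vertex)
  ultimately show "s \<in> set F \<and> e \<in> set F" by simp
qed

lemma pairing_fst_vertex: "(s, e) \<in> pairing F \<Longrightarrow> is_vertex s \<and> is_edge e"
  using pairing_vertex pairing_negative negative_is_edge by (metis is_vertex_singleton)

text \<open>Vertices and negative edges are different entries of \<open>F\<close>. So
  \<open>length F\<close> may serve as the size \<open>m\<close> of the link-cut tree.\<close>

lemma card_spanning_forest: "card (verts (set F)) + card {e. negative F e} \<le> length F"
proof -
  have inj: "inj_on (\<lambda>x. {x}) (verts (set F))" by (simp add: inj_on_def)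
  have "(\<lambda>x. {x}) ` verts (set F) \<inter> {e. negative F e} = {}" by (auto dest!: negative_is_edge)
  then have "card ((\<lambda>x. {x}) ` verts (set F) \<union> {e. negative F e}) = card (verts (set F)) + card {e. negative F e}"
    using inj negatives_finite card_Un_disjoint[of "(\<lambda>x. {x}) ` verts (set F)" "{e. negative F e}"]
    by (metis (no_types, lifting) card_image finite_imageD finite_imageI finite_set finite_subset
        image_subsetI mem_Collect_eq verts_def)
  moreover have "(\<lambda>x. {x}) ` verts (set F) \<union> {e. negative F e} \<subseteq> set F"
    by (auto simp: verts_def negative_in_set)
  ultimately show ?thesis using card_mono[OF finite_set] card_length[of F] by (metis le_trans)
qed

lemma card_nodes_MF: "card (nodes (MF F)) \<le> length F"
proof -
  have "nodes (MF F) \<subseteq> set F" by (auto simp: is_node_def)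
  then show ?thesis using card_mono[OF finite_set] card_length[of F] by (metis le_trans)
qed

end

locale stored_switch = graph_switch F k + data_structures D L "length F" \<beta>
  for F :: "'v simplex list" and k and D :: "('n, 'd) dft_ops" and L :: "('v, 'l) lct_ops" and \<beta> +
  fixes M0 :: "('v, 'n, 'd, 'l) memory" and A :: "'n forest" and W :: "'v simplex \<rightharpoonup> nat"
  assumes static: "static_mem F M0"
    and partners: "partner_mem (set F) (pairing F) (partner M0)"
    and dft: "dft_rep D (dft M0) A"
    and tree: "tree_mem (set F) (MF F) A (node_of M0) (simplex_of M0)"
    and ptrs: "ptrs_mem A (parent_ptr M0) (child_ptrs M0)"
    and msf: "msf_mem L F (lct M0) W"
begin

abbreviation "lab \<equiv> simplex_of M0"

sublocale rep: forest_representation "simplex_of M0" A "MF F"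
  by unfold_locales (use tree parent_MF is_parent_nodes in \<open>auto simp: tree_mem_def\<close>)

text \<open>The state between the case distinction and the final writes: the partners and the
  spanning forest already belong to \<open>F'\<close>, while the tables of indices still belong to
  \<open>F\<close>. \<open>T\<close> is the forest before \<open>update_levels\<close>.\<close>

definition middle :: "'v simplex forest \<Rightarrow> real \<Rightarrow> ('v, 'n, 'd, 'l) memory \<Rightarrow> nat \<Rightarrow> bool" where
  "middle T c M t \<longleftrightarrow> simplex_at M = simplex_at M0 \<and> index_of M = index_of M0 \<and>
     endpoints M = endpoints M0 \<and> partner_mem (set F) (pairing F') (partner M) \<and>
     tree_rep D (set F) T M \<and> (\<exists>W. msf_mem L F' (lct M) W) \<and> real t \<le> c"

lemma index_of [simp]: "s \<in> set F \<Longrightarrow> index_of M0 s = idx F s"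
  using static by (simp add: static_mem_def)

lemma endpoints_obtain:
  assumes "s \<in> set F" obtains x y where "endpoints M0 s = (x, y)" "s = {x, y}"
  using static assms by (metis prod.collapse static_mem_def)

lemma partner_iff: "s \<in> set F \<Longrightarrow> partner M0 s = Some t \<longleftrightarrow> (s, t) \<in> pairing F \<or> (t, s) \<in> pairing F"
  using partners by (simp add: partner_mem_def)

lemma partner_vertex: "is_vertex s \<Longrightarrow> s \<in> set F \<Longrightarrow> partner M0 s = Some t \<longleftrightarrow> (s, t) \<in> pairing F"
  using partner_iff pairing_fst_vertex is_edge_not_vertex by metis

text \<open>This is how the program finds out the sign of an edge.\<close>

lemma partner_edge: "is_edge e \<Longrightarrow> e \<in> set F \<Longrightarrow> partner M0 e = None \<longleftrightarrow> \<not> negative F e"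
  using partner_iff[of e] pairing_fst_vertex is_edge_not_vertex pairing_negative negative_paired
  by (metis not_Some_eq)

lemma node_obtain:
  assumes "is_node F s" obtains n where "node_of M0 s = Some n" "n \<in> nodes A" "lab n = s"
  using rep.lab_surj[of s] tree assms node_in_set by (auto simp: tree_mem_def)

lemma card_nodes_A: "card (nodes A) \<le> length F"
  using rep.card_nodes card_nodes_MF by simp

lemma msf_facts:
  "lct_rep L (lct M0) (verts (set F)) W" "dom W = {e. negative F e}"
  "\<And>e. negative F e \<Longrightarrow> W e = Some (idx F e)"
  "card (verts (set F)) + card (dom W) \<le> length F"
  using msf card_spanning_forest by (auto simp: msf_mem_def)

lemma endpoints_verts:
  assumes "{x, y} \<in> set F" shows "x \<in> verts (set F)" "y \<in> verts (set F)"
  using simplex_endpoint[OF assms] by (auto simp: verts_def)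

lemma msf_memI:
  assumes "lct_rep L l (verts (set F)) W'" "dom W' = {e. negative F' e}"
    and "\<And>e. negative F e \<Longrightarrow> e \<noteq> \<sigma> \<Longrightarrow> e \<noteq> \<tau> \<Longrightarrow> W' e = W e"
    and "negative F' \<sigma> \<Longrightarrow> W' \<sigma> = Some (Suc k)" "negative F' \<tau> \<Longrightarrow> W' \<tau> = Some k"
  shows "msf_mem L F' l W'"
proof -
  have "W' e = Some (idx F' e)" if e: "negative F' e" for e
  proof -
    have "e \<in> set F" using sw.negative_in_set[OF e] by simp
    then show ?thesis using assms(3-5) e other_negative msf_facts(3) idx_other
      by (cases "e = \<sigma>"; cases "e = \<tau>") simp_all
  qed
  then show ?thesis using assms(1,2) by (simp add: msf_mem_def)
qed

lemma msf_mem_unchanged: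
  assumes "stable" "\<not> negative F \<sigma>" "\<not> negative F \<tau>"
  shows "msf_mem L F' (lct M0) W"
  by (rule msf_memI) (use assms stable_negative msf_facts in auto)

text \<open>For stable switches in which only one of the two simplices is a negative edge: its
  weight is all that changes in the spanning forest.\<close>

lemma wp_reweigh_switched:
  assumes e: "negative F e" and st: "stable"
    and sel: "e = \<sigma> \<and> j = Suc k \<and> \<not> negative F \<tau> \<or> e = \<tau> \<and> j = k \<and> \<not> negative F \<sigma>"
    and T: "tree_rep D (set F) (MF F) M0" "pairing F' = pairing F"
  shows "wp (reweigh_msf L e j) (\<lambda>_. middle (MF F) (real t + 4 * \<beta>)) M0 t"
proof -
  have eF: "e \<in> set F" using e by (rule negative_in_set)
  obtain x y where xy: "endpoints M0 e = (x, y)" "e = {x, y}" using endpoints_obtain[OF eF] .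
  show ?thesis
  proof (rule wp_reweigh_msf[OF msf_facts(1,4) xy])
    show "x \<in> verts (set F)" "y \<in> verts (set F)" using endpoints_verts eF xy by auto
    show "e \<in> dom W" "acyclic_edges (dom W)" "finite (dom W)"
      unfolding msf_facts(2) using e negatives_acyclic negatives_finite by auto
    fix l c assume l: "lct_rep L l (verts (set F)) (W(e \<mapsto> j))" and c: "real c \<le> 2 * \<beta> + 2"
    have "msf_mem L F' l (W(e \<mapsto> j))"
      by (rule msf_memI[OF l]) (use sel e st stable_negative msf_facts(2) in auto)
    then show "middle (MF F) (real t + 4 * \<beta>) (M0\<lparr>lct := l\<rparr>) (t + c)"
      using T partners c bound by (auto simp: middle_def tree_rep_def)
  qed
qed

lemma tree_rep_M0: "tree_rep D (set F) (MF F) M0"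
  using dft tree ptrs by (auto simp: tree_rep_def)

lemma middle_refl:
  assumes "stable" "\<not> negative F \<sigma>" "\<not> negative F \<tau>" "pairing F' = pairing F"
  shows "middle (MF F) (real t) M0 t"
  using assms msf_mem_unchanged partners tree_rep_M0 by (auto simp: middle_def)

lemma wp_run_mixed:
  assumes "e = \<sigma> \<and> j = Suc k \<and> is_vertex \<tau> \<or> e = \<tau> \<and> j = k \<and> is_vertex \<sigma>" "is_edge e"
  shows "wp (run_mixed L e j) (\<lambda>_. middle (MF F) (real t + 5 * \<beta>)) M0 t"
proof -
  have st: stable using assms stable_if_vertex by blast
  have nv: "\<not> (is_vertex \<sigma> \<and> is_vertex \<tau>)" using assms is_edge_not_vertex by blast
  then have eq: "pairing F' = pairing F" using st stable_pairing by blast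
  have vneg: "\<not> negative F s" if "is_vertex s" for s using that negative_is_edge is_edge_not_vertex by metis
  have eF: "e \<in> set F" using assms by auto
  show ?thesis
  proof (cases "negative F e")
    case True
    then have "wp (reweigh_msf L e j) (\<lambda>_. middle (MF F) (real (t + 1) + 4 * \<beta>)) M0 (t + 1)"
      by (rule wp_reweigh_switched) (use st assms vneg tree_rep_M0 eq in auto)
    moreover have "real (t + 1) + 4 * \<beta> \<le> real t + 5 * \<beta>" using bound by simp
    ultimately show ?thesis using True partner_edge[OF assms(2) eF]
      by (auto simp: run_mixed_def middle_def elim: wp_mono)
  next
    case False
    then have "\<not> negative F \<sigma>" "\<not> negative F \<tau>" using assms(1) vneg by blast+
    then have "middle (MF F) (real t) M0 t" using middle_refl st eq by blast
    then show ?thesis using False partner_edge[OF assms(2) eF] bound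
      by (auto simp: run_mixed_def middle_def)
  qed
qed

end


section \<open>Programs for two vertices and for a negative edge before a positive one\<close>

lemma represents_relabel:
  assumes "represents lab A T" "inj f" "nodes T' = f ` nodes T"
    and "\<And>s. parent T' (f s) = map_option f (parent T s)" "\<And>s. level T' (f s) = level T s"
    and lab': "\<And>n. n \<in> nodes A \<Longrightarrow> lab' n = f (lab n)"
  shows "represents lab' A T'"
  unfolding represents_def
proof (intro conjI allI ballI impI)
  have bij: "bij_betw lab (nodes A) (nodes T)" using assms(1) by (simp add: represents_def)
  have "bij_betw f (nodes T) (nodes T')"
    unfolding assms(3) using assms(2) by (metis bij_betw_imageI inj_on_subset top_greatest)
  then have "bij_betw (f \<circ> lab) (nodes A) (nodes T')" using bij bij_betw_trans by blast
  then show "bij_betw lab' (nodes A) (nodes T')" using lab' by (metis bij_betw_cong comp_apply)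
  have closed: "n \<in> nodes A \<and> p \<in> nodes A" if "parent A n = Some p" for n p
    using assms(1) that by (simp add: represents_def)
  then show "n \<in> nodes A" "p \<in> nodes A" if "parent A n = Some p" for n p using that by blast+
  fix n
  show "map_option lab' (parent A n) = parent T' (lab' n)" if n: "n \<in> nodes A"
  proof -
    have "map_option lab (parent A n) = parent T (lab n)" using assms(1) n by (simp add: represents_def)
    then have "parent T' (lab' n) = map_option f (map_option lab (parent A n))"
      using assms(4) lab'[OF n] by simp
    also have "\<dots> = map_option lab' (parent A n)"
      using closed lab' by (cases "parent A n") auto
    finally show ?thesis by simp
  qed
  show "level A n = level T' (lab' n)" if n: "is_leaf A n"
  proof -
    have "n \<in> nodes A" using n by (simp add: is_leaf_def)
    then show ?thesis using assms(1,5) n lab' by (simp add: represents_def)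
  qed
qed

context stored_switch
begin

lemma wp_late_partner:
  assumes "partner M = partner M0" "index_of M = index_of M0" "v \<in> set F" "is_vertex v"
    and Q: "\<And>c. c \<le> 2 \<Longrightarrow> Q (\<forall>h. (v, h) \<in> pairing F \<longrightarrow> j \<le> idx F h) M (t + c)"
  shows "wp (late_partner j v) Q M t"
proof (cases "partner M0 v")
  case None
  then have "(v, h) \<notin> pairing F" for h using partner_vertex[OF assms(4,3)] by (metis option.distinct(1))
  then have "(\<forall>h. (v, h) \<in> pairing F \<longrightarrow> j \<le> idx F h) = True" by blast
  then show ?thesis using Q[of 1] None assms by (simp add: late_partner_def)
next
  case (Some h)
  then have h: "(v, h') \<in> pairing F \<longleftrightarrow> h' = h" for h'
    using partner_vertex[OF assms(4,3)] by (metis option.inject)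
  then have "h \<in> set F" using pairing_subset by blast
  then have "index_of M h = idx F h" using assms(2) by simp
  then show ?thesis using Q[of 2] Some assms h by (simp add: late_partner_def numeral_eq_Suc)
qed

lemma wp_run_vertices:
  assumes v: "is_vertex \<sigma>" "is_vertex \<tau>"
  shows "wp (run_vertices D \<sigma> \<tau>) (\<lambda>_. middle (MF F) (real t + 20 * \<beta>)) M0 t"
proof -
  obtain a b where ab: "\<sigma> = {a}" "\<tau> = {b}" using v by (auto simp: is_vertex_def)
  have st: stable using v by (intro stable_if_vertex) simp
  have vneg: "\<not> negative F \<sigma>" "\<not> negative F \<tau>"
    using v negative_is_edge is_edge_not_vertex by metis+
  have nodes: "is_node F \<sigma>" "is_node F \<tau>" using v by (simp_all add: is_node_def)
  obtain n1 where n1: "node_of M0 \<sigma> = Some n1" "n1 \<in> nodes A" "lab n1 = \<sigma>"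
    using node_obtain[OF nodes(1)] .
  obtain n2 where n2: "node_of M0 \<tau> = Some n2" "n2 \<in> nodes A" "lab n2 = \<tau>"
    using node_obtain[OF nodes(2)] .
  have fin: "middle (MF F) (real t + 20 * \<beta>) (M0\<lparr>dft := d, partner := p\<rparr>) (t + c)"
    if "dft_rep D d A" "partner_mem (set F) (pairing F') p" "real c \<le> 20 * \<beta>" for d p c
    using that tree ptrs msf_mem_unchanged[OF st vneg] by (auto simp: middle_def tree_rep_def)
  have fin0: "middle (MF F) (real t + 20 * \<beta>) (M0\<lparr>dft := d\<rparr>) (t + c)"
    if "dft_rep D d A" "pairing F' = pairing F" "real c \<le> 20 * \<beta>" for d c
    using fin[of d "partner M0" c] that partners by simp
  obtain r1 where r1: "is_node F r1" "ancestor (MF F) r1 \<sigma>" "parent (MF F) r1 = None" "root_of (MF F) \<sigma> = r1"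
    using root_of_MF[OF nodes(1)] .
  obtain r2 where r2: "is_node F r2" "ancestor (MF F) r2 \<tau>" "parent (MF F) r2 = None" "root_of (MF F) \<tau> = r2"
    using root_of_MF[OF nodes(2)] .
  have R1: "lab (root_of A n1) = r1" "root_of A n1 \<in> nodes A"
    using rep.root_of_lab[OF n1(2), of r1] r1 n1(3) by simp_all
  have R2: "lab (root_of A n2) = r2" "root_of A n2 \<in> nodes A"
    using rep.root_of_lab[OF n2(2), of r2] r2 n2(3) by simp_all
  have roots: "root_of A n1 = root_of A n2 \<longleftrightarrow> same_tree (MF F) \<sigma> \<tau>"
    using R1 R2 rep.lab_inj r1(4) r2(4) by (metis same_tree_def)
  have noswap: "pairing F' = pairing F" if "\<not> (\<exists>j. swaps a b j)"
  proof -
    have "(s, e) \<in> pairing F' \<longleftrightarrow> (s, e) \<in> pairing F" for s e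
    proof (cases "negative F e")
      case True
      then show ?thesis using pairing_switch_vertices[OF ab True, of s] that by simp
    next
      case False
      then show ?thesis using pairing_negative sw.pairing_negative stable_negative[OF st] by blast
    qed
    then show ?thesis by auto
  qed
  show ?thesis
  proof (cases "same_tree (MF F) \<sigma> \<tau>")
    case False
    then have eq: "pairing F' = pairing F" using noswap swaps_iff[OF ab] by blast
    show ?thesis
      unfolding run_vertices_def
      apply (simp add: n1 n2)
      apply (rule wp_on_dft, simp, rule dft_root[OF dft card_nodes_A n1(2)])
      apply (simp, rule wp_on_dft, simp, rule dft_root[OF _ card_nodes_A n2(2)], assumption)
      apply (simp add: roots False)
      subgoal for _ d1 c1 _ d2 c2
        using fin0[of d2 "2 + c1 + c2"] bound eq by (simp add: algebra_simps)
      done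
  next
    case True
    have mem: "{a} \<in> set F" "{b} \<in> set F" "a \<noteq> b"
      using mem_switched switched_neq unfolding ab by auto
    have "connected_in (set F) a b" using True same_tree_MF_vertices[OF mem(1,2)] unfolding ab by simp
    then obtain j p q where j: "j < length F" "F ! j = {p, q}" "negative F {p, q}"
      "connected_in (graph_at F j) a p" "connected_in (graph_at F j) b q"
      "\<And>l. connected_in (graph_at F l) a b \<Longrightarrow> j < l"
      using merge_time[of "length F" a b] mem(3) by (metis graph_at_length le_refl)
    let ?e = "{p, q}"
    have e: "is_node F ?e" "?e \<in> set F" using j(3) negative_is_node negative_in_set by simp_all
    note anc = ancestor_merge[OF mem(1,2) j(2,1,3,4,5,6)]
    have nca: "nca (MF F) \<sigma> \<tau> = ?e" unfolding ab by (rule nca_MF_merge[OF mem(1,2) j(2,1,3,4,5,6)])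
    have lab_nca: "lab (nca A n1 n2) = ?e"
    proof (rule rep.nca_lab[OF n1(2) n2(2)])
      show "nca (MF F) (lab n1) (lab n2) = ?e" using nca n1 n2 by simp
      show "?e \<in> nodes (MF F)" using e by simp
      show "ancestor (MF F) ?e (lab n1)" "ancestor (MF F) ?e (lab n2)"
        using anc n1 n2 ab by auto
      show "ancestor (MF F) z ?e" if "ancestor (MF F) z (lab n1)" "ancestor (MF F) z (lab n2)" for z
        using anc that n1 n2 ab by auto
      show "z = ?e" if "z \<in> nodes (MF F)" "ancestor (MF F) z ?e" "ancestor (MF F) ?e z" for z
        using that e ancestor_MF node_comp_inj by (metis nodes_MF subset_antisym)
    qed
    have same: "same_tree A n1 n2" using roots True by (simp add: same_tree_def)
    let ?c = "\<lambda>v. \<forall>h. (v, h) \<in> pairing F \<longrightarrow> idx F ?e \<le> idx F h"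
    have swaps: "(\<exists>j. swaps a b j) \<longleftrightarrow> ?c \<sigma> \<and> ?c \<tau>"
      using swaps_iff[OF ab] True nca by auto
    \<comment> \<open>Up to this point at most \<open>14 * \<beta>\<close> of the
      \<open>20 * \<beta>\<close> are used; exchanging the partners takes at most six further
      units.\<close>
    have last: "wp (when_prog (?c \<sigma> \<and> ?c \<tau>) (swap_partners \<sigma> \<tau>))
        (\<lambda>_. middle (MF F) (real t + 20 * \<beta>)) (M0\<lparr>dft := d\<rparr>) (t + c)"
      if d: "dft_rep D d A" and c: "real c \<le> 14 * \<beta>" for d c
    proof (cases "?c \<sigma> \<and> ?c \<tau>")
      case True
      \<comment> \<open>\<open>wp_swap_partners\<close> transposes both components. The second one
        is an edge and is fixed, since here only vertices are transposed.\<close>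
      have tr: "(x, y) \<in> pairing F' \<longleftrightarrow> (transpose \<sigma> \<tau> x, transpose \<sigma> \<tau> y) \<in> pairing F" for x y
      proof (cases "is_edge y")
        case y: True
        then have "transpose \<sigma> \<tau> y = y" using v is_edge_not_vertex by (metis transpose_apply_other)
        then show ?thesis
          using pairing_switch_vertices[OF ab, of y x] True swaps pairing_negative sw.pairing_negative
            stable_negative[OF st] by metis
      next
        case False
        moreover have "\<not> is_edge (transpose \<sigma> \<tau> y)" using False v is_edge_not_vertex by (metis transpose_eq_iff)
        ultimately show ?thesis using pairing_fst_vertex sw.pairing_fst_vertex by blast
      qed
      have "wp (swap_partners \<sigma> \<tau>) (\<lambda>_. middle (MF F) (real t + 20 * \<beta>)) (M0\<lparr>dft := d\<rparr>) (t + c)"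
      proof (rule wp_swap_partners[of "set F" "pairing F" _ \<sigma> \<tau> "pairing F'"])
        show "(x, x) \<notin> pairing F" "(\<sigma>, \<tau>) \<notin> pairing F" "(\<tau>, \<sigma>) \<notin> pairing F" for x
          using pairing_fst_vertex v is_edge_not_vertex by blast+
        fix p' c' assume "partner_mem (set F) (pairing F') p'" "c' \<le> (6 :: nat)"
        then show "middle (MF F) (real t + 20 * \<beta>) (M0\<lparr>dft := d\<rparr>\<lparr>partner := p'\<rparr>) (t + c + c')"
          using fin[OF d, of p' "c + c'"] c bound by (simp add: add.assoc)
      qed (use partners pairing_subset tr in simp_all)
      then show ?thesis unfolding wp_when if_P[OF True] .
    next
      case False
      then have "pairing F' = pairing F" using noswap swaps by blast
      then show ?thesis unfolding wp_when if_not_P[OF False] using fin0[OF d, of c] c bound by simp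
    qed
    show ?thesis
      unfolding run_vertices_def
      apply (simp add: n1 n2)
      apply (rule wp_on_dft, simp, rule dft_root[OF dft card_nodes_A n1(2)])
      apply (simp, rule wp_on_dft, simp, rule dft_root[OF _ card_nodes_A n2(2)], assumption)
      apply (simp add: roots True del: wp_when)
      apply (simp, rule wp_on_dft, simp, rule dft_nca[OF _ card_nodes_A n1(2) n2(2) same], assumption)
      apply (simp add: lab_nca e del: wp_when)
      apply (rule wp_late_partner[of _ \<sigma>], simp, simp, simp, rule v)
      apply (simp del: wp_when)
      apply (rule wp_late_partner[of _ \<tau>], simp, simp, simp, rule v)
      subgoal for _ d1 c1 _ d2 c2 _ d3 c3 c4 c5
        using last[of d3 "2 + c1 + c2 + c3 + 2 + c4 + c5"] bound
        by (simp add: algebra_simps numeral_eq_Suc del: wp_when)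
      done
  qed
qed

text \<open>The shape of the stored tree is untouched: \<open>\<tau>\<close> has no handle before
  and takes over the one of \<open>\<sigma>\<close>.\<close>

lemma relabel_tree_mem:
  assumes neg: "negative F \<sigma>" "positive F \<tau>" "in_one_cycle (graph_at F (Suc (Suc k))) \<sigma>"
    and n: "node_of M0 \<sigma> = Some n" "n \<in> nodes A" "lab n = \<sigma>"
  defines "f \<equiv> transpose \<sigma> \<tau>"
  defines "T \<equiv> \<lparr>parent = (\<lambda>x. map_option f (parent (MF F) (f x))), level = (\<lambda>x. level (MF F) (f x))\<rparr>"
  shows "tree_mem (set F) T A ((node_of M0)(\<tau> \<mapsto> n, \<sigma> := None)) (lab(n := \<tau>))"
proof -
  have ntau: "\<not> is_node F \<tau>" using neg(2) is_edge_not_vertex by (auto simp: positive_iff is_node_def)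
  have lab_tau: "lab x \<noteq> \<tau>" if "x \<in> nodes A" for x using rep.lab_nodes[OF that] ntau by auto
  have lab': "(lab(n := \<tau>)) x = f (lab x)" if "x \<in> nodes A" for x
    using n that lab_tau[OF that] rep.lab_inj[OF that n(2)] by (auto simp: f_def)
  have "represents (lab(n := \<tau>)) A T"
  proof (rule represents_relabel[of lab A "MF F" f])
    show "represents lab A (MF F)" using tree by (simp add: tree_mem_def)
    show "inj f" by (simp add: f_def)
    have nodes: "s \<in> nodes T \<longleftrightarrow> f s \<in> nodes (MF F)" for s by (simp add: T_def nodes_def domIff)
    show "nodes T = f ` nodes (MF F)"
      by (rule set_eqI) (simp only: nodes f_def in_transpose_image_iff)
  qed (use lab' in \<open>simp_all add: T_def f_def\<close>)
  moreover have "((node_of M0)(\<tau> \<mapsto> n, \<sigma> := None)) s = Some x \<longleftrightarrow> x \<in> nodes A \<and> (lab(n := \<tau>)) x = s"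
    if s: "s \<in> set F" for s x
  proof -
    have old: "node_of M0 s = Some x \<longleftrightarrow> x \<in> nodes A \<and> lab x = s"
      using tree s by (simp add: tree_mem_def)
    consider "s = \<sigma>" | "s = \<tau>" | "s \<noteq> \<sigma>" "s \<noteq> \<tau>" by blast
    then show ?thesis
    proof cases
      case 1
      have "x \<notin> nodes A \<or> (lab(n := \<tau>)) x \<noteq> \<sigma>"
        using n rep.lab_inj by (metis fun_upd_apply switched_neq(1))
      then show ?thesis using 1 by auto
    next
      case 2
      then show ?thesis using n lab_tau by auto
    next
      case 3
      then show ?thesis using old n by auto
    qed
  qed
  ultimately show ?thesis by (simp add: tree_mem_def)
qed

text \<open>The endpoints of \<open>\<tau>\<close> are connected once \<open>\<sigma>\<close> is
  present, so their bottleneck is at most \<open>k\<close>. It equals \<open>k\<close> exactly if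
  they are not connected before, which by \<open>in_one_cycle_switched\<close> means that
  \<open>\<sigma>\<close> lies on a cycle.\<close>

lemma wp_run_negative_positive:
  assumes neg: "negative F \<sigma>" "positive F \<tau>"
    and T: "update_negative_positive F (Suc k) (MF F, pairing F) = (T, P)"
  shows "wp (run_negative_positive L (Suc k) \<sigma> \<tau>) (\<lambda>_. middle T (real t + 30 * \<beta>)) M0 t"
proof -
  have edge: "is_edge \<sigma>" "is_edge \<tau>" "\<not> negative F \<tau>"
    using neg negative_is_edge by (auto simp: positive_iff)
  have nv: "\<not> (is_vertex \<sigma> \<and> is_vertex \<tau>)" using edge is_edge_not_vertex by blast
  obtain a b where ab: "endpoints M0 \<sigma> = (a, b)" "\<sigma> = {a, b}"
    using endpoints_obtain[OF mem_switched(1)] .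
  obtain c d where cd: "endpoints M0 \<tau> = (c, d)" "\<tau> = {c, d}"
    using endpoints_obtain[OF mem_switched(2)] .
  have neqs: "a \<noteq> b" "c \<noteq> d" using edge ab cd by auto
  have V: "a \<in> verts (set F)" "b \<in> verts (set F)" "c \<in> verts (set F)" "d \<in> verts (set F)"
    using endpoints_verts mem_switched unfolding ab(2) cd(2) by blast+
  have con: "connected_in (graph_at F (Suc k)) c d"
    using neg(2) graphs_switched(3) graph_at_Suc_k unfolding cd(2) by (simp add: positive_doubleton)
  then have con_all: "connected_in (set F) c d" using graph_at_subset connected_in_mono by metis
  then have conW: "connected_in (dom W) c d" by (simp add: msf_facts(2) negatives_connected_all)
  have W: "\<forall>e\<in>dom W. W e = Some (idx F e)" using msf_facts(2,3) by simp
  note le_iff = bottleneck_le_iff_connected[OF msf_facts(2) W con_all neqs(2)]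
  have cycle: "in_one_cycle (graph_at F (Suc (Suc k))) \<sigma> \<longleftrightarrow> \<not> connected_in G c d"
    using in_one_cycle_switched[OF neg cd(2)] .
  have "bottleneck W c d \<le> k" using le_iff[of k] con k by simp
  \<comment> \<open>The case \<open>k = 0\<close> is separate because there is no smaller weight;
    then \<open>G\<close> is empty and connects no two points.\<close>
  moreover have "bottleneck W c d < k \<longleftrightarrow> connected_in G c d"
  proof (cases k)
    case 0
    then show ?thesis using neqs by (auto simp: graph_at_def connected_in_def)
  next
    case (Suc k')
    then show ?thesis using le_iff[of k'] k by (simp add: less_Suc_eq_le)
  qed
  ultimately have test: "bottleneck W c d = k \<longleftrightarrow> in_one_cycle (graph_at F (Suc (Suc k))) \<sigma>"
    using cycle by linarith
  have bot: "performs (\<lambda>l'. lct_rep L l' (verts (set F)) W) (\<lambda>r. r = bottleneck W c d) \<beta>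
      (lct_bottleneck L c d (lct M0))"
    by (rule lct_bottleneck[OF msf_facts(1,4) V(3,4) neqs(2) conW])
  have acW: "acyclic_edges (dom W)" "finite (dom W)" "\<sigma> \<in> dom W"
    unfolding msf_facts(2) using negatives_acyclic negatives_finite neg by auto
  show ?thesis
  proof (cases "in_one_cycle (graph_at F (Suc (Suc k))) \<sigma>")
    case False
    then have TP: "T = MF F" using T by (simp add: update_negative_positive_def Let_def)
    have st: stable using stable_negative_positive neg False by blast
    have eq: "pairing F' = pairing F" using stable_pairing[OF st nv] .
    have last: "wp (reweigh_msf L \<sigma> (Suc k)) (\<lambda>_. middle T (real t + 30 * \<beta>)) (M0\<lparr>lct := l\<rparr>) (t + c1)"
      if l: "lct_rep L l (verts (set F)) W" and c1: "real c1 \<le> 20 * \<beta>" for l c1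
    proof (rule wp_reweigh_msf[of _ "verts (set F)" W \<sigma> a b])
      fix l' c2 assume l': "lct_rep L l' (verts (set F)) (W(\<sigma> \<mapsto> Suc k))" and c2: "real c2 \<le> 2 * \<beta> + 2"
      have "msf_mem L F' l' (W(\<sigma> \<mapsto> Suc k))"
        by (rule msf_memI[OF l']) (use st stable_negative msf_facts(2) neg edge in auto)
      then show "middle T (real t + 30 * \<beta>) (M0\<lparr>lct := l\<rparr>\<lparr>lct := l'\<rparr>) (t + c1 + c2)"
        using eq partners dft tree ptrs c1 c2 bound unfolding TP by (auto simp: middle_def tree_rep_def)
    qed (use l msf_facts(4) ab V acW in simp_all)
    show ?thesis
      unfolding run_negative_positive_def
      apply (simp add: cd(1))
      apply (rule wp_on_lct, rule bot, simp)
      apply (simp add: test False)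
      subgoal for _ l c1
        using last[of l "1 + c1"] bound by simp
      done
  next
    case True
    let ?f = "transpose \<sigma> \<tau>"
    have TP: "T = \<lparr>parent = (\<lambda>x. map_option ?f (parent (MF F) (?f x))), level = (\<lambda>x. level (MF F) (?f x))\<rparr>"
      using T True by (simp add: update_negative_positive_def Let_def)
    obtain n where n: "node_of M0 \<sigma> = Some n" "n \<in> nodes A" "lab n = \<sigma>"
      using node_obtain[OF negative_is_node[OF neg(1)]] .
    have tm: "tree_mem (set F) T A ((node_of M0)(\<tau> \<mapsto> n, \<sigma> := None)) (lab(n := \<tau>))"
      unfolding TP by (rule relabel_tree_mem[OF neg True n])
    have negs': "{e. negative F' e} = insert \<tau> (dom W - {\<sigma>})" "negative F' \<tau>" "\<not> negative F' \<sigma>"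
    proof -
      have nab: "\<not> connected_in G a b" using neg(1) negative_switched_edges(1)[OF ab(2) neqs(1) cd(2) neqs(2)] ab(2) by simp
      have c: "connected_in (insert {a, b} G) c d" using con unfolding graph_at_Suc_k ab(2) .
      have ncd: "\<not> connected_in G c d" using True cycle by simp
      show 1: "negative F' \<tau>" using ncd negative_switched_edges(3)[OF ab(2) neqs(1) cd(2) neqs(2)] cd(2) by simp
      have "connected_in (insert {c, d} G) a b"
        using c ncd unfolding connected_in_insert by (metis connected_in_sym)
      then show 2: "\<not> negative F' \<sigma>"
        using negative_switched_edges(4)[OF ab(2) neqs(1) cd(2) neqs(2)] ab(2) by simp
      have "negative F' e \<longleftrightarrow> e = \<tau> \<or> negative F e \<and> e \<noteq> \<sigma>" for e
        using 1 2 edge(3) other_negative[of e] negative_in_set[of e] sw.negative_in_set[of e]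
        by (metis set_switch)
      then show "{e. negative F' e} = insert \<tau> (dom W - {\<sigma>})" unfolding msf_facts(2) by blast
    qed
    \<comment> \<open>The forest left by the cut is the new spanning forest without
      \<open>\<tau>\<close>, and in the new one \<open>\<tau>\<close> is a bridge.\<close>
    have nconn: "\<not> connected_in (dom W - {\<sigma>}) c d"
    proof -
      have "\<not> connected_in ({e. negative F' e} - {{c, d}}) c d"
        by (rule acyclic_edges_bridge[OF sw.negatives_acyclic]) (use negs'(2) cd(2) in simp)
      moreover have "{e. negative F' e} - {{c, d}} = dom W - {\<sigma>}"
        using edge(3) unfolding negs'(1) cd(2)[symmetric] msf_facts(2) by blast
      ultimately show ?thesis by simp
    qed
    have tr: "(x, y) \<in> pairing F' \<longleftrightarrow> (?f x, ?f y) \<in> pairing F" for x y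
    proof (cases "is_vertex x")
      case x: True
      then have "?f x = x" using edge is_edge_not_vertex by (metis transpose_apply_other)
      then show ?thesis using relabel_pairing[OF neg True] by metis
    next
      case False
      moreover have "\<not> is_vertex (?f x)" using False edge is_edge_not_vertex by (metis transpose_eq_iff)
      ultimately show ?thesis using pairing_fst_vertex sw.pairing_fst_vertex by blast
    qed
    let ?M1 = "\<lambda>l. M0\<lparr>lct := l, simplex_of := lab(n := \<tau>), node_of := (node_of M0)(\<tau> \<mapsto> n, \<sigma> := None)\<rparr>"
    have msf_part: "wp (cut_msf L \<sigma>) (\<lambda>_. wp (link_msf L \<tau> k) (\<lambda>_. middle T (real t + 30 * \<beta>)))
        ((?M1 l)\<lparr>partner := p\<rparr>) (t + c1)"
      if l: "lct_rep L l (verts (set F)) W" and p: "partner_mem (set F) (pairing F') p"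
        and c1: "real c1 \<le> 20 * \<beta>" for l p c1
    proof (rule wp_cut_msf[of _ "verts (set F)" W \<sigma> a b])
      fix l1 c2 assume l1: "lct_rep L l1 (verts (set F)) (W(\<sigma> := None))" and c2: "real c2 \<le> \<beta> + 1"
      have dom1: "dom (W(\<sigma> := None)) = dom W - {\<sigma>}" by auto
      show "wp (link_msf L \<tau> k) (\<lambda>_. middle T (real t + 30 * \<beta>))
        ((?M1 l)\<lparr>partner := p\<rparr>\<lparr>lct := l1\<rparr>) (t + c1 + c2)"
      proof (rule wp_link_msf[of _ "verts (set F)" "W(\<sigma> := None)" \<tau> c d])
        show "card (verts (set F)) + card (dom (W(\<sigma> := None))) \<le> length F"
          unfolding dom1 using msf_facts(4) card_Diff1_le[of "dom W" \<sigma>] by linarith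
        show "\<not> connected_in (dom (W(\<sigma> := None))) c d" unfolding dom1 by (rule nconn)
        fix l2 c3 assume l2: "lct_rep L l2 (verts (set F)) (W(\<sigma> := None, \<tau> \<mapsto> k))" and c3: "real c3 \<le> \<beta> + 1"
        have "msf_mem L F' l2 (W(\<sigma> := None, \<tau> \<mapsto> k))"
          by (rule msf_memI[OF l2]) (use negs' in auto)
        then show "middle T (real t + 30 * \<beta>) ((?M1 l)\<lparr>partner := p\<rparr>\<lparr>lct := l1\<rparr>\<lparr>lct := l2\<rparr>) (t + c1 + c2 + c3)"
          using p dft tm ptrs c1 c2 c3 bound by (auto simp: middle_def tree_rep_def)
      qed (use l1 cd V in simp_all)
    qed (use l msf_facts(4) ab V acW in simp_all)
    have last: "wp (swap_partners \<sigma> \<tau>) (\<lambda>_. wp (cut_msf L \<sigma>) (\<lambda>_. wp (link_msf L \<tau> k)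
        (\<lambda>_. middle T (real t + 30 * \<beta>)))) (?M1 l) (t + c1)"
      if l: "lct_rep L l (verts (set F)) W" and c1: "real c1 \<le> 14 * \<beta>" for l c1
    proof (rule wp_swap_partners[of "set F" "pairing F" _ \<sigma> \<tau> "pairing F'"])
      show "(x, x) \<notin> pairing F" "(\<sigma>, \<tau>) \<notin> pairing F" "(\<tau>, \<sigma>) \<notin> pairing F" for x
        using pairing_fst_vertex edge is_edge_not_vertex by blast+
      fix p c' assume "partner_mem (set F) (pairing F') p" "c' \<le> (6 :: nat)"
      then show "wp (cut_msf L \<sigma>) (\<lambda>_. wp (link_msf L \<tau> k) (\<lambda>_. middle T (real t + 30 * \<beta>)))
          ((?M1 l)\<lparr>partner := p\<rparr>) (t + c1 + c')"
        using msf_part[OF l, of p "c1 + c'"] c1 bound by (simp add: add.assoc)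
    qed (use partners pairing_subset tr in simp_all)
    show ?thesis
      unfolding run_negative_positive_def
      apply (simp add: cd(1))
      apply (rule wp_on_lct, rule bot, simp)
      apply (simp add: test True n)
      subgoal for _ l c1
        using last[of l "c1 + 5"] bound by (simp add: numeral_eq_Suc algebra_simps wp_bind_fun)
      done
  qed
qed

end


section \<open>The rotation in memory\<close>

lemma (in stored_switch) wp_reweigh_both:
  assumes neg: "negative F \<sigma>" "negative F \<tau>"
    and Q: "\<And>l c. lct_rep L l (verts (set F)) (W(\<sigma> \<mapsto> Suc k, \<tau> \<mapsto> k)) \<Longrightarrow> real c \<le> 8 * \<beta> \<Longrightarrow>
      Q () (M0\<lparr>lct := l\<rparr>) (t + c)"
  shows "wp (reweigh_msf L \<sigma> (Suc k)) (\<lambda>_. wp (reweigh_msf L \<tau> k) Q) M0 t"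
proof -
  let ?V = "verts (set F)"
  obtain s s' where s: "endpoints M0 \<sigma> = (s, s')" "\<sigma> = {s, s'}" using endpoints_obtain[OF mem_switched(1)] .
  obtain v v' where v: "endpoints M0 \<tau> = (v, v')" "\<tau> = {v, v'}" using endpoints_obtain[OF mem_switched(2)] .
  have dom: "\<sigma> \<in> dom W" "\<tau> \<in> dom W" "acyclic_edges (dom W)" "finite (dom W)"
    unfolding msf_facts(2) using neg negatives_acyclic negatives_finite by auto
  have V: "s \<in> ?V" "s' \<in> ?V" "v \<in> ?V" "v' \<in> ?V"
    using endpoints_verts mem_switched unfolding s(2) v(2) by blast+
  show ?thesis
  proof (rule wp_reweigh_msf[OF msf_facts(1,4) s V(1,2) dom(1,3,4)])
    fix l c1 assume l: "lct_rep L l ?V (W(\<sigma> \<mapsto> Suc k))" and c1: "real c1 \<le> 2 * \<beta> + 2"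
    have dom': "dom (W(\<sigma> \<mapsto> Suc k)) = dom W" using dom(1) by auto
    show "wp (reweigh_msf L \<tau> k) Q (M0\<lparr>lct := l\<rparr>) (t + c1)"
    proof (rule wp_reweigh_msf[of _ ?V "W(\<sigma> \<mapsto> Suc k)" \<tau> v v'])
      fix l2 c2 assume "lct_rep L l2 ?V (W(\<sigma> \<mapsto> Suc k, \<tau> \<mapsto> k))" "real c2 \<le> 2 * \<beta> + 2"
      then show "Q () (M0\<lparr>lct := l\<rparr>\<lparr>lct := l2\<rparr>) (t + c1 + c2)"
        using Q[of l2 "c1 + c2"] c1 bound by (simp add: add.assoc)
    qed (use l v V dom msf_facts(4) dom' in simp_all)
  qed
qed

locale stored_rotation =
  stored_switch F k D L \<beta> M0 A W + graph_rotation F k a b c d ra rb rd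
  for F :: "'v simplex list" and k and D :: "('n, 'd) dft_ops" and L :: "('v, 'l) lct_ops" and \<beta>
    and M0 :: "('v, 'n, 'd, 'l) memory" and A :: "'n forest" and W :: "'v simplex \<rightharpoonup> nat"
    and a b c d ra rb rd +
  fixes n1 n2 na nb nd :: 'n
  assumes handles: "n1 \<in> nodes A" "n2 \<in> nodes A" "na \<in> nodes A" "nb \<in> nodes A" "nd \<in> nodes A"
    and labels: "lab n1 = \<sigma>" "lab n2 = \<tau>" "lab na = ra" "lab nb = rb" "lab nd = rd"
begin

lemma handles_distinct:
  "n1 \<noteq> n2" "na \<noteq> n1" "na \<noteq> n2" "na \<noteq> nb" "nd \<noteq> n1" "nd \<noteq> n2" "nb \<noteq> n1" "nb \<noteq> n2" "na \<noteq> nd" "nb \<noteq> nd"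
  using labels nodes_distinct switched_neq by (metis insertCI)+

lemma parent_n1: "parent A y = Some n1 \<longleftrightarrow> y = na \<or> y = nb"
proof
  assume y: "parent A y = Some n1"
  then have "y \<in> nodes A" using rep.parent_nodes by blast
  then have "is_parent F {a, b} (lab y)"
    using y rep.parent_iff handles labels parent_MF e by metis
  then show "y = na \<or> y = nb" using children_F(1) rep.lab_inj handles labels \<open>y \<in> nodes A\<close> by metis
next
  assume "y = na \<or> y = nb"
  then have "y \<in> nodes A" "is_parent F \<sigma> (lab y)" using handles labels children_F(1) e by auto
  then show "parent A y = Some n1" using rep.parent_iff handles labels parent_MF by metis
qed

lemma parent_n2: "parent A y = Some n2 \<longleftrightarrow> y = n1 \<or> y = nd"
proof
  assume y: "parent A y = Some n2"
  then have "y \<in> nodes A" using rep.parent_nodes by blast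
  then have "is_parent F {c, d} (lab y)"
    using y rep.parent_iff handles labels parent_MF e by metis
  then show "y = n1 \<or> y = nd" using children_F(2) rep.lab_inj handles labels \<open>y \<in> nodes A\<close> e by metis
next
  assume "y = n1 \<or> y = nd"
  then have "y \<in> nodes A" "is_parent F \<tau> (lab y)" using handles labels children_F(2) e by auto
  then show "parent A y = Some n2" using rep.parent_iff handles labels parent_MF by metis
qed

abbreviation "q \<equiv> parent A n2"
abbreviation "A' \<equiv> A\<lparr>parent := (parent A)(na \<mapsto> n2, n2 \<mapsto> n1, n1 := q)\<rparr>"

text \<open>Indices grow towards the root: everything above \<open>n2\<close> is younger than
  \<open>\<tau>\<close>, whereas the three nodes in question have at most the index of
  \<open>\<tau>\<close>.\<close>

lemma above:
  assumes "q = Some p" "ancestor A y p" shows "y \<noteq> n1 \<and> y \<noteq> n2 \<and> y \<noteq> na"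
proof -
  have p: "p \<in> nodes A" using assms(1) rep.parent_nodes by blast
  then have y: "y \<in> nodes A" using assms(2) rep.ancestor_node by blast
  have nodes': "is_node F (lab p)" "is_node F (lab y)" using p y rep.lab_nodes by auto
  have "parent (MF F) \<tau> = Some (lab p)" using assms(1) rep.parent_lab handles(2) labels(2) by fastforce
  then have "is_parent F (lab p) \<tau>" by (simp add: parent_MF)
  then have "idx F \<tau> < idx F (lab p)" by (rule is_parent_idx_less)
  moreover have "idx F (lab p) \<le> idx F (lab y)"
  proof -
    have "ancestor (MF F) (lab y) (lab p)" using assms(2) rep.ancestor_iff p y by blast
    then have "node_comp F (lab p) \<subseteq> node_comp F (lab y)" using ancestor_MF nodes' by blast
    then show ?thesis
      using node_comp_subset_idx[OF nodes'(2,1)] subset_node_comp[OF node_in_set[OF nodes'(1)]] by blast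
  qed
  moreover have "is_parent F \<sigma> ra" using children_F(1)[of ra] e by simp
  then have "idx F ra < idx F \<sigma>" by (rule is_parent_idx_less)
  ultimately show ?thesis using labels by auto
qed

lemma children_A':
  "children A' n1 = {n2, nb}" "children A' n2 = {na, nd}"
  "x \<noteq> n1 \<Longrightarrow> x \<noteq> n2 \<Longrightarrow> q \<noteq> Some x \<Longrightarrow> children A' x = children A x"
  "q = Some p \<Longrightarrow> children A' p = insert n1 (children A p - {n2})"
proof -
  have qn: "q \<noteq> Some n1" "q \<noteq> Some n2" using above[of n1 n1] above[of n2 n2] by auto
  have eq: "children A' x = {y. if y = n1 then q = Some x else if y = n2 then x = n1
      else if y = na then x = n2 else parent A y = Some x}" for x
    by (auto simp: children_def)
  show "children A' n1 = {n2, nb}" "children A' n2 = {na, nd}"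
    unfolding eq parent_n1 parent_n2 using handles_distinct qn by auto
  have pa: "parent A n1 = Some n2" "parent A na = Some n1" using parent_n1 parent_n2 by auto
  show "children A' x = children A x" if "x \<noteq> n1" "x \<noteq> n2" "q \<noteq> Some x"
    unfolding eq using that pa by (auto simp: children_def)
  assume q: "q = Some p"
  then have "p \<noteq> n1" "p \<noteq> n2" using qn by auto
  then show "children A' p = insert n1 (children A p - {n2})"
    unfolding eq using q pa by (auto simp: children_def)
qed

lemma represents_rotated: "represents lab A' rotated"
  unfolding represents_def
proof (intro conjI allI ballI impI)
  have "nodes rotated = nodes (MF F)" by (simp add: rotated_def)
  then show "bij_betw lab (nodes A') (nodes rotated)"
    using rep.represents by (simp add: represents_def)
  fix n p
  assume n: "parent A' n = Some p"
  then show "n \<in> nodes A'" "p \<in> nodes A'"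
    using handles rep.parent_nodes by (auto split: if_splits)
next
  fix n assume "n \<in> nodes A'"
  then have n: "n \<in> nodes A" by simp
  consider "n = na" | "n = nb" | "n = nd" | "n = n1" | "n = n2"
    | "n \<noteq> na" "n \<noteq> nb" "n \<noteq> nd" "n \<noteq> n1" "n \<noteq> n2" by blast
  then show "map_option lab (parent A' n) = parent rotated (lab n)"
  proof cases
    case 1
    then show ?thesis using handles_distinct labels nodes_distinct by (simp add: rotated_def)
  next
    case 2
    then show ?thesis using handles_distinct labels nodes_distinct parent_n1[of nb] by (simp add: rotated_def)
  next
    case 3
    then show ?thesis using handles_distinct labels nodes_distinct parent_n2[of nd] by (simp add: rotated_def)
  next
    case 4
    then show ?thesis using handles_distinct labels rep.parent_lab[OF handles(2)] by (simp add: rotated_def)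
  next
    case 5
    then show ?thesis using handles_distinct labels nodes_distinct(4)[of rb] by (simp add: rotated_def)
  next
    case 6
    then have "lab n \<noteq> ra" "lab n \<noteq> rb" "lab n \<noteq> rd" "lab n \<noteq> \<sigma>" "lab n \<noteq> \<tau>"
      using rep.lab_inj[OF n] handles labels by metis+
    then show ?thesis using 6 rep.parent_lab[OF n] by (simp add: rotated_def)
  qed
next
  fix n assume leaf: "is_leaf A' n"
  have "n \<noteq> n1" "n \<noteq> n2" using leaf children_A'(1,2) by (auto simp: is_leaf_def)
  moreover have "q \<noteq> Some n" using leaf children_A'(4) by (auto simp: is_leaf_def)
  ultimately have "is_leaf A n" using leaf children_A'(3) by (simp add: is_leaf_def)
  then show "level A' n = level rotated (lab n)" using rep.level_leaf by (simp add: rotated_def)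
qed

abbreviation "pp \<equiv> (parent_ptr M0)(na \<mapsto> n2, n2 \<mapsto> n1, n1 := q)"
abbreviation "cp \<equiv> (case q of None \<Rightarrow> child_ptrs M0
    | Some p \<Rightarrow> (case the (child_ptrs M0 p) of (x, y) \<Rightarrow>
        (child_ptrs M0)(p \<mapsto> if x = n2 then (n1, y) else (x, n1))))(n2 \<mapsto> (na, nd), n1 \<mapsto> (n2, nb))"

lemma ptrs_rotated: "ptrs_mem A' pp cp"
  unfolding ptrs_mem_def
proof (intro ballI conjI)
  fix n assume "n \<in> nodes A'"
  then have n: "n \<in> nodes A" by simp
  have old: "parent_ptr M0 n = parent A n"
    "case child_ptrs M0 n of None \<Rightarrow> children A n = {} | Some (x, y) \<Rightarrow> x \<noteq> y \<and> children A n = {x, y}"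
    using ptrs n by (simp_all add: ptrs_mem_def)
  show "pp n = parent A' n" using old(1) by simp
  consider "n = n1" | "n = n2" | "n \<noteq> n1" "n \<noteq> n2" "q = Some n" | "n \<noteq> n1" "n \<noteq> n2" "q \<noteq> Some n" by blast
  then show "case cp n of None \<Rightarrow> children A' n = {} | Some (x, y) \<Rightarrow> x \<noteq> y \<and> children A' n = {x, y}"
  proof cases
    case 1
    then show ?thesis using children_A'(1) handles_distinct by simp
  next
    case 2
    then show ?thesis using children_A'(2) handles_distinct by simp
  next
    case 3
    have n2: "n2 \<in> children A n" using 3(3) by (simp add: children_def)
    then obtain x y where xy: "child_ptrs M0 n = Some (x, y)" "x \<noteq> y" "children A n = {x, y}"
      using old(2) by (auto split: option.splits)
    have "n1 \<notin> children A n" using parent_n2[of n1] 3(2) by (simp add: children_def)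
    moreover have "cp n = Some (if x = n2 then (n1, y) else (x, n1))" using 3 xy by simp
    ultimately show ?thesis using children_A'(4)[OF 3(3)] xy n2 by auto
  next
    case 4
    then have cp: "cp n = child_ptrs M0 n" by (cases q) (auto split: prod.splits)
    show ?thesis unfolding cp children_A'(3)[OF 4] by (rule old(2))
  qed
qed

lemma wp_rotate:
  fixes M :: "('v, 'n, 'd, 'l) memory"
  assumes M: "dft_rep D (dft M) A" "parent_ptr M = parent_ptr M0" "child_ptrs M = child_ptrs M0"
    and Q: "\<And>d c. dft_rep D d A' \<Longrightarrow> real c \<le> 18 * \<beta> \<Longrightarrow>
      Q () (M\<lparr>dft := d, parent_ptr := pp, child_ptrs := cp\<rparr>) (t + c)"
  shows "wp (rotate_nodes D n1 n2 na nb nd) Q M t"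
proof -
  obtain r where r: "ancestor (MF F) r \<tau>" "parent (MF F) r = None" "is_node F r"
    using root_of_MF[of \<tau>] rep.lab_nodes[OF handles(2)] labels(2) by auto
  note root = rep.root_of_lab[OF handles(2), of r]
  show ?thesis
  proof (rule wp_rotate_nodes[OF M(1) card_nodes_A])
    show "parent A n = Some p \<Longrightarrow> n \<in> nodes A \<and> p \<in> nodes A" for n p by (rule rep.parent_nodes)
    show "parent A n1 = Some n2" "parent A na = Some n1" using parent_n1 parent_n2 by auto
    show "n1 \<noteq> n2" "na \<noteq> n1" "na \<noteq> n2" by (rule handles_distinct)+
    show "parent_ptr M n2 = q" using M(2) ptrs handles by (simp add: ptrs_mem_def)
    show "ancestor A (root_of A n2) n2" "parent A (root_of A n2) = None"
      using root r labels by auto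
    show "q = Some p \<Longrightarrow> ancestor A y p \<Longrightarrow> y \<noteq> n1 \<and> y \<noteq> n2 \<and> y \<noteq> na" for p y
      by (rule above)
    fix d and c :: nat assume "dft_rep D d A'" "real c \<le> 18 * \<beta>"
    then show "Q () (M\<lparr>dft := d, parent_ptr := (parent_ptr M)(na \<mapsto> n2, n2 \<mapsto> n1, n1 := q),
        child_ptrs := (case q of None \<Rightarrow> child_ptrs M
          | Some p \<Rightarrow> (case the (child_ptrs M p) of (a, b) \<Rightarrow>
              (child_ptrs M)(p \<mapsto> if a = n2 then (n1, b) else (a, n1))))
          (n2 \<mapsto> (na, nd), n1 \<mapsto> (n2, nb))\<rparr>) (t + c)"
      using Q[of d c] unfolding M(2,3) by simp
  qed
qed

lemma tree_mem_rotated: "tree_mem (set F) rotated A' (node_of M0) lab"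
  using represents_rotated tree by (simp add: tree_mem_def)

abbreviation "W2 \<equiv> W(\<sigma> \<mapsto> Suc k, \<tau> \<mapsto> k)"

lemma negatives_unchanged: "negative F' s \<longleftrightarrow> negative F s"
  using negatives other_negative[of s] negative_in_set[of s] sw.negative_in_set[of s] set_switch
  unfolding e by metis

lemma dom_W2: "dom W2 = {e. negative F' e}"
  using negatives_unchanged negatives msf_facts(2) unfolding e by auto

lemma msf_mem_W2: "lct_rep L l (verts (set F)) W2 \<Longrightarrow> msf_mem L F' l W2"
  by (rule msf_memI) (use dom_W2 in auto)

text \<open>The sub-case in which \<open>\<tau>\<close> directly connects \<open>C1\<close> and
  \<open>C3\<close>: the child touched by \<open>\<tau>\<close> is the one with the younger lowest
  leaf, so \<open>Ca\<close> is \<open>C1\<close>.\<close>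

abbreviation (input) "younger_a \<equiv> idx F (oldest F Cb) < idx F (oldest F Ca)"

text \<open>Both branches perform the same rotation around \<open>na\<close>. They differ only in
  whether partners may have to be exchanged.\<close>

lemma wp_finish:
  assumes l: "lct_rep L l (verts (set F)) W2" and d: "dft_rep D d' A" and c1: "real c1 \<le> 30 * \<beta>"
    and M: "M = M0\<lparr>dft := d', lct := l\<rparr>"
  shows "wp (if younger_a then State_Monad.bind (rotate_nodes D n1 n2 na nb nd)
        (\<lambda>_. when_prog (idx F (oldest F Cd) < idx F (oldest F Ca)) (swap_partners \<sigma> \<tau>))
      else rotate_nodes D n1 n2 na nb nd) (\<lambda>_. middle rotated (real t + 60 * \<beta>)) M (t + c1)"
proof -
  let ?swap = "younger_a \<and> idx F (oldest F Cd) < idx F (oldest F Ca)"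
  have edge: "is_edge \<sigma>" "is_edge \<tau>" using neq unfolding e by simp_all
  have fin: "middle rotated (real t + 60 * \<beta>)
      (M\<lparr>dft := d2, parent_ptr := pp, child_ptrs := cp, partner := p\<rparr>) (t + c2)"
    if "dft_rep D d2 A'" "partner_mem (set F) (pairing F') p" "real c2 \<le> 60 * \<beta>" for d2 p c2
    using that tree_mem_rotated ptrs_rotated msf_mem_W2[OF l] unfolding M
    by (auto simp: middle_def tree_rep_def)
  have rot: "wp (rotate_nodes D n1 n2 na nb nd) Q M (t + c1)"
    if "\<And>d2 c2. dft_rep D d2 A' \<Longrightarrow> real c2 \<le> 18 * \<beta> \<Longrightarrow>
      Q () (M\<lparr>dft := d2, parent_ptr := pp, child_ptrs := cp\<rparr>) (t + c1 + c2)" for Q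
    by (rule wp_rotate) (use that d M in simp_all)
  have noswap: "wp (rotate_nodes D n1 n2 na nb nd) (\<lambda>_. middle rotated (real t + 60 * \<beta>)) M (t + c1)"
    if "\<not> ?swap"
  proof (rule rot)
    fix d2 c2 assume d2: "dft_rep D d2 A'" and c2: "real c2 \<le> 18 * \<beta>"
    have "pairing F' = pairing F" using pairing_swap that by auto
    then show "middle rotated (real t + 60 * \<beta>) (M\<lparr>dft := d2, parent_ptr := pp, child_ptrs := cp\<rparr>) (t + c1 + c2)"
      using fin[OF d2, of "partner M0" "c1 + c2"] partners c1 c2 bound unfolding M by (simp add: add.assoc)
  qed
  show ?thesis
  proof (cases ?swap)
    case True
    have pair: "pairing F' = (\<lambda>(v, h). (v, transpose \<sigma> \<tau> h)) ` pairing F"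
      using pairing_swap True by simp
    have tr: "(x, y) \<in> pairing F' \<longleftrightarrow> (transpose \<sigma> \<tau> x, transpose \<sigma> \<tau> y) \<in> pairing F" for x y
    proof (cases "is_vertex x")
      case x: True
      then have "transpose \<sigma> \<tau> x = x" using edge is_edge_not_vertex by (metis transpose_apply_other)
      then show ?thesis unfolding pair by (force simp: image_iff)
    next
      case False
      moreover have "\<not> is_vertex (transpose \<sigma> \<tau> x)" using False edge is_edge_not_vertex by (metis transpose_eq_iff)
      ultimately show ?thesis using pairing_fst_vertex sw.pairing_fst_vertex by blast
    qed
    have "wp (rotate_nodes D n1 n2 na nb nd)
        (\<lambda>_. wp (swap_partners \<sigma> \<tau>) (\<lambda>_. middle rotated (real t + 60 * \<beta>))) M (t + c1)"
    proof (rule rot)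
      fix d2 c2 assume d2: "dft_rep D d2 A'" and c2: "real c2 \<le> 18 * \<beta>"
      show "wp (swap_partners \<sigma> \<tau>) (\<lambda>_. middle rotated (real t + 60 * \<beta>))
          (M\<lparr>dft := d2, parent_ptr := pp, child_ptrs := cp\<rparr>) (t + c1 + c2)"
      proof (rule wp_swap_partners[of "set F" "pairing F" _ \<sigma> \<tau> "pairing F'"])
        show "(x, x) \<notin> pairing F" "(\<sigma>, \<tau>) \<notin> pairing F" "(\<tau>, \<sigma>) \<notin> pairing F" for x
          using pairing_fst_vertex edge is_edge_not_vertex by blast+
        show "partner_mem (set F) (pairing F) (partner (M\<lparr>dft := d2, parent_ptr := pp, child_ptrs := cp\<rparr>))"
          using partners unfolding M by simp
        fix p c' assume "partner_mem (set F) (pairing F') p" "c' \<le> (6 :: nat)"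
        then show "middle rotated (real t + 60 * \<beta>)
            (M\<lparr>dft := d2, parent_ptr := pp, child_ptrs := cp\<rparr>\<lparr>partner := p\<rparr>) (t + c1 + c2 + c')"
          using fin[OF d2, of p "c1 + c2 + c'"] c1 c2 bound by (simp add: add.assoc)
      qed (use pairing_subset tr in simp_all)
    qed
    then show ?thesis using True by (simp add: wp_bind_fun when_prog_def)
  next
    case False
    then show ?thesis using noswap[OF False] by (simp add: wp_bind_fun when_prog_def)
  qed
qed

lemma wp_run_rotation:
  "wp (run_negatives D L (Suc k) \<sigma> \<tau>) (\<lambda>_. middle rotated (real t + 60 * \<beta>)) M0 t"
proof -
  let ?V = "verts (set F)"
  have no: "node_of M0 \<sigma> = Some n1" "node_of M0 \<tau> = Some n2"
    using tree handles labels by (simp_all add: tree_mem_def)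
  have pp1: "parent_ptr M0 n1 = Some n2" using ptrs handles parent_n2[of n1] by (simp add: ptrs_mem_def)
  have ch: "children A n1 = {na, nb}" "children A n2 = {n1, nd}"
    by (auto simp: children_def parent_n1 parent_n2)
  obtain x1 y1 where xy1: "child_ptrs M0 n1 = Some (x1, y1)" "x1 = na \<and> y1 = nb \<or> x1 = nb \<and> y1 = na"
    using ptrs handles(1) ch(1) by (auto simp: ptrs_mem_def doubleton_eq_iff split: option.splits)
  obtain x2 y2 where xy2: "child_ptrs M0 n2 = Some (x2, y2)" "x2 = n1 \<and> y2 = nd \<or> x2 = nd \<and> y2 = n1"
    using ptrs handles(2) ch(2) by (auto simp: ptrs_mem_def doubleton_eq_iff split: option.splits)
  have r3: "(if x2 = n1 then y2 else x2) = nd" using xy2(2) handles_distinct by auto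
  have xyA: "x1 \<in> nodes A" "y1 \<in> nodes A" using xy1(2) handles by auto
  obtain pa where pa: "oldest F Ca = {pa}" "pa \<in> Ca" "{pa} \<in> set F"
    using oldest_component_obtain[of a] by (metis insertI1)
  obtain pb where pb: "oldest F Cb = {pb}" "pb \<in> Cb" "{pb} \<in> set F"
    using oldest_component_obtain[of b] by (metis insertCI)
  obtain pd where pd: "oldest F Cd = {pd}" "pd \<in> Cd" "{pd} \<in> set F"
    using oldest_component_obtain[of d] by (metis insertCI)
  have low: "lab l = oldest F (node_comp F (lab n))" if "is_lowest_leaf A n l" "n \<in> nodes A" for n l
    using rep.is_lowest_leaf_lab[OF that(2,1)] is_lowest_leaf_MF rep.lab_nodes[OF that(2)] by simp
  have lowd: "lab l = {pd}" if "is_lowest_leaf A nd l" for l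
    using low[OF that handles(5)] labels comps pd by simp
  have ep: "endpoints M0 {v} = (v, v)" if "{v} \<in> set F" for v
    using endpoints_obtain[OF that] by (metis insertI1 insertI2 singletonD)
  define u where "u = (if younger_a then pa else pb)"
  have u: "u = (if idx F {pb} < idx F {pa} then pa else pb)" "{u} \<in> set F"
    using pa pb by (simp_all add: u_def)
  \<comment> \<open>The child pointers may list the two children in either order. Comparing the
    indices of the lowest leaves removes this ambiguity, so \<open>choice\<close> depends only on
    \<open>younger_a\<close>.\<close>
  obtain s1 s2 where s1: "\<And>l. is_lowest_leaf A x1 l \<Longrightarrow> lab l = s1" "s1 \<in> set F"
    and s2: "\<And>l. is_lowest_leaf A y1 l \<Longrightarrow> lab l = s2" "s2 \<in> set F"
    and choice: "(if idx F s1 < idx F s2 then (y1, x1, s2, idx F s2) else (x1, y1, s1, idx F s1)) =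
      (if younger_a then (na, nb, {u}, idx F {u}) else (nb, na, {u}, idx F {u}))"
  proof (cases "x1 = na")
    case True
    then have "y1 = nb" using xy1(2) handles_distinct by auto
    then show ?thesis
      by (intro that[of "{pa}" "{pb}"])
        (use True low handles labels comps pa pb oldest_neq u in \<open>auto simp: not_less\<close>)
  next
    case False
    then have "x1 = nb" "y1 = na" using xy1(2) by auto
    then show ?thesis
      by (intro that[of "{pb}" "{pa}"])
        (use low handles labels comps pa pb oldest_neq u in \<open>auto simp: not_less\<close>)
  qed
  have dW: "dom W = {e. negative F e}" by (rule msf_facts(2))
  have conn_all: "connected_in (set F) x y" if "x \<in> Ca \<union> Cb \<union> Cd" "y \<in> Ca \<union> Cb \<union> Cd" for x y
  proof -
    have "component (graph_at F (Suc (idx F \<tau>))) c = Ca \<union> Cb \<union> Cd"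
      using node_comp_switched(2) node_comp_eq[of \<tau> c] mem_switched(2) e by auto
    then have "connected_in (graph_at F (Suc (idx F \<tau>))) x y"
      using that by (metis connected_in_sym connected_in_trans mem_component)
    then show ?thesis using graph_at_subset connected_in_mono by metis
  qed
  have uC: "u \<in> Ca \<union> Cb \<union> Cd" "pd \<in> Ca \<union> Cb \<union> Cd" "u \<noteq> pd"
    using pa pb pd disjoint by (auto simp: u_def)
  have V: "u \<in> ?V" "pd \<in> ?V" using u(2) pd(3) by (simp_all add: verts_def)
  have W2: "\<forall>e\<in>dom W2. W2 e = Some (idx F' e)"
    using msf_mem_W2 dom_W2 msf_facts(3) idx_other negatives_unchanged negative_in_set by auto
  \<comment> \<open>With the new weights the query concerns \<open>F'\<close>, where the graph with
    number \<open>Suc k\<close> is \<open>G\<close> with \<open>\<tau>\<close> alone. There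
    \<open>pd\<close> is connected to the vertices of \<open>Ca\<close> but not to those of
    \<open>Cb\<close>.\<close>
  have "bottleneck W2 u pd \<le> k \<longleftrightarrow> connected_in (graph_at F' (Suc k)) u pd"
    using sw.bottleneck_le_iff_connected[OF dom_W2 W2, of u pd k] conn_all[OF uC(1,2)] uC(3) k by simp
  also have "\<dots> \<longleftrightarrow> younger_a"
  proof -
    have G': "graph_at F' (Suc k) = insert {c, d} G" using graph_at_switch_Suc_k unfolding e .
    show ?thesis
    proof (cases younger_a)
      case True
      then have "u \<in> component (insert {c, d} G) a" "pd \<in> component (insert {c, d} G) a"
        unfolding comps_F' using pa pd by (auto simp: u_def)
      then show ?thesis unfolding G' using True
        by (metis connected_in_sym connected_in_trans mem_component)
    next
      case False
      then have "u \<in> component (insert {c, d} G) b" "pd \<notin> component (insert {c, d} G) b"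
        unfolding comps_F' using pb pd disjoint by (auto simp: u_def)
      then show ?thesis unfolding G' using False
        by (metis connected_in_trans mem_component)
    qed
  qed
  finally have test: "bottleneck W2 u pd \<le> k \<longleftrightarrow> younger_a" .
  have card2: "card ?V + card (dom W2) \<le> length F"
    using msf_facts(4) dom_W2 negatives_unchanged dW by simp
  have bot: "performs (\<lambda>l'. lct_rep L l' ?V W2) (\<lambda>r. r = bottleneck W2 u pd) \<beta> (lct_bottleneck L u pd l)"
    if "lct_rep L l ?V W2" for l
  proof (rule lct_bottleneck[OF that card2 V uC(3)])
    show "connected_in (dom W2) u pd"
      unfolding dom_W2 sw.negatives_connected_all using conn_all[OF uC(1,2)] by simp
  qed
  \<comment> \<open>The program after the two changes of weights, isolated so that it can serve as
    the postcondition of \<open>wp_reweigh_both\<close>.\<close>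
  define rest :: "('v, 'n, 'd, 'l, unit) prog" where "rest = do {
       n1 \<leftarrow> get_node \<sigma>;
       n2 \<leftarrow> get_node \<tau>;
       p \<leftarrow> look parent_ptr n1;
       when_prog (p = Some n2) (do {
         ab \<leftarrow> look child_ptrs n1;
         cd \<leftarrow> look child_ptrs n2;
         let (a, b) = the ab;
         let r3 = (if fst (the cd) = n1 then snd (the cd) else fst (the cd));
         la \<leftarrow> on_dft (dft_lowest_leaf D a);
         lb \<leftarrow> on_dft (dft_lowest_leaf D b);
         lw \<leftarrow> on_dft (dft_lowest_leaf D r3);
         sa \<leftarrow> look simplex_of la;
         sb \<leftarrow> look simplex_of lb;
         w \<leftarrow> look simplex_of lw;
         ia \<leftarrow> look index_of sa;
         ib \<leftarrow> look index_of sb;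
         iw \<leftarrow> look index_of w;
         let (r1, r2, u, iu) = (if ia < ib then (b, a, sb, ib) else (a, b, sa, ia));
         (x, _) \<leftarrow> look endpoints u;
         (y, _) \<leftarrow> look endpoints w;
         k' \<leftarrow> on_lct (lct_bottleneck L x y);
         (if 1 + k' \<le> Suc k then do {
            rotate_nodes D n1 n2 r1 r2 r3;
            when_prog (iw < iu) (swap_partners \<sigma> \<tau>)
          }
          else rotate_nodes D n1 n2 r2 r1 r3)
       })
     }"
  have main: "wp rest (\<lambda>_. middle rotated (real t + 60 * \<beta>)) (M0\<lparr>lct := l\<rparr>) (t + c1)"
    if l: "lct_rep L l ?V W2" and c1: "real c1 \<le> 8 * \<beta>" for l c1
    unfolding rest_def
    apply (simp add: no pp1 xy1(1) xy2(1) r3 Let_def split del: if_split cong: if_cong)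
    apply (rule wp_on_dft, simp, rule dft_lowest_leaf[OF dft card_nodes_A xyA(1)])
    apply (simp split del: if_split, rule wp_on_dft, simp, rule dft_lowest_leaf[OF _ card_nodes_A xyA(2)], assumption)
    apply (simp split del: if_split, rule wp_on_dft, simp, rule dft_lowest_leaf[OF _ card_nodes_A handles(5)], assumption)
    apply (simp add: s1 s2 lowd pd(3) choice split del: if_split cong: if_cong)
    subgoal premises prems for l1 d1 c2 l2 d2 c3 l3 d3 c4
    proof -
      show ?thesis
      proof (cases younger_a)
        case True
        show ?thesis
          apply (simp add: True ep u(2) pd(3))
          apply (rule wp_on_lct, rule bot[OF l], simp)
          apply (simp add: test True)
          subgoal for _ l4 c5
            \<comment> \<open>The 13 table accesses are two nodes, a parent, two pairs of children,
              three simplices, three indices and two pairs of endpoints.\<close>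
            using wp_finish[of l4 d3 "c1 + c2 + c3 + c4 + c5 + 13" _ t] prems c1 bound True pd(1) pa(1)
            by (simp add: u_def numeral_eq_Suc algebra_simps)
          done
      next
        case False
        show ?thesis
          apply (simp add: False ep u(2) pd(3))
          apply (rule wp_on_lct, rule bot[OF l], simp)
          apply (simp add: test False)
          subgoal for _ l4 c5
            using wp_finish[of l4 d3 "c1 + c2 + c3 + c4 + c5 + 13" _ t] prems c1 bound False
            by (simp add: numeral_eq_Suc algebra_simps)
          done
      qed
    qed
    done
  have prog: "run_negatives D L (Suc k) \<sigma> \<tau> =
      State_Monad.bind (reweigh_msf L \<sigma> (Suc k)) (\<lambda>_. State_Monad.bind (reweigh_msf L \<tau> k) (\<lambda>_. rest))"
    by (simp only: run_negatives_def rest_def diff_Suc_1)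
  show ?thesis
    unfolding prog wp_bind_fun
    by (rule wp_reweigh_both) (use negatives main in \<open>simp_all add: e\<close>)
qed

end


text \<open>Only levels of leaves are visible in a representation. This permits passing to a forest
  whose internal levels have been recomputed without touching the memory.\<close>

lemma tree_rep_cong:
  assumes rep: "tree_rep D V T M"
    and eq: "nodes T' = nodes T" "parent T' = parent T"
    and closed: "\<And>s p. parent T s = Some p \<Longrightarrow> s \<in> nodes T"
    and level: "\<And>s. is_leaf T s \<Longrightarrow> level T' s = level T s"
  shows "tree_rep D V T' M"
proof -
  obtain A where A: "dft_rep D (dft M) A" "tree_mem V T A (node_of M) (simplex_of M)"
    "ptrs_mem A (parent_ptr M) (child_ptrs M)"
    using rep by (auto simp: tree_rep_def)
  then interpret forest_representation "simplex_of M" A T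
    by unfold_locales (use closed in \<open>auto simp: tree_mem_def\<close>)
  have "level A n = level T' (simplex_of M n)" if "is_leaf A n" for n
  proof -
    have "n \<in> nodes A" using that by (simp add: is_leaf_def)
    then show ?thesis using level level_leaf[OF that] is_leaf_iff that by simp
  qed
  then have "represents (simplex_of M) A T'"
    using represents unfolding represents_def eq by simp
  then have "tree_mem V T' A (node_of M) (simplex_of M)" using A(2) by (simp add: tree_mem_def)
  then show ?thesis using A by (auto simp: tree_rep_def)
qed

lemma (in data_structures) wp_set_leaf_level:
  assumes rep: "tree_rep D V T M" and s: "s \<in> V" "is_leaf T s"
    and closed: "\<And>s p. parent T s = Some p \<Longrightarrow> s \<in> nodes T" and card: "card (nodes T) \<le> m"
    and Q: "\<And>d c. tree_rep D V (T\<lparr>level := (level T)(s \<mapsto> j)\<rparr>) (M\<lparr>dft := d\<rparr>) \<Longrightarrow> real c \<le> \<beta> + 1 \<Longrightarrow>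
      Q () (M\<lparr>dft := d\<rparr>) (t + c)"
  shows "wp (set_leaf_level D s j) Q M t"
proof -
  let ?lab = "simplex_of M"
  obtain A where A: "dft_rep D (dft M) A" "tree_mem V T A (node_of M) ?lab"
    "ptrs_mem A (parent_ptr M) (child_ptrs M)"
    using rep by (auto simp: tree_rep_def)
  then interpret forest_representation ?lab A T
    by unfold_locales (use closed in \<open>auto simp: tree_mem_def\<close>)
  have sT: "s \<in> nodes T" using s(2) by (simp add: is_leaf_def)
  obtain n where n: "n \<in> nodes A" "?lab n = s" using lab_surj[OF sT] by blast
  then have no: "node_of M s = Some n" using A(2) s(1) by (simp add: tree_mem_def)
  have leaf: "is_leaf A n" using is_leaf_iff n s(2) by simp
  let ?A = "A\<lparr>level := (level A)(n \<mapsto> j)\<rparr>" and ?T = "T\<lparr>level := (level T)(s \<mapsto> j)\<rparr>"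
  have nodes: "nodes ?A = nodes A" "nodes ?T = nodes T"
    using n(1) sT by (auto simp: nodes_def)
  have children: "children ?A = children A" by (simp add: children_def fun_eq_iff)
  have "level ?A x = level ?T (?lab x)" if x: "is_leaf ?A x" for x
  proof -
    have "is_leaf A x" using x by (simp add: is_leaf_def nodes children)
    then have "x \<in> nodes A" "level A x = level T (?lab x)" using level_leaf by (simp_all add: is_leaf_def)
    then show ?thesis using lab_inj[of x n] n by auto
  qed
  then have "represents ?lab ?A ?T"
    using represents unfolding represents_def nodes by simp
  then have "tree_mem V ?T ?A (node_of M) ?lab"
    using A(2) unfolding tree_mem_def nodes by simp
  moreover have "ptrs_mem ?A (parent_ptr M) (child_ptrs M)"
    using A(3) unfolding ptrs_mem_def nodes children by simp
  ultimately have rep': "tree_rep D V ?T (M\<lparr>dft := d\<rparr>)" if "dft_rep D d ?A" for d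
    using that by (auto simp: tree_rep_def)
  have "performs (\<lambda>d'. dft_rep D d' ?A) (\<lambda>_. True) \<beta> (dft_set_level D n j (dft M))"
    by (rule dft_set_level[OF A(1) _ leaf]) (use card card_nodes in simp)
  then have "wp (on_dft (dft_set_level D n j)) Q M (t + 1)"
  proof (rule wp_on_dft[OF refl])
    fix r :: unit and d c assume "dft_rep D d ?A" "real c \<le> \<beta>"
    then show "Q r (M\<lparr>dft := d\<rparr>) (t + 1 + c)" using Q[OF rep', of d "1 + c"] by (simp add: add.assoc)
  qed
  then show ?thesis by (simp add: set_leaf_level_def no)
qed

section \<open>Assembly of the complete program\<close>

context stored_switch
begin

lemma wp_run_negatives:
  assumes neg: "negative F \<sigma>" "negative F \<tau>"
    and T: "update_negatives F (Suc k) (MF F, pairing F) = (T, P)"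
  shows "wp (run_negatives D L (Suc k) \<sigma> \<tau>) (\<lambda>_. middle T (real t + 60 * \<beta>)) M0 t"
proof (cases "is_parent F \<tau> \<sigma>")
  case True
  then obtain a b c d ra rb rd where "graph_rotation F k a b c d ra rb rd"
    using rotation_obtain neg by metis
  then interpret rot: graph_rotation F k a b c d ra rb rd .
  obtain n1 where n1: "n1 \<in> nodes A" "lab n1 = \<sigma>" using node_obtain[OF negative_is_node[OF neg(1)]] by metis
  obtain n2 where n2: "n2 \<in> nodes A" "lab n2 = \<tau>" using node_obtain[OF negative_is_node[OF neg(2)]] by metis
  obtain na where na: "na \<in> nodes A" "lab na = ra" using node_obtain[OF rot.nodes(1)] by metis
  obtain nb where nb: "nb \<in> nodes A" "lab nb = rb" using node_obtain[OF rot.nodes(2)] by metis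
  obtain nd where nd: "nd \<in> nodes A" "lab nd = rd" using node_obtain[OF rot.nodes(3)] by metis
  interpret stored_rotation F k D L \<beta> M0 A W a b c d ra rb rd n1 n2 na nb nd
    by unfold_locales (use n1 n2 na nb nd in simp_all)
  have "T = rot.rotated" using T rot.update_negatives_rotated by simp
  then show ?thesis using wp_run_rotation by simp
next
  case False
  have TP: "T = MF F" using T False by (simp add: update_negatives_def Let_def parent_MF)
  have st: stable using stable_negatives_not_child[OF neg False] .
  have "\<not> is_vertex \<sigma>" using neg negative_is_edge is_edge_not_vertex by metis
  then have eq: "pairing F' = pairing F" using stable_pairing[OF st] by simp
  obtain n1 where n1: "node_of M0 \<sigma> = Some n1" "n1 \<in> nodes A" "lab n1 = \<sigma>"
    using node_obtain[OF negative_is_node[OF neg(1)]] .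
  obtain n2 where n2: "node_of M0 \<tau> = Some n2" "n2 \<in> nodes A" "lab n2 = \<tau>"
    using node_obtain[OF negative_is_node[OF neg(2)]] .
  have pp: "parent_ptr M0 n1 \<noteq> Some n2"
    using ptrs n1 n2 rep.parent_iff[of n1 n2] False by (simp add: ptrs_mem_def parent_MF)
  have fin: "middle T (real t + 60 * \<beta>) (M0\<lparr>lct := l\<rparr>) (t + c)"
    if l: "lct_rep L l (verts (set F)) (W(\<sigma> \<mapsto> Suc k, \<tau> \<mapsto> k))" and c: "real c \<le> 60 * \<beta>" for l c
  proof -
    have "msf_mem L F' l (W(\<sigma> \<mapsto> Suc k, \<tau> \<mapsto> k))"
      by (rule msf_memI[OF l]) (use neg st stable_negative msf_facts(2) in auto)
    then show ?thesis using eq partners dft tree ptrs c unfolding TP by (auto simp: middle_def tree_rep_def)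
  qed
  show ?thesis
    unfolding run_negatives_def wp_bind_fun diff_Suc_1
  proof (rule wp_reweigh_both[OF neg])
    fix l c assume l: "lct_rep L l (verts (set F)) (W(\<sigma> \<mapsto> Suc k, \<tau> \<mapsto> k))" and c: "real c \<le> 8 * \<beta>"
    \<comment> \<open>The guarded part is generalised to \<open>r\<close>, as it is not executed
      when the test fails. The three accesses before it account for \<open>c + 3\<close>.\<close>
    show "wp (get_node \<sigma>) (\<lambda>n1. wp (get_node \<tau>) (\<lambda>n2. wp (look parent_ptr n1) (\<lambda>p. wp (when_prog (p = Some n2) (r n1 n2))
        (\<lambda>_. middle T (real t + 60 * \<beta>))))) (M0\<lparr>lct := l\<rparr>) (t + c)" for r
      using fin[OF l, of "c + 3"] c bound pp by (simp add: n1 n2 numeral_eq_Suc)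
  qed
qed

text \<open>The forest is given as \<open>T\<close> with a condition on
  \<open>update_levels\<close>, because leaf levels are written only later, in
  \<open>finish\<close>, for all cases alike.\<close>

lemma wp_run_edges:
  assumes edge: "is_edge \<sigma>" "is_edge \<tau>"
  obtains T where "update_levels F (Suc k) T = MF F'"
    "wp (run_edges D L (Suc k) \<sigma> \<tau>) (\<lambda>_. middle T (real t + 70 * \<beta>)) M0 t"
proof -
  have nv: "\<not> (is_vertex \<sigma> \<and> is_vertex \<tau>)" using edge is_edge_not_vertex by blast
  have p1: "partner M0 \<sigma> = None \<longleftrightarrow> \<not> negative F \<sigma>" and p2: "partner M0 \<tau> = None \<longleftrightarrow> \<not> negative F \<tau>"
    using partner_edge edge by simp_all
  have weaken: "middle T (real t + 70 * \<beta>) M t'" if "middle T (real (t + 2) + 60 * \<beta>) M t'" for T M t'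
    using that bound by (simp add: middle_def)
  consider "\<not> negative F \<sigma>" "\<not> negative F \<tau>" | "\<not> negative F \<sigma>" "negative F \<tau>"
    | "negative F \<sigma>" "positive F \<tau>" | "negative F \<sigma>" "negative F \<tau>"
    using positive_iff edge by auto
  then show ?thesis
  proof cases
    case 1
    have st: stable using stable_nonnegative_first edge 1 by blast
    have "middle (MF F) (real (t + 2)) M0 (t + 2)"
      using middle_refl[OF st 1 stable_pairing[OF st nv]] .
    then have "wp (run_edges D L (Suc k) \<sigma> \<tau>) (\<lambda>_. middle (MF F) (real t + 70 * \<beta>)) M0 t"
      using weaken[of "MF F" M0 "t + 2"] bound 1 p1 p2
      by (simp add: run_edges_def middle_def numeral_eq_Suc)
    then show ?thesis using that stable_MF[OF st] by blast
  next
    case 2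
    have st: stable using stable_nonnegative_first edge 2 by blast
    have "wp (reweigh_msf L \<tau> k) (\<lambda>_. middle (MF F) (real (t + 2) + 4 * \<beta>)) M0 (t + 2)"
      by (rule wp_reweigh_switched[OF 2(2) st]) (use 2 tree_rep_M0 stable_pairing[OF st nv] in auto)
    then have "wp (reweigh_msf L \<tau> k) (\<lambda>_. middle (MF F) (real t + 70 * \<beta>)) M0 (t + 2)"
      by (rule wp_mono) (use bound in \<open>simp add: middle_def\<close>)
    then have "wp (run_edges D L (Suc k) \<sigma> \<tau>) (\<lambda>_. middle (MF F) (real t + 70 * \<beta>)) M0 t"
      using 2 p1 p2 by (auto simp: run_edges_def numeral_eq_Suc)
    then show ?thesis using that stable_MF[OF st] by blast
  next
    case 3
    obtain T P where TP: "update_negative_positive F (Suc k) (MF F, pairing F) = (T, P)" by fastforce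
    have "wp (run_negative_positive L (Suc k) \<sigma> \<tau>) (\<lambda>_. middle T (real (t + 2) + 30 * \<beta>)) M0 (t + 2)"
      by (rule wp_run_negative_positive[OF 3 TP])
    then have "wp (run_negative_positive L (Suc k) \<sigma> \<tau>) (\<lambda>_. middle T (real t + 70 * \<beta>)) M0 (t + 2)"
      by (rule wp_mono) (use bound in \<open>simp add: middle_def\<close>)
    then have "wp (run_edges D L (Suc k) \<sigma> \<tau>) (\<lambda>_. middle T (real t + 70 * \<beta>)) M0 t"
      using 3 p1 p2 by (auto simp: run_edges_def numeral_eq_Suc positive_iff)
    then show ?thesis using that update_negative_positive_correct[OF 3 TP] by blast
  next
    case 4
    obtain T P where TP: "update_negatives F (Suc k) (MF F, pairing F) = (T, P)" by fastforce
    have "wp (run_negatives D L (Suc k) \<sigma> \<tau>) (\<lambda>_. middle T (real (t + 2) + 60 * \<beta>)) M0 (t + 2)"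
      by (rule wp_run_negatives[OF 4 TP])
    then have "wp (run_negatives D L (Suc k) \<sigma> \<tau>) (\<lambda>_. middle T (real t + 70 * \<beta>)) M0 (t + 2)"
      by (rule wp_mono) (use weaken in blast)
    then have "wp (run_edges D L (Suc k) \<sigma> \<tau>) (\<lambda>_. middle T (real t + 70 * \<beta>)) M0 t"
      using 4 p1 p2 by (auto simp: run_edges_def numeral_eq_Suc)
    then show ?thesis using that update_negatives_correct[OF 4 TP] by blast
  qed
qed

lemma simplex_type: "s \<in> set F \<Longrightarrow> is_edge s \<longleftrightarrow> \<not> is_vertex s"
  by (metis is_edge_doubleton is_edge_not_vertex is_vertex_singleton simplex_cases)

lemma wp_run_cases:
  assumes v: "v1 \<longleftrightarrow> is_vertex \<sigma>" "v2 \<longleftrightarrow> is_vertex \<tau>"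
  obtains T where "update_levels F (Suc k) T = MF F'"
    "wp (if v1 \<and> v2 then run_vertices D \<sigma> \<tau>
        else if v1 then run_mixed L \<tau> k
        else if v2 then run_mixed L \<sigma> (Suc k)
        else run_edges D L (Suc k) \<sigma> \<tau>) (\<lambda>_. middle T (real t + 70 * \<beta>)) M0 t"
proof -
  have type: "is_edge \<sigma> \<longleftrightarrow> \<not> is_vertex \<sigma>" "is_edge \<tau> \<longleftrightarrow> \<not> is_vertex \<tau>"
    using simplex_type mem_switched by blast+
  have weaken: "middle T (real t + 70 * \<beta>) M t'" if "middle T (real t + x * \<beta>) M t'" "x \<le> 70" for T M t' x
  proof -
    have "x * \<beta> \<le> 70 * \<beta>" using that(2) bound by (intro mult_right_mono) linarith+
    then show ?thesis using that(1) by (simp add: middle_def)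
  qed
  consider "is_vertex \<sigma>" "is_vertex \<tau>" | "is_vertex \<sigma>" "is_edge \<tau>" | "is_edge \<sigma>" "is_vertex \<tau>"
    | "is_edge \<sigma>" "is_edge \<tau>" using type by blast
  then show ?thesis
  proof cases
    case 1
    have st: stable using 1 stable_if_vertex by blast
    have "wp (run_vertices D \<sigma> \<tau>) (\<lambda>_. middle (MF F) (real t + 70 * \<beta>)) M0 t"
      using wp_run_vertices[OF 1] by (rule wp_mono) (use weaken[of _ 20] in simp)
    then show ?thesis using that[of "MF F"] stable_MF[OF st] v 1 by simp
  next
    case 2
    have st: stable using 2 stable_if_vertex by blast
    have "wp (run_mixed L \<tau> k) (\<lambda>_. middle (MF F) (real t + 5 * \<beta>)) M0 t"
      by (rule wp_run_mixed) (use 2 in auto)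
    then have "wp (run_mixed L \<tau> k) (\<lambda>_. middle (MF F) (real t + 70 * \<beta>)) M0 t"
      by (rule wp_mono) (use weaken[of _ 5] in simp)
    then show ?thesis using that[of "MF F"] stable_MF[OF st] v 2 type by simp
  next
    case 3
    have st: stable using 3 stable_if_vertex by blast
    have "wp (run_mixed L \<sigma> (Suc k)) (\<lambda>_. middle (MF F) (real t + 5 * \<beta>)) M0 t"
      by (rule wp_run_mixed) (use 3 in auto)
    then have "wp (run_mixed L \<sigma> (Suc k)) (\<lambda>_. middle (MF F) (real t + 70 * \<beta>)) M0 t"
      by (rule wp_mono) (use weaken[of _ 5] in simp)
    then show ?thesis using that[of "MF F"] stable_MF[OF st] v 3 type by simp
  next
    case 4
    obtain T where "update_levels F (Suc k) T = MF F'"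
      "wp (run_edges D L (Suc k) \<sigma> \<tau>) (\<lambda>_. middle T (real t + 70 * \<beta>)) M0 t"
      using wp_run_edges[OF 4] .
    then show ?thesis using that[of T] v 4 type by simp
  qed
qed

text \<open>\<open>update_levels\<close> recomputes all internal levels, whereas the program writes
  at most two leaf levels. The resulting forest \<open>?T2\<close> agrees with that of
  \<open>F'\<close> in its structure and in its leaf levels, which suffices by
  \<open>tree_rep_cong\<close>.\<close>

lemma finish:
  assumes T: "update_levels F (Suc k) T = MF F'" and mid: "middle T c M t"
    and c: "c + 20 * \<beta> \<le> b"
  shows "wp (do {
       when_prog (is_vertex \<sigma>) (set_leaf_level D \<sigma> (Suc k));
       when_prog (is_vertex \<tau>) (set_leaf_level D \<tau> k);
       store simplex_at_update k \<tau>;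
       store simplex_at_update (Suc k) \<sigma>;
       store index_of_update \<tau> k;
       store index_of_update \<sigma> (Suc k)
     }) (\<lambda>_ M t. stores D L F' M \<and> real t \<le> b) M t"
proof -
  have parT: "parent T = parent (MF F')" unfolding T[symmetric] by (simp add: update_levels_def)
  have levT: "level (MF F') x = (if x \<notin> nodes T then None
      else if is_leaf T x \<and> x \<notin> {\<sigma>, \<tau>} then level T x else Some (idx F' x))" for x
    unfolding T[symmetric] by (simp add: update_levels_def)
  have nodT: "x \<in> nodes T \<longleftrightarrow> is_node F' x" for x
  proof -
    have "x \<in> nodes T \<longleftrightarrow> level (MF F') x \<noteq> None"
      unfolding levT by (auto simp: nodes_def)
    also have "\<dots> \<longleftrightarrow> is_node F' x" by (simp add: sw.level_MF)
    finally show ?thesis .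
  qed
  have nodT': "nodes T = nodes (MF F')"
    by (rule set_eqI) (simp only: nodT sw.nodes_MF)
  have leafT: "is_leaf T x \<longleftrightarrow> x \<in> set F \<and> is_vertex x" for x
    using sw.is_leaf_MF[of x] unfolding is_leaf_def children_def parT nodT' by simp
  have closed: "parent T s = Some p \<Longrightarrow> s \<in> nodes T" for s p
    unfolding parT nodT' using sw.parent_MF sw.is_parent_nodes by auto
  have card: "card (nodes T) \<le> length F" unfolding nodT' using sw.card_nodes_MF by simp
  let ?T1 = "if is_vertex \<sigma> then T\<lparr>level := (level T)(\<sigma> \<mapsto> Suc k)\<rparr> else T"
  let ?T2 = "if is_vertex \<tau> then ?T1\<lparr>level := (level ?T1)(\<tau> \<mapsto> k)\<rparr> else ?T1"
  have nod1: "nodes ?T1 = nodes T" and par1: "parent ?T1 = parent T"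
    using leafT[of \<sigma>] by (auto simp: nodes_def is_leaf_def)
  have nod2: "nodes ?T2 = nodes T" and par2: "parent ?T2 = parent T"
    using leafT[of \<tau>] nod1 par1 by (auto simp: nodes_def is_leaf_def)
  have leaf1: "is_leaf ?T1 x \<longleftrightarrow> is_leaf T x" and leaf2: "is_leaf ?T2 x \<longleftrightarrow> is_leaf T x" for x
    unfolding is_leaf_def children_def nod1 par1 nod2 par2 by simp_all
  have lev2: "level (MF F') x = level ?T2 x" if x: "is_leaf ?T2 x" for x
  proof -
    have "x \<in> nodes T" "x \<in> set F" "is_vertex x" "is_leaf T x"
      using x leaf2 leafT by (auto simp: is_leaf_def)
    then show ?thesis unfolding levT by auto
  qed
  have final: "tree_rep D (set F) (MF F') M'" if "tree_rep D (set F) ?T2 M'" for M' :: "('v, 'n, 'd, 'l) memory"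
    by (rule tree_rep_cong[OF that])
      (unfold nod2 par2, use nodT' parT closed lev2 in auto)
  have m: "simplex_at M = simplex_at M0" "index_of M = index_of M0" "endpoints M = endpoints M0"
    "partner_mem (set F) (pairing F') (partner M)" "tree_rep D (set F) T M" "real t \<le> c"
    using mid by (simp_all add: middle_def)
  obtain W' where W': "msf_mem L F' (lct M) W'" using mid by (auto simp: middle_def)
  have last: "wp (do {
       store simplex_at_update k \<tau>;
       store simplex_at_update (Suc k) \<sigma>;
       store index_of_update \<tau> k;
       store index_of_update \<sigma> (Suc k)
     }) (\<lambda>_ M t. stores D L F' M \<and> real t \<le> b) (M\<lparr>dft := d\<rparr>) (t + c')"
    if rep: "tree_rep D (set F) ?T2 (M\<lparr>dft := d\<rparr>)" and c': "real c' \<le> 16 * \<beta>" for d c'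
  proof -
    let ?M = "M\<lparr>dft := d, simplex_at := (simplex_at M)(k := \<tau>, Suc k := \<sigma>),
      index_of := (index_of M)(\<tau> := k, \<sigma> := Suc k)\<rparr>"
    have "static_mem F' ?M"
      using static m idx_switch unfolding static_mem_def by (auto simp: nth_switch)
    moreover have "tree_rep D (set F) (MF F') ?M"
      using final[OF rep] by (simp add: tree_rep_def)
    ultimately have "stores D L F' ?M"
      unfolding sw.stores_iff using m(4) W' by auto
    then show ?thesis using m(6) c c' bound by simp
  qed
  have second: "wp (do {
       when_prog (is_vertex \<tau>) (set_leaf_level D \<tau> k);
       store simplex_at_update k \<tau>;
       store simplex_at_update (Suc k) \<sigma>;
       store index_of_update \<tau> k;
       store index_of_update \<sigma> (Suc k)
     }) (\<lambda>_ M t. stores D L F' M \<and> real t \<le> b) (M\<lparr>dft := d\<rparr>) (t + c')"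
    if rep: "tree_rep D (set F) ?T1 (M\<lparr>dft := d\<rparr>)" and c': "real c' \<le> 8 * \<beta>" for d c'
  proof (cases "is_vertex \<tau>")
    case True
    show ?thesis
      unfolding when_prog_def if_P[OF True]
    proof (subst wp_bind_fun, rule wp_set_leaf_level[OF rep])
      show "is_leaf ?T1 \<tau>" unfolding leaf1 leafT using True by simp
      show "parent ?T1 s = Some p \<Longrightarrow> s \<in> nodes ?T1" for s p unfolding par1 nod1 by (rule closed)
      show "card (nodes ?T1) \<le> length F" unfolding nod1 by (rule card)
      fix d' c2 assume "tree_rep D (set F) (?T1\<lparr>level := (level ?T1)(\<tau> \<mapsto> k)\<rparr>) (M\<lparr>dft := d\<rparr>\<lparr>dft := d'\<rparr>)"
        "real c2 \<le> \<beta> + 1"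
      then show "wp (do {
         store simplex_at_update k \<tau>;
         store simplex_at_update (Suc k) \<sigma>;
         store index_of_update \<tau> k;
         store index_of_update \<sigma> (Suc k)
       }) (\<lambda>_ M t. stores D L F' M \<and> real t \<le> b) (M\<lparr>dft := d\<rparr>\<lparr>dft := d'\<rparr>) (t + c' + c2)"
        using last[of d' "c' + c2"] True c' bound by (simp add: add.assoc)
    qed simp
  next
    case False
    then show ?thesis using last[of d c'] rep c' bound by simp
  qed
  show ?thesis
  proof (cases "is_vertex \<sigma>")
    case True
    show ?thesis
      unfolding when_prog_def[of "is_vertex \<sigma>"] if_P[OF True]
    proof (subst wp_bind_fun, rule wp_set_leaf_level[OF m(5)])
      show "is_leaf T \<sigma>" unfolding leafT using True by simp
      show "parent T s = Some p \<Longrightarrow> s \<in> nodes T" for s p by (rule closed)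
      show "card (nodes T) \<le> length F" by (rule card)
      fix d' c2 assume "tree_rep D (set F) (T\<lparr>level := (level T)(\<sigma> \<mapsto> Suc k)\<rparr>) (M\<lparr>dft := d'\<rparr>)"
        "real c2 \<le> \<beta> + 1"
      then show "wp (do {
         when_prog (is_vertex \<tau>) (set_leaf_level D \<tau> k);
         store simplex_at_update k \<tau>;
         store simplex_at_update (Suc k) \<sigma>;
         store index_of_update \<tau> k;
         store index_of_update \<sigma> (Suc k)
       }) (\<lambda>_ M t. stores D L F' M \<and> real t \<le> b) (M\<lparr>dft := d'\<rparr>) (t + c2)"
        using second[of d' c2] True bound by simp
    qed simp
  next
    case False
    then show ?thesis using second[of "dft M" 0] m(5) bound by simp
  qed
qed

text \<open>The bound collects four initial reads, \<open>70 * \<beta>\<close> for the case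
  distinction and \<open>20 * \<beta>\<close> for levels and tables, using \<beta> \<ge> 1.\<close>

lemma wp_run_update:
  "wp (run_update D L (Suc k)) (\<lambda>_ M t. stores D L F' M \<and> real t \<le> 100 * \<beta>) M0 0"
proof -
  obtain x x' where x: "endpoints M0 \<sigma> = (x, x')" "\<sigma> = {x, x'}" using endpoints_obtain[OF mem_switched(1)] .
  obtain y y' where y: "endpoints M0 \<tau> = (y, y')" "\<tau> = {y, y'}" using endpoints_obtain[OF mem_switched(2)] .
  have vx: "x = x' \<longleftrightarrow> is_vertex \<sigma>" and vy: "y = y' \<longleftrightarrow> is_vertex \<tau>"
    unfolding x(2) y(2) by (auto simp: is_vertex_def)
  have at: "simplex_at M0 k = \<sigma>" "simplex_at M0 (Suc k) = \<tau>" using static k by (simp_all add: static_mem_def)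
  obtain T where T: "update_levels F (Suc k) T = MF F'"
    "wp (if (x = x') \<and> (y = y') then run_vertices D \<sigma> \<tau>
        else if (x = x') then run_mixed L \<tau> k
        else if (y = y') then run_mixed L \<sigma> (Suc k)
        else run_edges D L (Suc k) \<sigma> \<tau>) (\<lambda>_. middle T (real 4 + 70 * \<beta>)) M0 4"
    using wp_run_cases[OF vx vy, of 4] by metis
  have main: "wp (if (x = x') \<and> (y = y') then run_vertices D \<sigma> \<tau>
        else if (x = x') then run_mixed L \<tau> k
        else if (y = y') then run_mixed L \<sigma> (Suc k)
        else run_edges D L (Suc k) \<sigma> \<tau>) (\<lambda>_. wp (do {
       when_prog (is_vertex \<sigma>) (set_leaf_level D \<sigma> (Suc k));
       when_prog (is_vertex \<tau>) (set_leaf_level D \<tau> k);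
       store simplex_at_update k \<tau>;
       store simplex_at_update (Suc k) \<sigma>;
       store index_of_update \<tau> k;
       store index_of_update \<sigma> (Suc k)
     }) (\<lambda>_ M t. stores D L F' M \<and> real t \<le> 100 * \<beta>)) M0 4"
    using T(2)
  proof (rule wp_mono)
    fix M' t' assume "middle T (real 4 + 70 * \<beta>) M' t'"
    then show "wp (do {
       when_prog (is_vertex \<sigma>) (set_leaf_level D \<sigma> (Suc k));
       when_prog (is_vertex \<tau>) (set_leaf_level D \<tau> k);
       store simplex_at_update k \<tau>;
       store simplex_at_update (Suc k) \<sigma>;
       store index_of_update \<tau> k;
       store index_of_update \<sigma> (Suc k)
     }) (\<lambda>_ M t. stores D L F' M \<and> real t \<le> 100 * \<beta>) M' t'"
      by (rule finish[OF T(1)]) (use bound in simp)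
  qed
  show ?thesis
    using main
    by (simp add: run_update_def at x(1) y(1) vx vy wp_bind_fun numeral_eq_Suc split del: if_split cong: if_cong)
qed

end


subsection \<open>The time bound\<close>

lemma performs_mono: "performs S R b out \<Longrightarrow> b \<le> b' \<Longrightarrow> performs S R b' out"
  by (auto simp: performs_def split: prod.splits)

lemma bigo_ln_obtain:
  assumes "b \<in> O(\<lambda>N. ln (real N))"
  obtains C N0 where "C \<ge> 0" "N0 \<ge> 1" "\<And>N. N \<ge> N0 \<Longrightarrow> \<bar>b N\<bar> \<le> C * ln (real N)"
proof -
  obtain C where C: "C > 0" "eventually (\<lambda>N. norm (b N) \<le> C * norm (ln (real N))) at_top"
    using landau_o.bigE[OF assms] .
  then obtain N1 where N1: "\<And>N. N \<ge> N1 \<Longrightarrow> norm (b N) \<le> C * norm (ln (real N))"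
    by (auto simp: eventually_at_top_linorder)
  show thesis
  proof (rule that[of C "max 1 N1"])
    fix N assume "max 1 N1 \<le> N"
    then show "\<bar>b N\<bar> \<le> C * ln (real N)" using N1[of N] by simp
  qed (use C in auto)
qed

text \<open>The bound assumed for the tours refers to the exact number of nodes and need not be
  monotone. Its running maximum is, and so it applies to every size up to \<open>m\<close>.\<close>

definition max_bound :: "(nat \<Rightarrow> real) \<Rightarrow> nat \<Rightarrow> real" where
  "max_bound b m = Max ((\<lambda>N. \<bar>b N\<bar>) ` {..m})"

lemma max_bound_ge: "N \<le> m \<Longrightarrow> b N \<le> max_bound b m"
  unfolding max_bound_def by (rule order_trans[OF abs_ge_self Max_ge]) auto

lemma max_bound_nonneg: "0 \<le> max_bound b m"
  unfolding max_bound_def by (rule order_trans[OF abs_ge_zero Max_ge[of _ "\<bar>b 0\<bar>"]]) auto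

text \<open>Sizes up to \<open>N0\<close> contribute a constant, larger ones at most
  \<open>C * ln m\<close> by monotonicity of the logarithm.\<close>

lemma max_bound_bigo:
  assumes "b \<in> O(\<lambda>N. ln (real N))" shows "max_bound b \<in> O(\<lambda>m. ln (real m))"
proof -
  obtain C N0 where C: "C \<ge> 0" "N0 \<ge> 1" "\<And>N. N \<ge> N0 \<Longrightarrow> \<bar>b N\<bar> \<le> C * ln (real N)"
    by (rule bigo_ln_obtain[OF assms]) (rule that; blast)
  have "norm (max_bound b m) \<le> (max_bound b N0 + C) * norm (ln (real m))" if m: "m \<ge> 3" for m
  proof -
    \<comment> \<open>The threshold 3 exceeds Euler's number, so that constants are absorbed by the
      logarithm.\<close>
    have ln: "1 \<le> ln (real m)" using m exp_le by (subst ln_ge_iff) auto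
    have "max_bound b m \<le> max_bound b N0 + C * ln (real m)"
      unfolding max_bound_def[of b m]
    proof (rule Max.boundedI)
      fix a assume "a \<in> (\<lambda>N. \<bar>b N\<bar>) ` {..m}"
      then obtain N where N: "N \<le> m" "a = \<bar>b N\<bar>" by auto
      show "a \<le> max_bound b N0 + C * ln (real m)"
      proof (cases "N \<le> N0")
        case True
        then have "a \<le> max_bound b N0" unfolding max_bound_def N(2) by (intro Max_ge) auto
        then show ?thesis using C(1) ln by (simp add: add_increasing2)
      next
        case False
        then have "a \<le> C * ln (real N)" using C(3) N by simp
        also have "\<dots> \<le> C * ln (real m)" using False C(1,2) N by (intro mult_left_mono) auto
        finally show ?thesis using max_bound_nonneg[of b N0] by linarith
      qed
    qed auto
    also have "\<dots> \<le> (max_bound b N0 + C) * ln (real m)"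
      using mult_left_mono[OF ln max_bound_nonneg[of b N0]] by (simp add: algebra_simps)
    finally show ?thesis using max_bound_nonneg ln by simp
  qed
  then have "\<forall>\<^sub>F m in at_top. norm (max_bound b m) \<le> (max_bound b N0 + C) * norm (ln (real m))"
    by (rule eventually_at_top_linorderI)
  then show ?thesis by (rule bigoI)
qed

lemma data_structures_bound:
  fixes D :: "('n, 'd) dft_ops" and L :: "('v, 'l) lct_ops"
  assumes "dft_tree D" "link_cut_tree L"
  shows "\<exists>\<beta>. \<beta> \<in> O(\<lambda>m. ln (real m)) \<and> (\<forall>m. data_structures D L m (\<beta> m))"
proof -
  obtain b1 where b1: "b1 \<in> O(\<lambda>N. ln (real N))" and D: "\<forall>d T. dft_rep D d T \<longrightarrow>
        (\<forall>x\<in>nodes T.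
           performs (\<lambda>d'. dft_rep D d' T) (\<lambda>r. r = root_of T x)
             (b1 (card (nodes T))) (dft_root D x d)) \<and>
        (\<forall>x\<in>nodes T. parent T x \<noteq> None \<longrightarrow>
           performs (\<lambda>d'. dft_rep D d' (T\<lparr>parent := (parent T)(x := None)\<rparr>)) (\<lambda>_. True)
             (b1 (card (nodes T))) (dft_cut D x d)) \<and>
        (\<forall>r\<in>nodes T. \<forall>x\<in>nodes T. parent T r = None \<and> root_of T x \<noteq> r \<longrightarrow>
           performs (\<lambda>d'. dft_rep D d' (T\<lparr>parent := (parent T)(r \<mapsto> x)\<rparr>)) (\<lambda>_. True)
             (b1 (card (nodes T))) (dft_link D r x d)) \<and>
        (\<forall>x\<in>nodes T. \<forall>y\<in>nodes T. same_tree T x y \<longrightarrow>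
           performs (\<lambda>d'. dft_rep D d' T) (\<lambda>r. r = nca T x y)
             (b1 (card (nodes T))) (dft_nca D x y d)) \<and>
        (\<forall>x k. is_leaf T x \<longrightarrow>
           performs (\<lambda>d'. dft_rep D d' (T\<lparr>level := (level T)(x \<mapsto> k)\<rparr>)) (\<lambda>_. True)
             (b1 (card (nodes T))) (dft_set_level D x k d)) \<and>
        (\<forall>x\<in>nodes T.
           performs (\<lambda>d'. dft_rep D d' T) (is_lowest_leaf T x)
             (b1 (card (nodes T))) (dft_lowest_leaf D x d))"
    using assms(1) unfolding dft_tree_def by (elim exE conjE) (rule that)
  obtain b2 where b2: "b2 \<in> O(\<lambda>m. ln (real m))" and L: "\<forall>l V W m. lct_rep L l V W \<and> card V + card (dom W) \<le> m \<longrightarrow>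
        (\<forall>x\<in>V. \<forall>y\<in>V. \<forall>k. \<not> connected_in (dom W) x y \<longrightarrow>
           performs (\<lambda>l'. lct_rep L l' V (W({x, y} \<mapsto> k))) (\<lambda>_. True)
             (b2 m) (lct_link L x y k l)) \<and>
        (\<forall>x\<in>V. \<forall>y\<in>V. {x, y} \<in> dom W \<longrightarrow>
           performs (\<lambda>l'. lct_rep L l' V (W({x, y} := None))) (\<lambda>_. True)
             (b2 m) (lct_cut L x y l)) \<and>
        (\<forall>x\<in>V. \<forall>y\<in>V. x \<noteq> y \<and> connected_in (dom W) x y \<longrightarrow>
           performs (\<lambda>l'. lct_rep L l' V W) (\<lambda>r. r = bottleneck W x y)
             (b2 m) (lct_bottleneck L x y l))"
    using assms(2) unfolding link_cut_tree_def by (elim exE conjE) (rule that)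
  \<comment> \<open>The summand 1 provides \<beta> \<ge> 1, and a sum dominates both bounds because
    the running maxima are nonnegative.\<close>
  define \<beta> where "\<beta> m = 1 + max_bound b1 m + max_bound b2 m" for m
  have "(\<lambda>_. 1) \<in> O(\<lambda>m. ln (real m))"
  proof (rule bigoI[of _ 1])
    have "1 \<le> ln (real m)" if "m \<ge> 3" for m
      using that exp_le by (subst ln_ge_iff) auto
    then show "\<forall>\<^sub>F m in at_top. norm (1 :: real) \<le> 1 * norm (ln (real m))"
      by (intro eventually_at_top_linorderI[of 3]) fastforce
  qed
  then have "\<beta> \<in> O(\<lambda>m. ln (real m))"
    unfolding \<beta>_def using max_bound_bigo[OF b1] max_bound_bigo[OF b2]
    by (intro sum_in_bigo) simp_all
  moreover have "data_structures D L m (\<beta> m)" for m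
  proof -
    have 1: "b1 N \<le> \<beta> m" if "N \<le> m" for N
      using max_bound_ge[OF that, of b1] max_bound_nonneg[of b2 m] by (simp add: \<beta>_def)
    have 2: "b2 m \<le> \<beta> m"
      using max_bound_ge[of m m b2] max_bound_nonneg[of b1 m] by (simp add: \<beta>_def)
    note D' = D[THEN spec, THEN spec, THEN mp]
    note L' = L[THEN spec, THEN spec, THEN spec, THEN spec, THEN mp, OF conjI]
    show ?thesis
    proof
      show "1 \<le> \<beta> m" using max_bound_nonneg[of b1 m] max_bound_nonneg[of b2 m] by (simp add: \<beta>_def)
    next
      fix d T assume d: "dft_rep D d T" and m: "card (nodes T) \<le> m"
      note * = D'[OF d] and mono = performs_mono[OF _ 1[OF m]]
      show "performs (\<lambda>d'. dft_rep D d' T) (\<lambda>r. r = root_of T x) (\<beta> m) (dft_root D x d)"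
        if "x \<in> nodes T" for x
        using * that by (intro mono) blast
      show "performs (\<lambda>d'. dft_rep D d' (T\<lparr>parent := (parent T)(x := None)\<rparr>)) (\<lambda>_. True) (\<beta> m) (dft_cut D x d)"
        if "x \<in> nodes T" "parent T x \<noteq> None" for x
        using * that by (intro mono) blast
      show "performs (\<lambda>d'. dft_rep D d' (T\<lparr>parent := (parent T)(r \<mapsto> x)\<rparr>)) (\<lambda>_. True) (\<beta> m) (dft_link D r x d)"
        if "r \<in> nodes T" "x \<in> nodes T" "parent T r = None" "root_of T x \<noteq> r" for r x
        using * that by (intro mono) blast
      show "performs (\<lambda>d'. dft_rep D d' T) (\<lambda>r. r = nca T x y) (\<beta> m) (dft_nca D x y d)"
        if "x \<in> nodes T" "y \<in> nodes T" "same_tree T x y" for x y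
        using * that by (intro mono) blast
      show "performs (\<lambda>d'. dft_rep D d' (T\<lparr>level := (level T)(x \<mapsto> j)\<rparr>)) (\<lambda>_. True) (\<beta> m) (dft_set_level D x j d)"
        if "is_leaf T x" for x j
        using * that by (intro mono) blast
      show "performs (\<lambda>d'. dft_rep D d' T) (is_lowest_leaf T x) (\<beta> m) (dft_lowest_leaf D x d)"
        if "x \<in> nodes T" for x
        using * that by (intro mono) blast
    next
      fix l V W assume l: "lct_rep L l V W" and m: "card V + card (dom W) \<le> m"
      note * = L'[OF l m] and mono = performs_mono[OF _ 2]
      show "performs (\<lambda>l'. lct_rep L l' V (W({x, y} \<mapsto> j))) (\<lambda>_. True) (\<beta> m) (lct_link L x y j l)"
        if "x \<in> V" "y \<in> V" "\<not> connected_in (dom W) x y" for x y j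
        using * that by (intro mono) blast
      show "performs (\<lambda>l'. lct_rep L l' V (W({x, y} := None))) (\<lambda>_. True) (\<beta> m) (lct_cut L x y l)"
        if "x \<in> V" "y \<in> V" "{x, y} \<in> dom W" for x y
        using * that by (intro mono) blast
      show "performs (\<lambda>l'. lct_rep L l' V W) (\<lambda>r. r = bottleneck W x y) (\<beta> m) (lct_bottleneck L x y l)"
        if "x \<in> V" "y \<in> V" "x \<noteq> y" "connected_in (dom W) x y" for x y
        using * that by (intro mono) blast
    qed
  qed
  ultimately show ?thesis by blast
qed

theorem theorem11:
  fixes D :: "('n, 'd) dft_ops" and L :: "('v, 'l) lct_ops"
  shows "(\<forall>(F :: 'v simplex list) i. switchable F i \<longrightarrow>
            update F i (MF F, pairing F) = (MF (switch F i), pairing (switch F i))) \<and>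
         (dft_tree D \<and> link_cut_tree L \<longrightarrow>
            (\<exists>b :: nat \<Rightarrow> real. b \<in> O(\<lambda>m. ln (real m)) \<and>
              (\<forall>(F :: 'v simplex list) i M. switchable F i \<and> stores D L F M \<longrightarrow>
                 (case run_state (run_update D L i) (M, 0) of
                    (_, M', t) \<Rightarrow> stores D L (switch F i) M' \<and> real t \<le> b (length F)))))"
proof (intro conjI allI impI)
  fix F :: "'v simplex list" and i assume "switchable F i"
  then obtain k where k: "i = Suc k" "graph_switch F k" by (rule switchable_graph_switch)
  show "update F i (MF F, pairing F) = (MF (switch F i), pairing (switch F i))"
    unfolding k(1) by (rule graph_switch.update_correct[OF k(2)])
next
  assume DL: "dft_tree D \<and> link_cut_tree L"
  then obtain \<beta> where \<beta>: "\<beta> \<in> O(\<lambda>m. ln (real m))" "\<And>m. data_structures D L m (\<beta> m)"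
    using data_structures_bound by blast
  have main: "case run_state (run_update D L i) (M, 0) of
      (_, M', t) \<Rightarrow> stores D L (switch F i) M' \<and> real t \<le> 100 * \<beta> (length F)"
    if sw: "switchable F i" and stores: "stores D L F M" for F :: "'v simplex list" and i M
  proof -
    obtain k where ik: "i = Suc k" "graph_switch F k" using sw by (rule switchable_graph_switch)
    interpret graph_switch F k by (rule ik(2))
    obtain A W where "static_mem F M" "partner_mem (set F) (pairing F) (partner M)" "dft_rep D (dft M) A"
      "tree_mem (set F) (MF F) A (node_of M) (simplex_of M)" "ptrs_mem A (parent_ptr M) (child_ptrs M)"
      "msf_mem L F (lct M) W"
      using stores unfolding stores_iff tree_rep_def by blast
    then have "stored_switch F k D L (\<beta> (length F)) M A W"
      by (intro stored_switch.intro stored_switch_axioms.intro ik(2) \<beta>(2))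
    then show ?thesis using stored_switch.wp_run_update unfolding ik(1) wp_def by fastforce
  qed
  show "\<exists>b :: nat \<Rightarrow> real. b \<in> O(\<lambda>m. ln (real m)) \<and>
      (\<forall>(F :: 'v simplex list) i M. switchable F i \<and> stores D L F M \<longrightarrow>
         (case run_state (run_update D L i) (M, 0) of
            (_, M', t) \<Rightarrow> stores D L (switch F i) M' \<and> real t \<le> b (length F)))"
  \<comment> \<open>The witness depends only on the data structures; the filtration enters through
    its length alone.\<close>
  proof (intro exI[of _ "\<lambda>m. 100 * \<beta> m"] conjI allI impI)
    show "(\<lambda>m. 100 * \<beta> m) \<in> O(\<lambda>m. ln (real m))" using \<beta>(1) by simp
  qed (elim conjE, rule main)
qed

end
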